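(* Let $(X,d_X)$ be a smocked metric space with smocking map $\pi:\mathbb{E}^N\to X$ and smocking set $S$. Let $\bar B_R(p)$ be a closed ball in $(X,d_X)$ and $U_R(p)=\pi^{-1}(\bar B_R(p))\subset\mathbb{E}^N$. Then $\bar B_R(p)$ has a pair of natural integer rectifiable current structures of weight $1$ defined by pushing forward the two oriented local integral current structures $\pm[U_R(p)]$ on $\mathbb{E}^N$: $$T=\pi_\#[U_R(p)]=\sum_{k=0}^\infty\pi_*[A_k],$$ where $$A_k=\big(U_R(p)\cap T_{1/k}(S)\big)\setminus T_{1/(k+1)}(S)\quad(k\ge1),\qquad A_0=U_R(p)\setminus\Big(S\cup\bigcup_{k=1}^\infty A_k\Big),$$ so that for any tuple of functions $(f,h_1,\dots,h_N)$ we have $$T(f,h_1,\dots,h_N)=\sum_{k=0}^\infty\int_{A_k}(f\circ\pi)\,d(h_1\circ\pi)\wedge\cdots\wedge d(h_N\circ\pi).$$ Furthermore the mass satisfies $\mathbf M(T)=\mathrm{Vol}(U_R(p))$.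
   Context: **Smocked metric spaces.** Let $\mathcal I=\{I_j: j\in J\}$ be a finite or countable collection of disjoint connected compact subsets (smocking intervals, or stitches) of Euclidean space $\mathbb{E}^N$ with positive separation factor $\delta=\min\{|z-z'|: z\in I_j, z'\in I_{j'}, j\ne j'\in J\}>0$. Let $S=\bigcup_{j\in J} I_j$ (the smocking set). The smocked metric space is $X=(\mathbb{E}^N\setminus S)\cup\mathcal I$ (each $I_j$ is regarded as a single point). The smocking map $\pi:\mathbb{E}^N\to X$ is $\pi(x)=x$ for $x\notin S$ and $\pi(x)=I_j$ for $x\in I_j$. Put $d_0(v,w)=|v-w|$ and, for $k\ge1$, $$d_k(v,w)=\min\Big\{|v-z_1|+\sum_{i=1}^{k-1}|z_i'-z_{i+1}|+|z_k'-w| : z_i,z_i'\in I_{j_i},\ j_1\neq\cdots\neq j_k\in J\Big\}.$$ The metric $d_X$ on $X$ is given by $d_X(\pi(v),\pi(w))=\min\{d_k(v',w'):\pi(v')=\pi(v),\pi(w')=\pi(w),k\ge0\}$. $T_r(S)=\{x\in\mathbb{E}^N:|x-z|<r\text{ for some }z\in S\}$ is the tubular neighborhood. **Currents (Ambrosio-Kirchheim).** On a complete metric space $Z$, $N$-dimensional currents act on tuples $(f_0,f_1,\dots,f_N)$ with all $f_i:Z\to\mathbb{R}$ Lipschitz and $f_0$ bounded. For a precompact Borel set $A\subset\mathbb{E}^N$ and a Lipschitz map $\varphi:A\to Z$, $$\varphi_*[A](f_0,\dots,f_N)=\int_A (f_0\circ\varphi)\,d(f_1\circ\varphi)\wedge\cdots\wedge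 d(f_N\circ\varphi).$$ The push-forward of a current $T$ by a Lipschitz map $\psi$ is $\psi_\#T(f_0,\dots,f_N)=T(f_0\circ\psi,\dots,f_N\circ\psi)$, and $[A]$ denotes integration over $A\subset\mathbb{E}^N$. The mass $\mathbf M(T)$ is the Ambrosio-Kirchheim mass: the total mass of the least finite Borel measure $\mu$ with $|T(f_0,\dots,f_N)|\le\prod_{i\ge1}\mathrm{Lip}(f_i)\int|f_0|\,d\mu$ for all tuples. **Integer rectifiable current structure.** A complete metric space $(Y,d)$ has an integer rectifiable current structure $T=\sum_i a_i\,\varphi_{i*}[A_i]$ if there are countably many weights $a_i\in\mathbb{Z}$ and bi-Lipschitz charts $\varphi_i:A_i\to\varphi_i(A_i)\subset Y$ from Borel sets $A_i\subset\mathbb{E}^N$ with pairwise disjoint images, with $\sum_i|a_i|\mathrm{Lip}(\varphi_i)^N\mathrm{Vol}(A_i)<\infty$ and $\mathcal H^N\big(Y\setminus\bigcup_i\varphi_i(A_i)\big)=0$. It has weight $1$ if all $a_i=1$. (A map is bi-Lipschitz if it is a bijection and both it and its inverse are Lipschitz.)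
   Formalization: The mass is proved to be Vol(U_R(p)∖S), and Vol(U_R(p)) only when U_R(p)∩S has volume zero; the stated M(T)=Vol(U_R(p)) fails for stitches of positive volume, e.g. a closed unit ball as the only stitch. *)

theory Defs
  imports "HOL-Analysis.Analysis"
begin

section \<open>Smocked metric spaces\<close>

text \<open>The separation factor is required to be positive in the form of a common positive lower
  bound, so that no convention is needed when there are fewer than two stitches.\<close>

definition smocking :: "'a::euclidean_space set set \<Rightarrow> bool" where
  "smocking \<I> \<longleftrightarrow> countable \<I> \<and> disjoint \<I> \<and>
     (\<forall>I\<in>\<I>. I \<noteq> {} \<and> connected I \<and> compact I) \<and>
     (\<exists>\<delta>>0. \<forall>I\<in>\<I>. \<forall>I'\<in>\<I>. I \<noteq> I' \<longrightarrow> (\<forall>z\<in>I. \<forall>z'\<in>I'. \<delta> \<le> dist z z'))"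

text \<open>Points of the smocked space are \<open>Inl x\<close> for \<open>x\<close> outside the smocking set and \<open>Inr I\<close> for
  a stitch \<open>I\<close>.\<close>

definition smocked_points :: "'a set set \<Rightarrow> ('a + 'a set) set" where
  "smocked_points \<I> = (- \<Union>\<I>) <+> \<I>"

definition smocking_map :: "'a set set \<Rightarrow> 'a \<Rightarrow> 'a + 'a set" where
  "smocking_map \<I> x = (if x \<in> \<Union>\<I> then Inr (THE I. I \<in> \<I> \<and> x \<in> I) else Inl x)"

definition stitch_chain ::
    "'a set set \<Rightarrow> nat \<Rightarrow> (nat \<Rightarrow> 'a set) \<Rightarrow> (nat \<Rightarrow> 'a) \<Rightarrow> (nat \<Rightarrow> 'a) \<Rightarrow> bool" where
  "stitch_chain \<I> k I z z' \<longleftrightarrow>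
     (\<forall>i\<in>{1..k}. I i \<in> \<I> \<and> z i \<in> I i \<and> z' i \<in> I i) \<and> (\<forall>i\<in>{1..<k}. I i \<noteq> I (i + 1))"

text \<open>The value is \<open>\<infinity>\<close> if there is no chain of \<open>k\<close> consecutively distinct stitches, which happens
  when there are fewer than two of them.\<close>

definition smocking_dk :: "'a::metric_space set set \<Rightarrow> nat \<Rightarrow> 'a \<Rightarrow> 'a \<Rightarrow> ereal" where
  "smocking_dk \<I> k v w =
     (if k = 0 then ereal (dist v w)
      else INF (I, z, z') \<in> {(I, z, z'). stitch_chain \<I> k I z z'}.
             ereal (dist v (z 1) + (\<Sum>i=1..k-1. dist (z' i) (z (i + 1))) + dist (z' k) w))"

definition smocked_dist :: "'a::metric_space set set \<Rightarrow> 'a + 'a set \<Rightarrow> 'a + 'a set \<Rightarrow> real" where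
  "smocked_dist \<I> x y =
     real_of_ereal (INF (k, v, w) \<in> {(k, v, w). smocking_map \<I> v = x \<and> smocking_map \<I> w = y}.
       smocking_dk \<I> k v w)"

definition smocked_space :: "'a::metric_space set set \<Rightarrow> ('a + 'a set) metric" where
  "smocked_space \<I> = metric (smocked_points \<I>, smocked_dist \<I>)"

definition tubular_nbhd :: "real \<Rightarrow> 'a::metric_space set \<Rightarrow> 'a set" where
  "tubular_nbhd r S = {x. \<exists>z\<in>S. dist x z < r}"

definition smocking_shell :: "'a::metric_space set \<Rightarrow> 'a set \<Rightarrow> nat \<Rightarrow> 'a set" where
  "smocking_shell S U k = (U \<inter> tubular_nbhd (1 / real k) S) - tubular_nbhd (1 / real (k + 1)) S"

definition smocking_piece :: "'a::metric_space set \<Rightarrow> 'a set \<Rightarrow> nat \<Rightarrow> 'a set" where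
  "smocking_piece S U k =
     (if k = 0 then U - (S \<union> (\<Union>j\<in>{1..}. smocking_shell S U j)) else smocking_shell S U k)"


section \<open>Currents\<close>

definition lip_const :: "'a metric \<Rightarrow> 'b metric \<Rightarrow> ('a \<Rightarrow> 'b) \<Rightarrow> real" where
  "lip_const X Y f =
     Inf {L. 0 \<le> L \<and> (\<forall>x\<in>mspace X. \<forall>y\<in>mspace X. mdist Y (f x) (f y) \<le> L * mdist X x y)}"

text \<open>An \<open>N\<close>-dimensional current takes a function \<open>f\<close> and a family \<open>h\<close> of \<open>N\<close> functions.  The
  family is indexed by the same finite type \<open>'n\<close> as the coordinates of \<open>real ^ 'n\<close>, so that
  \<open>dh\<^sub>1 \<and> \<dots> \<and> dh\<^sub>N\<close> is the Jacobian determinant of \<open>h\<close>, whatever order is chosen on \<open>'n\<close>.\<close>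

type_synonym ('y, 'n) current = "('y \<Rightarrow> real) \<Rightarrow> ('n \<Rightarrow> 'y \<Rightarrow> real) \<Rightarrow> real"

definition current_tuple :: "'y metric \<Rightarrow> ('y \<Rightarrow> real) \<Rightarrow> ('n \<Rightarrow> 'y \<Rightarrow> real) \<Rightarrow> bool" where
  "current_tuple Y f h \<longleftrightarrow>
     Lipschitz_continuous_map Y euclidean_metric f \<and> bounded (f ` mspace Y) \<and>
     (\<forall>i. Lipschitz_continuous_map Y euclidean_metric (h i))"

text \<open>The functions \<open>g i\<close> may be Lipschitz on \<open>A\<close> only, hence the derivative is taken within \<open>A\<close>.
  It exists at almost every point of \<open>A\<close> (extend \<open>g\<close> and apply Rademacher's theorem) and is unique
  at every density point of \<open>A\<close>, hence almost everywhere; on the remaining null set the integrand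
  is arbitrary, which is why the integral is over \<^term>\<open>lebesgue\<close>.\<close>

definition integration_current :: "(real ^ 'n) set \<Rightarrow> (real ^ 'n, 'n::finite) current" where
  "integration_current A f g =
     (LINT x:A|lebesgue.
        f x * det (matrix (frechet_derivative (\<lambda>x. \<chi> i. g i x) (at x within A))))"

definition pushforward :: "('x \<Rightarrow> 'y) \<Rightarrow> ('x, 'n) current \<Rightarrow> ('y, 'n) current" where
  "pushforward \<psi> T f h = T (f \<circ> \<psi>) (\<lambda>i. h i \<circ> \<psi>)"

definition current_dominated_by :: "'y metric \<Rightarrow> ('y, 'n::finite) current \<Rightarrow> 'y measure \<Rightarrow> bool" where
  "current_dominated_by Y T \<mu> \<longleftrightarrow>
     space \<mu> = mspace Y \<and> sets \<mu> = sigma_sets (mspace Y) {V. openin (mtopology_of Y) V} \<and>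
     finite_measure \<mu> \<and>
     (\<forall>f h. current_tuple Y f h \<longrightarrow>
        \<bar>T f h\<bar> \<le> (\<Prod>i\<in>UNIV. lip_const Y euclidean_metric (h i)) * (LINT x|\<mu>. \<bar>f x\<bar>))"

definition has_mass :: "'y metric \<Rightarrow> ('y, 'n::finite) current \<Rightarrow> ennreal \<Rightarrow> bool" where
  "has_mass Y T m \<longleftrightarrow>
     (\<exists>\<mu>. current_dominated_by Y T \<mu> \<and>
        (\<forall>\<nu>. current_dominated_by Y T \<nu> \<longrightarrow> (\<forall>B\<in>sets \<mu>. emeasure \<mu> B \<le> emeasure \<nu> B)) \<and>
        m = emeasure \<mu> (mspace Y))"


section \<open>Integer rectifiable current structures\<close>

definition metric_diam :: "'y metric \<Rightarrow> 'y set \<Rightarrow> ennreal" where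
  "metric_diam Y C = (SUP x\<in>C. SUP y\<in>C. ennreal (mdist Y x y))"

text \<open>Only meant for \<open>n \<ge> 1\<close>: for \<open>n = 0\<close> the empty sets of a cover would count.\<close>

definition hausdorff_measure :: "'y metric \<Rightarrow> nat \<Rightarrow> 'y set \<Rightarrow> ennreal" where
  "hausdorff_measure Y n E =
     (SUP \<delta>\<in>{0<..}.
        INF C\<in>{C :: nat \<Rightarrow> 'y set.
                (\<forall>i. C i \<subseteq> mspace Y \<and> metric_diam Y (C i) \<le> \<delta>) \<and> E \<subseteq> (\<Union>i. C i)}.
          (\<Sum>i. ennreal (unit_ball_vol (real n)) * (metric_diam Y (C i) / 2) ^ n))"

definition bi_lipschitz_chart :: "'y metric \<Rightarrow> ('x::metric_space \<Rightarrow> 'y) \<Rightarrow> 'x set \<Rightarrow> bool" where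
  "bi_lipschitz_chart Y \<phi> A \<longleftrightarrow>
     Lipschitz_continuous_map (submetric euclidean_metric A) Y \<phi> \<and> inj_on \<phi> A \<and>
     Lipschitz_continuous_map (submetric Y (\<phi> ` A)) (submetric euclidean_metric A) (inv_into A \<phi>)"

text \<open>Domains \<open>A i\<close> may be empty, so finite families of charts are covered.  They are bounded because
  \<open>\<phi>\<^sub>*[A]\<close> is a current only for precompact \<open>A\<close>.\<close>

definition int_rect_structure ::
    "'y metric \<Rightarrow> ('y, 'n::finite) current \<Rightarrow> (nat \<Rightarrow> int) \<Rightarrow> (nat \<Rightarrow> real ^ 'n \<Rightarrow> 'y) \<Rightarrow>
     (nat \<Rightarrow> (real ^ 'n) set) \<Rightarrow> bool" where
  "int_rect_structure Y T a \<phi> A \<longleftrightarrow>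
     mcomplete_of Y \<and>
     (\<forall>i. A i \<in> sets borel \<and> bounded (A i) \<and> bi_lipschitz_chart Y (\<phi> i) (A i)) \<and>
     disjoint_family (\<lambda>i. \<phi> i ` A i) \<and>
     (\<Sum>i. ennreal (\<bar>real_of_int (a i)\<bar> *
              lip_const (submetric euclidean_metric (A i)) Y (\<phi> i) ^ CARD('n)) *
            emeasure lborel (A i)) < \<infinity> \<and>
     hausdorff_measure Y CARD('n) (mspace Y - (\<Union>i. \<phi> i ` A i)) = 0 \<and>
     (\<forall>f h. current_tuple Y f h \<longrightarrow>
        (\<lambda>i. real_of_int (a i) * pushforward (\<phi> i) (integration_current (A i)) f h) sums T f h)"

definition weight_one_structure ::
    "'y metric \<Rightarrow> ('y, 'n::finite) current \<Rightarrow> (nat \<Rightarrow> real ^ 'n \<Rightarrow> 'y) \<Rightarrow>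
     (nat \<Rightarrow> (real ^ 'n) set) \<Rightarrow> bool" where
  "weight_one_structure Y T \<phi> A \<longleftrightarrow> int_rect_structure Y T (\<lambda>_. 1) \<phi> A"

section \<open>The smocked distance is a metric\<close>

text \<open>This makes \<^const>\<open>smocked_space\<close> meaningful, since \<^const>\<open>metric\<close> is unspecified off metric
  spaces.  Chains of consecutively distinct stitches are compared with lists of pairs of points
  identified by the smocking map, which are closed under concatenation.\<close>

fun jump_length :: "'a::metric_space \<Rightarrow> ('a \<times> 'a) list \<Rightarrow> 'a \<Rightarrow> real" where
  "jump_length v [] w = dist v w" |
  "jump_length v ((a, b) # ps) w = dist v a + jump_length b ps w"

definition jump_list :: "'a set set \<Rightarrow> ('a \<times> 'a) list \<Rightarrow> bool" where
  "jump_list \<I> ps \<longleftrightarrow> (\<forall>(a, b)\<in>set ps. smocking_map \<I> a = smocking_map \<I> b)"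

lemma jump_list_simps [simp]:
  "jump_list \<I> []"
  "jump_list \<I> ((a, b) # ps) \<longleftrightarrow> smocking_map \<I> a = smocking_map \<I> b \<and> jump_list \<I> ps"
  "jump_list \<I> (ps @ qs) \<longleftrightarrow> jump_list \<I> ps \<and> jump_list \<I> qs"
  by (auto simp: jump_list_def)

lemma jump_length_nonneg: "0 \<le> jump_length v ps w"
  by (induction ps arbitrary: v) auto

lemma jump_length_triangle: "jump_length v ps w \<le> dist v a + jump_length a ps w"
proof (cases ps)
  case Nil
  then show ?thesis by (simp add: dist_triangle)
next
  case (Cons p qs)
  obtain c e where "p = (c, e)" by (cases p)
  then show ?thesis using Cons dist_triangle[of v c a] by simp
qed

lemma jump_length_append:
  "jump_length v (ps @ (a, b) # qs) w = jump_length v ps a + jump_length b qs w"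
  by (induction ps arbitrary: v) auto

lemma jump_length_sum:
  assumes "ps \<noteq> []"
  shows "jump_length v ps w = dist v (fst (ps ! 0)) +
           (\<Sum>i<length ps - 1. dist (snd (ps ! i)) (fst (ps ! Suc i))) +
           dist (snd (ps ! (length ps - 1))) w"
  using assms
proof (induction ps arbitrary: v)
  case Nil
  then show ?case by simp
next
  case (Cons p ps)
  obtain a b where p: "p = (a, b)" by (cases p)
  show ?case
  proof (cases ps)
    case Nil
    then show ?thesis by (simp add: p)
  next
    case (Cons q qs)
    have "jump_length v (p # ps) w = dist v a + jump_length b ps w"
      by (simp add: p)
    also have "jump_length b ps w = dist b (fst (ps ! 0)) +
           (\<Sum>i<length ps - 1. dist (snd (ps ! i)) (fst (ps ! Suc i))) +
           dist (snd (ps ! (length ps - 1))) w"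
      by (rule Cons.IH) (simp add: Cons)
    finally have *: "jump_length v (p # ps) w = dist v a + (dist b (fst (ps ! 0)) +
           (\<Sum>i<length ps - 1. dist (snd (ps ! i)) (fst (ps ! Suc i))) +
           dist (snd (ps ! (length ps - 1))) w)" .
    have len: "length (p # ps) - 1 = Suc (length ps - 1)"
      by (simp add: Cons)
    show ?thesis
      unfolding * len sum.lessThan_Suc_shift by (simp add: p)
  qed
qed

lemma smocking_dk_le_chain:
  assumes "k > 0" "stitch_chain \<I> k I z z'"
  shows "smocking_dk \<I> k v w \<le>
    ereal (dist v (z 1) + (\<Sum>i=1..k-1. dist (z' i) (z (i + 1))) + dist (z' k) w)"
proof -
  let ?F = "\<lambda>(I :: nat \<Rightarrow> 'a set, z, z').
    ereal (dist v (z 1) + (\<Sum>i=1..k-1. dist (z' i) (z (i + 1))) + dist (z' k) w)"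
  have "smocking_dk \<I> k v w = (INF t \<in> {(I, z, z'). stitch_chain \<I> k I z z'}. ?F t)"
    using assms(1) by (simp add: smocking_dk_def)
  also have "\<dots> \<le> ?F (I, z, z')"
    by (rule INF_lower) (simp add: assms(2))
  finally show ?thesis by simp
qed

context
  fixes \<I> :: "'a::euclidean_space set set"
  assumes smock: "smocking \<I>"
begin

lemma stitch_unique:
  assumes "I \<in> \<I>" "I' \<in> \<I>" "x \<in> I" "x \<in> I'"
  shows "I = I'"
proof (rule ccontr)
  assume "I \<noteq> I'"
  moreover have "disjoint \<I>" using smock by (simp only: smocking_def)
  ultimately have "I \<inter> I' = {}" using assms(1,2) by (intro disjointD)
  then show False using assms(3,4) by blast
qed

lemma stitch_compact: "\<forall>I\<in>\<I>. I \<noteq> {} \<and> connected I \<and> compact I"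
  using smock unfolding smocking_def by (elim conjE)

lemma smocking_map_stitch:
  assumes "I \<in> \<I>" "x \<in> I"
  shows "smocking_map \<I> x = Inr I"
proof -
  have "(THE I. I \<in> \<I> \<and> x \<in> I) = I"
    using assms stitch_unique[OF _ assms(1) _ assms(2)] by (intro the_equality) blast+
  moreover have "x \<in> \<Union>\<I>" using assms by blast
  ultimately show ?thesis
    by (simp only: smocking_map_def if_True)
qed

lemma smocking_map_outside: "x \<notin> \<Union>\<I> \<Longrightarrow> smocking_map \<I> x = Inl x"
  unfolding smocking_map_def by (rule if_not_P)

lemma smocking_map_eq_iff:
  "smocking_map \<I> x = smocking_map \<I> y \<longleftrightarrow> x = y \<or> (\<exists>I\<in>\<I>. x \<in> I \<and> y \<in> I)"
proof
  assume eq: "smocking_map \<I> x = smocking_map \<I> y"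
  show "x = y \<or> (\<exists>I\<in>\<I>. x \<in> I \<and> y \<in> I)"
  proof (cases "x \<in> \<Union>\<I>")
    case True
    then obtain I where I: "I \<in> \<I>" "x \<in> I" by blast
    have "y \<in> \<Union>\<I>"
    proof (rule ccontr)
      assume "y \<notin> \<Union>\<I>"
      from eq[unfolded smocking_map_stitch[OF I] smocking_map_outside[OF this]]
      show False by simp
    qed
    then obtain I' where I': "I' \<in> \<I>" "y \<in> I'" by blast
    from eq[unfolded smocking_map_stitch[OF I] smocking_map_stitch[OF I']]
    show ?thesis using I I' by blast
  next
    case x: False
    have "y \<notin> \<Union>\<I>"
    proof
      assume "y \<in> \<Union>\<I>"
      then obtain I' where I': "I' \<in> \<I>" "y \<in> I'" by blast
      from eq[unfolded smocking_map_outside[OF x] smocking_map_stitch[OF I']]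
      show False by simp
    qed
    from eq[unfolded smocking_map_outside[OF x] smocking_map_outside[OF this]]
    show ?thesis by simp
  qed
next
  assume "x = y \<or> (\<exists>I\<in>\<I>. x \<in> I \<and> y \<in> I)"
  then show "smocking_map \<I> x = smocking_map \<I> y"
  proof
    assume "\<exists>I\<in>\<I>. x \<in> I \<and> y \<in> I"
    then obtain I where "I \<in> \<I>" "x \<in> I" "y \<in> I" by blast
    then show ?thesis by (simp add: smocking_map_stitch)
  qed simp
qed

lemma range_smocking_map: "range (smocking_map \<I>) = smocked_points \<I>"
proof (intro equalityI subsetI)
  fix y assume "y \<in> range (smocking_map \<I>)"
  then obtain x where x: "y = smocking_map \<I> x" by blast
  show "y \<in> smocked_points \<I>"
  proof (cases "x \<in> \<Union>\<I>")
    case True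
    then obtain I where I: "I \<in> \<I>" "x \<in> I" by blast
    show ?thesis
      unfolding x smocked_points_def smocking_map_stitch[OF I] using I by blast
  next
    case False
    then show ?thesis
      unfolding x smocked_points_def smocking_map_outside[OF False] by blast
  qed
next
  fix y assume y: "y \<in> smocked_points \<I>"
  show "y \<in> range (smocking_map \<I>)"
  proof (cases y)
    case (Inl x)
    then have "x \<notin> \<Union>\<I>" using y by (auto simp: smocked_points_def)
    then have "smocking_map \<I> x = y" using Inl smocking_map_outside by simp
    then show ?thesis by blast
  next
    case (Inr I)
    then have I: "I \<in> \<I>" using y by (auto simp: smocked_points_def)
    then have "I \<noteq> {}" using stitch_compact by blast
    then obtain x where "x \<in> I" by blast
    then have "smocking_map \<I> x = y" using I smocking_map_stitch Inr by simp
    then show ?thesis by blast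
  qed
qed

lemma normalize_jump_list:
  assumes "jump_list \<I> ps"
  shows "\<exists>qs. jump_list \<I> qs \<and> (\<forall>q\<in>set qs. fst q \<in> \<Union>\<I>) \<and>
           successively (\<lambda>p q. smocking_map \<I> (fst p) \<noteq> smocking_map \<I> (fst q)) qs \<and>
           jump_length v qs w \<le> jump_length v ps w"
  using assms
proof (induction ps arbitrary: v)
  case Nil
  then show ?case by (intro exI[of _ "[]"]) auto
next
  case (Cons p ps)
  obtain a b where p: "p = (a, b)" by (cases p)
  have *: "smocking_map \<I> a = smocking_map \<I> b \<and> jump_list \<I> ps"
    using Cons.prems unfolding p jump_list_simps .
  note ab = conjunct1[OF *] and ps = conjunct2[OF *]
  show ?case
  proof (cases "a \<in> \<Union>\<I>")
    case False
    then have "b = a" using ab unfolding smocking_map_eq_iff by blast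
    then have "jump_length v ps w \<le> jump_length v (p # ps) w"
      using p jump_length_triangle by simp
    then show ?thesis using Cons.IH[OF ps, of v] order_trans by blast
  next
    case True
    obtain qs where qs: "jump_list \<I> qs" "\<forall>q\<in>set qs. fst q \<in> \<Union>\<I>"
      "successively (\<lambda>p q. smocking_map \<I> (fst p) \<noteq> smocking_map \<I> (fst q)) qs"
      "jump_length b qs w \<le> jump_length b ps w"
      using Cons.IH[OF ps, of b] by blast
    show ?thesis
    proof (cases "qs \<noteq> [] \<and> smocking_map \<I> (fst (hd qs)) = smocking_map \<I> a")
      case False
      have "successively (\<lambda>p q. smocking_map \<I> (fst p) \<noteq> smocking_map \<I> (fst q)) ((a, b) # qs)"
      proof -
        have "qs = [] \<or> smocking_map \<I> a \<noteq> smocking_map \<I> (fst (hd qs))"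
          using False by metis
        then show ?thesis using qs(3) unfolding successively_Cons fst_conv by blast
      qed
      moreover have "jump_list \<I> ((a, b) # qs)"
        using qs(1) ab by (simp only: jump_list_simps)
      moreover have "\<forall>q\<in>set ((a, b) # qs). fst q \<in> \<Union>\<I>"
        using qs(2) True by (simp only: set_simps ball_simps fst_conv)
      moreover have "jump_length v ((a, b) # qs) w \<le> jump_length v (p # ps) w"
        using qs(4) p by simp
      ultimately show ?thesis by blast
    next
      case same: True
      then obtain c e rs where ce: "qs = (c, e) # rs" by (metis neq_Nil_conv surj_pair)
      have ca: "smocking_map \<I> c = smocking_map \<I> a"
        using same unfolding ce by (simp only: list.sel fst_conv)
      have rs: "smocking_map \<I> c = smocking_map \<I> e" "jump_list \<I> rs"
        "\<forall>q\<in>set rs. fst q \<in> \<Union>\<I>"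
        "rs = [] \<or> smocking_map \<I> c \<noteq> smocking_map \<I> (fst (hd rs)) \<and>
           successively (\<lambda>p q. smocking_map \<I> (fst p) \<noteq> smocking_map \<I> (fst q)) rs"
        using qs(1-3) unfolding ce jump_list_simps set_simps ball_simps fst_conv successively_Cons
        by blast+
      have "successively (\<lambda>p q. smocking_map \<I> (fst p) \<noteq> smocking_map \<I> (fst q)) ((a, e) # rs)"
        using rs(4) unfolding ca by (simp only: successively_Cons fst_conv)
      moreover have "jump_list \<I> ((a, e) # rs)"
        using rs(1,2) ca by (simp only: jump_list_simps)
      moreover have "\<forall>q\<in>set ((a, e) # rs). fst q \<in> \<Union>\<I>"
        using rs(3) True by (simp only: set_simps ball_simps fst_conv)
      moreover have "jump_length v ((a, e) # rs) w \<le> jump_length v (p # ps) w"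
        using qs(4) p zero_le_dist[of b c] unfolding ce p jump_length.simps by linarith
      ultimately show ?thesis by blast
    qed
  qed
qed

lemma smocking_dk_le_jump_length:
  assumes "jump_list \<I> ps"
  shows "\<exists>k. smocking_dk \<I> k v w \<le> ereal (jump_length v ps w)"
proof -
  obtain qs where qs: "jump_list \<I> qs" "\<forall>q\<in>set qs. fst q \<in> \<Union>\<I>"
    "successively (\<lambda>p q. smocking_map \<I> (fst p) \<noteq> smocking_map \<I> (fst q)) qs"
    and le: "jump_length v qs w \<le> jump_length v ps w"
    using normalize_jump_list[OF assms] by blast
  show ?thesis
  proof (cases "qs = []")
    case True
    then show ?thesis using le by (intro exI[of _ 0]) (simp add: smocking_dk_def)
  next
    case False
    define k where "k = length qs"
    define z where "z = (\<lambda>i. fst (qs ! (i - 1)))"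
    define z' where "z' = (\<lambda>i. snd (qs ! (i - 1)))"
    define I where "I = (\<lambda>i. SOME I. I \<in> \<I> \<and> z i \<in> I)"
    have k: "k > 0" using False by (simp add: k_def)
    have zI: "I i \<in> \<I> \<and> z i \<in> I i" if "i \<in> {1..k}" for i
    proof -
      have "qs ! (i - 1) \<in> set qs" using that by (auto simp: k_def)
      then have "\<exists>I. I \<in> \<I> \<and> z i \<in> I" using qs(2) by (auto simp: z_def)
      then show ?thesis unfolding I_def by (rule someI_ex)
    qed
    have zz': "smocking_map \<I> (z i) = smocking_map \<I> (z' i)" if "i \<in> {1..k}" for i
    proof -
      have "qs ! (i - 1) \<in> set qs" using that by (auto simp: k_def)
      then show ?thesis using qs(1) unfolding z_def z'_def jump_list_def case_prod_beta by blast
    qed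
    have z'I: "z' i \<in> I i" if "i \<in> {1..k}" for i
    proof -
      have "z i = z' i \<or> (\<exists>I'\<in>\<I>. z i \<in> I' \<and> z' i \<in> I')"
        using zz'[OF that] unfolding smocking_map_eq_iff .
      then show ?thesis using zI[OF that] stitch_unique by fastforce
    qed
    have "I i \<noteq> I (i + 1)" if "i \<in> {1..<k}" for i
    proof
      assume "I i = I (i + 1)"
      moreover have "i \<in> {1..k}" "i + 1 \<in> {1..k}" using that by auto
      ultimately have "smocking_map \<I> (z i) = smocking_map \<I> (z (i + 1))"
        using zI[of i] zI[of "i + 1"] unfolding smocking_map_eq_iff by metis
      moreover have "smocking_map \<I> (fst (qs ! (i - 1))) \<noteq> smocking_map \<I> (fst (qs ! Suc (i - 1)))"
      proof -
        have "Suc (i - 1) < length qs" using that by (auto simp: k_def)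
        then show ?thesis using qs(3) unfolding successively_conv_nth by blast
      qed
      moreover have "Suc (i - 1) = i + 1 - 1" using that by simp
      ultimately show False unfolding z_def by metis
    qed
    then have ch: "stitch_chain \<I> k I z z'"
      using zI z'I by (simp add: stitch_chain_def)
    have "(\<Sum>i<k - 1. dist (snd (qs ! i)) (fst (qs ! Suc i))) =
          (\<Sum>i=1..k-1. dist (z' i) (z (i + 1)))"
      by (rule sum.reindex_bij_witness[of _ "\<lambda>i. i - 1" Suc]) (auto simp: z_def z'_def)
    then have len: "jump_length v qs w =
        dist v (z 1) + (\<Sum>i=1..k-1. dist (z' i) (z (i + 1))) + dist (z' k) w"
      using jump_length_sum[OF False, of v w] by (simp add: z_def z'_def k_def)
    have "smocking_dk \<I> k v w \<le> ereal (jump_length v qs w)"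
      unfolding len by (rule smocking_dk_le_chain[OF k ch])
    then show ?thesis using le by (meson ereal_less_eq(3) order_trans)
  qed
qed

lemma smocking_dk_ge:
  assumes "\<And>ps. jump_list \<I> ps \<Longrightarrow> c \<le> ereal (jump_length v ps w)"
  shows "c \<le> smocking_dk \<I> k v w"
proof (cases "k = 0")
  case True
  then show ?thesis using assms[of "[]"] by (simp add: smocking_dk_def)
next
  case False
  have "c \<le> ereal (dist v (z 1) + (\<Sum>i=1..k-1. dist (z' i) (z (i + 1))) + dist (z' k) w)"
    if ch: "stitch_chain \<I> k I z z'" for I z z'
  proof -
    define ps where "ps = map (\<lambda>i. (z (Suc i), z' (Suc i))) [0..<k]"
    have "smocking_map \<I> (z (Suc i)) = smocking_map \<I> (z' (Suc i))" if "i < k" for i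
      using ch that unfolding stitch_chain_def smocking_map_eq_iff by force
    then have ps: "jump_list \<I> ps" by (auto simp: jump_list_def ps_def)
    have "(\<Sum>i<k - 1. dist (snd (ps ! i)) (fst (ps ! Suc i))) =
          (\<Sum>i=1..k-1. dist (z' i) (z (i + 1)))"
      by (rule sum.reindex_bij_witness[of _ "\<lambda>i. i - 1" Suc]) (auto simp: ps_def)
    then have "jump_length v ps w =
        dist v (z 1) + (\<Sum>i=1..k-1. dist (z' i) (z (i + 1))) + dist (z' k) w"
      using jump_length_sum[of ps v w] False by (simp add: ps_def)
    then show ?thesis using assms[OF ps] by simp
  qed
  then show ?thesis using False by (auto simp: smocking_dk_def intro!: INF_greatest)
qed

lemma smocked_dist_nonneg: "0 \<le> smocked_dist \<I> x y"
  unfolding smocked_dist_def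
  by (intro real_of_ereal_pos INF_greatest)
     (auto intro!: smocking_dk_ge simp: jump_length_nonneg)

lemma smocking_dk_commute_le: "smocking_dk \<I> k v w \<le> smocking_dk \<I> k w v"
proof (cases "k = 0")
  case True
  then show ?thesis by (simp add: smocking_dk_def dist_commute)
next
  case False
  have "smocking_dk \<I> k v w \<le>
      ereal (dist w (z 1) + (\<Sum>i=1..k-1. dist (z' i) (z (i + 1))) + dist (z' k) v)"
    if ch: "stitch_chain \<I> k I z z'" for I z z'
  proof -
    define f where "f = (\<lambda>i. k + 1 - i)"
    have "I (f i) \<noteq> I (f (i + 1))" if "i \<in> {1..<k}" for i
    proof -
      have "f i = f (i + 1) + 1" "f (i + 1) \<in> {1..<k}" using that by (auto simp: f_def)
      then show ?thesis using ch unfolding stitch_chain_def by metis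
    qed
    moreover have "f i \<in> {1..k}" if "i \<in> {1..k}" for i
      using that by (auto simp: f_def)
    ultimately have ch': "stitch_chain \<I> k (I \<circ> f) (z' \<circ> f) (z \<circ> f)"
      using ch unfolding stitch_chain_def by simp
    have "(\<Sum>i=1..k-1. dist ((z \<circ> f) i) ((z' \<circ> f) (i + 1))) =
          (\<Sum>i=1..k-1. dist (z' i) (z (i + 1)))"
      by (rule sum.reindex_bij_witness[of _ "\<lambda>i. k - i" "\<lambda>i. k - i"])
         (auto simp: f_def dist_commute Suc_diff_le)
    moreover have "dist v ((z' \<circ> f) 1) = dist (z' k) v" "dist ((z \<circ> f) k) w = dist w (z 1)"
      by (auto simp: f_def dist_commute)
    ultimately have eq: "dist w (z 1) + (\<Sum>i=1..k-1. dist (z' i) (z (i + 1))) + dist (z' k) v =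
        dist v ((z' \<circ> f) 1) + (\<Sum>i=1..k-1. dist ((z \<circ> f) i) ((z' \<circ> f) (i + 1))) +
        dist ((z \<circ> f) k) w" by linarith
    show ?thesis
      unfolding eq using False by (intro smocking_dk_le_chain[OF _ ch']) simp
  qed
  then have "smocking_dk \<I> k v w \<le> (INF (I, z, z') \<in> {(I, z, z'). stitch_chain \<I> k I z z'}.
      ereal (dist w (z 1) + (\<Sum>i=1..k-1. dist (z' i) (z (i + 1))) + dist (z' k) v))"
    by (auto intro!: INF_greatest)
  then show ?thesis
    using False by (simp add: smocking_dk_def)
qed

lemma smocked_dist_commute: "smocked_dist \<I> x y = smocked_dist \<I> y x"
proof -
  have "smocking_dk \<I> k v w = smocking_dk \<I> k w v" for k v w
    by (intro antisym smocking_dk_commute_le)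
  then have "(\<lambda>(k, v, w). smocking_dk \<I> k v w) ` {(k, v, w). smocking_map \<I> v = x \<and> smocking_map \<I> w = y} =
    (\<lambda>(k, v, w). smocking_dk \<I> k v w) ` {(k, v, w). smocking_map \<I> v = y \<and> smocking_map \<I> w = x}"
    by (force simp: image_iff)
  then show ?thesis by (simp add: smocked_dist_def)
qed

lemma smocked_dist_props:
  fixes v w
  defines "x \<equiv> smocking_map \<I> v" and "y \<equiv> smocking_map \<I> w"
  shows smocked_dist_le: "jump_list \<I> ps \<Longrightarrow> smocked_dist \<I> x y \<le> jump_length v ps w"
    and smocked_dist_ge:
      "(\<And>v' w' ps. smocking_map \<I> v' = x \<Longrightarrow> smocking_map \<I> w' = y \<Longrightarrow> jump_list \<I> ps \<Longrightarrow>
          c \<le> jump_length v' ps w') \<Longrightarrow> c \<le> smocked_dist \<I> x y"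
proof -
  let ?D = "INF (k, v, w) \<in> {(k, v, w). smocking_map \<I> v = x \<and> smocking_map \<I> w = y}.
       smocking_dk \<I> k v w"
  have upper: "?D \<le> ereal (jump_length v ps w)" if ps: "jump_list \<I> ps" for ps
  proof -
    obtain k where k: "smocking_dk \<I> k v w \<le> ereal (jump_length v ps w)"
      using smocking_dk_le_jump_length[OF ps] by blast
    then show ?thesis by (intro INF_lower2[of "(k, v, w)"]) (auto simp: x_def y_def)
  qed
  have "0 \<le> ?D"
    by (intro INF_greatest) (auto intro!: smocking_dk_ge simp: jump_length_nonneg)
  then have fin: "ereal (smocked_dist \<I> x y) = ?D"
    using upper[of "[]"] unfolding smocked_dist_def by (intro ereal_real') auto
  show "smocked_dist \<I> x y \<le> jump_length v ps w" if "jump_list \<I> ps"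
    using upper[OF that] by (simp flip: fin)
  show "c \<le> smocked_dist \<I> x y"
    if c: "\<And>v' w' ps. smocking_map \<I> v' = x \<Longrightarrow> smocking_map \<I> w' = y \<Longrightarrow> jump_list \<I> ps \<Longrightarrow>
          c \<le> jump_length v' ps w'"
  proof -
    have "ereal c \<le> ?D"
      by (intro INF_greatest) (auto intro!: smocking_dk_ge c)
    then show ?thesis by (simp flip: fin)
  qed
qed

lemma fibre_isolated:
  assumes "smocking_map \<I> w \<noteq> smocking_map \<I> v"
  obtains r where "r > 0"
    "\<And>v' a. smocking_map \<I> v' = smocking_map \<I> v \<Longrightarrow> smocking_map \<I> a \<noteq> smocking_map \<I> v \<Longrightarrow>
       a \<in> \<Union>\<I> \<or> smocking_map \<I> a = smocking_map \<I> w \<Longrightarrow> r \<le> dist v' a"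
proof -
  obtain \<delta> where \<delta>: "\<delta> > 0" and sep: "\<And>I I' z z'. I \<in> \<I> \<Longrightarrow> I' \<in> \<I> \<Longrightarrow> I \<noteq> I' \<Longrightarrow>
      z \<in> I \<Longrightarrow> z' \<in> I' \<Longrightarrow> \<delta> \<le> dist z z'"
    using smock unfolding smocking_def by metis
  have point: "\<exists>r>0. \<forall>a\<in>\<Union>\<I>. r \<le> dist x a" if x: "x \<notin> \<Union>\<I>" for x
  proof (cases "\<exists>I\<in>\<I>. \<exists>a\<in>I. dist x a < \<delta> / 2")
    case False
    then show ?thesis using \<delta> by (intro exI[of _ "\<delta> / 2"]) force
  next
    case True
    then obtain I b where I: "I \<in> \<I>" "b \<in> I" "dist x b < \<delta> / 2" by blast
    have "closed I" using I(1) stitch_compact compact_imp_closed by blast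
    then obtain e where e: "e > 0" "\<forall>a\<in>I. e \<le> dist x a"
      using separate_point_closed[of I x] I x by blast
    have "min e (\<delta> / 2) \<le> dist x a" if a: "a \<in> I'" "I' \<in> \<I>" for a I'
    proof (cases "I' = I")
      case True
      then show ?thesis using e a by force
    next
      case False
      then have "\<delta> \<le> dist b a" using sep I a by metis
      also have "\<dots> \<le> dist x b + dist x a" using dist_triangle2[of b a x] by (simp add: dist_commute)
      finally show ?thesis using I by linarith
    qed
    then show ?thesis using e \<delta> by (intro exI[of _ "min e (\<delta> / 2)"]) auto
  qed
  show thesis
  proof (cases "v \<in> \<Union>\<I>")
    case False
    obtain r where r: "r > 0" "\<And>a. a \<in> \<Union>\<I> \<Longrightarrow> r \<le> dist v a" using point[OF False] by blast
    have vw: "v \<noteq> w" using assms by auto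
    show thesis
    proof (rule that[of "min r (dist v w)"])
      show "0 < min r (dist v w)" using r vw by simp
      fix v' a
      assume *: "smocking_map \<I> v' = smocking_map \<I> v"
        "a \<in> \<Union>\<I> \<or> smocking_map \<I> a = smocking_map \<I> w"
      have "v' = v" using * False unfolding smocking_map_eq_iff by blast
      moreover have "a \<in> \<Union>\<I> \<or> a = w" using * unfolding smocking_map_eq_iff by blast
      ultimately show "min r (dist v w) \<le> dist v' a" using r by force
    qed
  next
    case True
    then obtain I where I: "I \<in> \<I>" "v \<in> I" by blast
    have in_I: "v' \<in> I" if "smocking_map \<I> v' = smocking_map \<I> v" for v'
      using that I stitch_unique unfolding smocking_map_eq_iff by metis
    have far: "\<delta> \<le> dist v' a"
      if v': "smocking_map \<I> v' = smocking_map \<I> v" and a: "smocking_map \<I> a \<noteq> smocking_map \<I> v"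
        and aS: "a \<in> \<Union>\<I>" for v' a
    proof -
      obtain I' where I': "I' \<in> \<I>" "a \<in> I'" using aS by blast
      then have "I \<noteq> I'" using a I unfolding smocking_map_eq_iff by blast
      then show ?thesis by (rule sep[OF I(1) I'(1) _ in_I[OF v'] I'(2)])
    qed
    show thesis
    proof (cases "w \<in> \<Union>\<I>")
      case wS: True
      show thesis
      proof (rule that[OF \<delta>])
        fix v' a
        assume *: "smocking_map \<I> v' = smocking_map \<I> v" "smocking_map \<I> a \<noteq> smocking_map \<I> v"
          "a \<in> \<Union>\<I> \<or> smocking_map \<I> a = smocking_map \<I> w"
        then have "a \<in> \<Union>\<I>" using wS unfolding smocking_map_eq_iff by blast
        then show "\<delta> \<le> dist v' a" using far * by blast
      qed
    next
      case wS: False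
      obtain r where r: "r > 0" "\<And>a. a \<in> \<Union>\<I> \<Longrightarrow> r \<le> dist w a" using point[OF wS] by blast
      show thesis
      proof (rule that[of "min \<delta> r"])
        show "0 < min \<delta> r" using \<delta> r by simp
        fix v' a
        assume *: "smocking_map \<I> v' = smocking_map \<I> v" "smocking_map \<I> a \<noteq> smocking_map \<I> v"
          "a \<in> \<Union>\<I> \<or> smocking_map \<I> a = smocking_map \<I> w"
        have "a \<in> \<Union>\<I> \<or> a = w" using * unfolding smocking_map_eq_iff by blast
        then show "min \<delta> r \<le> dist v' a"
        proof
          assume "a \<in> \<Union>\<I>"
          then show ?thesis using far[of v' a] * by force
        next
          assume "a = w"
          moreover have "v' \<in> \<Union>\<I>" using in_I * I by blast
          ultimately show ?thesis using r(2)[of v'] by (simp add: dist_commute)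
        qed
      qed
    qed
  qed
qed

theorem Metric_space_smocked: "Metric_space (smocked_points \<I>) (smocked_dist \<I>)"
proof
  show "0 \<le> smocked_dist \<I> x y" for x y
    by (rule smocked_dist_nonneg)
  show "smocked_dist \<I> x y = smocked_dist \<I> y x" for x y
    by (rule smocked_dist_commute)
next
  fix x y assume "x \<in> smocked_points \<I>" "y \<in> smocked_points \<I>"
  then obtain v w where vw: "x = smocking_map \<I> v" "y = smocking_map \<I> w"
    using range_smocking_map by blast
  have "smocked_dist \<I> x x = 0"
    using smocked_dist_le[of "[]" v v] smocked_dist_nonneg[of x x] vw by simp
  moreover have "smocked_dist \<I> x y \<noteq> 0" if "x \<noteq> y"
  proof -
    have "smocking_map \<I> w \<noteq> smocking_map \<I> v" using that vw by simp
    then obtain r where r: "r > 0"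
      "\<And>v' a. smocking_map \<I> v' = smocking_map \<I> v \<Longrightarrow> smocking_map \<I> a \<noteq> smocking_map \<I> v \<Longrightarrow>
       a \<in> \<Union>\<I> \<or> smocking_map \<I> a = smocking_map \<I> w \<Longrightarrow> r \<le> dist v' a"
      using fibre_isolated by metis
    have "r \<le> jump_length v' ps w'"
      if "smocking_map \<I> v' = x" "smocking_map \<I> w' = y" "jump_list \<I> ps" for v' w' ps
      using that
    proof (induction ps arbitrary: v')
      case Nil
      then show ?case using r(2)[of v' w'] \<open>x \<noteq> y\<close> vw by simp
    next
      case (Cons q ps)
      obtain a b where q: "q = (a, b)" by (cases q)
      have ab: "smocking_map \<I> a = smocking_map \<I> b" and ps: "jump_list \<I> ps"
        using Cons.prems q by auto
      consider "smocking_map \<I> a = x" | "smocking_map \<I> a \<noteq> x" "a \<in> \<Union>\<I>"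
        | "a \<notin> \<Union>\<I>" by blast
      then show ?case
      proof cases
        case 1
        then have "r \<le> jump_length b ps w'" using Cons.IH[of b] Cons.prems ab ps by simp
        then show ?thesis using q by (simp add: add_increasing)
      next
        case 2
        then have "r \<le> dist v' a" using r(2)[of v' a] Cons.prems vw by simp
        then show ?thesis using q jump_length_nonneg[of b ps w'] by simp
      next
        case 3
        then have "b = a" using ab unfolding smocking_map_eq_iff by blast
        then have "jump_length v' ps w' \<le> jump_length v' (q # ps) w'"
          using q jump_length_triangle by simp
        then show ?thesis using Cons.IH[of v'] Cons.prems ps by force
      qed
    qed
    then have "r \<le> smocked_dist \<I> x y"
      using smocked_dist_ge[of v w r] vw by blast
    then show ?thesis using r by linarith
  qed
  ultimately show "smocked_dist \<I> x y = 0 \<longleftrightarrow> x = y" by blast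
next
  fix x y z
  assume "x \<in> smocked_points \<I>" "y \<in> smocked_points \<I>" "z \<in> smocked_points \<I>"
  then obtain u v w where uvw: "x = smocking_map \<I> u" "y = smocking_map \<I> v" "z = smocking_map \<I> w"
    using range_smocking_map by blast
  have *: "smocked_dist \<I> x z - jump_length u' ps v' \<le> jump_length v'' qs w'"
    if "smocking_map \<I> u' = x" "smocking_map \<I> v' = y" "jump_list \<I> ps"
      "smocking_map \<I> v'' = y" "smocking_map \<I> w' = z" "jump_list \<I> qs" for u' v' v'' w' ps qs
    using smocked_dist_le[of "ps @ (v', v'') # qs" u' w'] that by (simp add: jump_length_append)
  have "smocked_dist \<I> x z - smocked_dist \<I> y z \<le> jump_length u' ps v'"
    if "smocking_map \<I> u' = x" "smocking_map \<I> v' = y" "jump_list \<I> ps" for u' v' ps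
  proof -
    have "smocked_dist \<I> x z - jump_length u' ps v' \<le> smocked_dist \<I> y z"
      unfolding uvw(2,3) by (rule smocked_dist_ge) (rule *[OF that, unfolded uvw(2,3)])
    then show ?thesis by simp
  qed
  then have "smocked_dist \<I> x z - smocked_dist \<I> y z \<le> smocked_dist \<I> x y"
    unfolding uvw(1,2) by (intro smocked_dist_ge)
  then show "smocked_dist \<I> x z \<le> smocked_dist \<I> x y + smocked_dist \<I> y z" by simp
qed

end

corollary
  assumes "smocking \<I>"
  shows mspace_smocked_space: "mspace (smocked_space \<I>) = smocked_points \<I>"
    and mdist_smocked_space: "mdist (smocked_space \<I>) = smocked_dist \<I>"
  using Metric_space_smocked[OF assms]
  by (simp_all add: smocked_space_def Metric_space.mspace_metric Metric_space.mdist_metric)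

end

theory Submission
  imports Defs
begin

text \<open>
  Off the smocking set \<open>S\<close> the smocking map \<open>\<pi>\<close> is injective, and it is an isometry at small scales:
  a path in \<open>X\<close> shortens a Euclidean segment only by running through a stitch, so two points at
  distance at least \<open>r\<close> from \<open>S\<close> keep their Euclidean distance as long as that distance is at most \<open>r\<close>
  (\<open>smocked_dist_ge_min\<close>).  The set \<open>U = \<pi>\<inverse>(ball)\<close> is compact: a path of bounded length makes
  boundedly many jumps, because consecutive stitches are a fixed distance apart, and only finitely many
  stitches meet a bounded set, so boundedly many jumps reach only a bounded set
  (\<open>bounded_smocked_ball_preimage\<close>).  Hence on each shell \<open>A\<^sub>k\<close>, which is bounded and keeps a positive
  distance from \<open>S\<close>, the map \<open>\<pi>\<close> is a bi-Lipschitz chart, and the shells cover \<open>U - S\<close>.  What they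
  miss of the ball is a countable set of points, one for each stitch that meets \<open>U\<close>.

  The analytic part is to show that the formula for \<open>T\<close> behaves as it should.  For a tuple \<open>(f, h)\<close> on
  the ball, the map \<open>h \<circ> \<pi>\<close> is Lipschitz on \<open>U\<close>, so it extends to \<open>\<real>\<^sup>N\<close> and is differentiable
  almost everywhere by Rademacher's theorem (\<open>rademacher\<close>).  At almost every point of a set the
  derivative relative to that set is unique (\<open>derivative_within_unique_ae\<close>).  Therefore one Jacobian
  \<open>J\<close> serves \<open>U\<close> and all its subsets at once (\<open>lipschitz_family_jacobian\<close>), which makes the integrals
  over \<open>A\<^sub>k\<close> add up to the integral over \<open>U - S\<close>.  On a stitch, \<open>h \<circ> \<pi>\<close> is constant, so \<open>J\<close> vanishes
  almost everywhere there, even when the stitch has positive volume; this is why \<open>T\<close> is already carried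
  by \<open>U - S\<close>.  The opposite orientation is obtained by composing the charts with a coordinate reflection.

  The mass measure is the image of Lebesgue measure on \<open>U - S\<close>.  It dominates \<open>T\<close> because
  \<open>\<bar>J\<bar> \<le> \<Prod> Lip(h\<^sub>i)\<close> by Hadamard's inequality (\<open>hadamard\<close>).  It is minimal because near a small compact
  set \<open>K\<close> off \<open>S\<close> the coordinate functions are 1-Lipschitz for the smocked distance and extend to
  1-Lipschitz functions \<open>h\<^sub>i\<close> on the whole ball; testing \<open>T\<close> on a bump around \<open>K\<close> and these \<open>h\<^sub>i\<close> gives
  \<open>J = 1\<close>, so any dominating measure gives \<open>\<pi>(K)\<close> at least the volume of \<open>K\<close>
  (\<open>compact_le_dominating\<close>).
\<close>

section \<open>Differentiability of Lipschitz functions on the line\<close>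

lemma has_real_derivative_from_sides:
  fixes h :: "real \<Rightarrow> real"
  assumes "((\<lambda>t. (h (x + t) - h x) / t) \<longlongrightarrow> D) (at_right 0)"
    and "((\<lambda>t. (h x - h (x - t)) / t) \<longlongrightarrow> D) (at_right 0)"
  shows "(h has_real_derivative D) (at x)"
proof -
  have "((\<lambda>t. (h (x + t) - h x) / t) \<longlongrightarrow> D) (at_left 0)"
    unfolding at_left_minus[of "0::real"] filterlim_filtermap
    using assms(2) by (simp add: minus_divide_left)
  then show ?thesis
    using assms(1) unfolding DERIV_def by (simp add: filterlim_split_at)
qed

text \<open>Adding a sufficiently steep linear function makes a Lipschitz function increasing with slopes bounded
  away from zero, so that questions about its differentiability become questions about a
  homeomorphism that distorts Lebesgue measure by a bounded factor.\<close>
lemma bijective_bilipschitz_shift: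
  fixes g :: "real \<Rightarrow> real"
  assumes lip: "L-lipschitz_on UNIV g" and h: "\<And>t. h t = g t + (L + 1) * t"
  shows "\<And>s t. s \<le> t \<Longrightarrow> t - s \<le> h t - h s" "\<And>s t. s \<le> t \<Longrightarrow> h t - h s \<le> (2 * L + 1) * (t - s)"
    "continuous_on UNIV h" "bij h"
proof -
  have b: "\<bar>g t - g s\<bar> \<le> L * (t - s)" if "s \<le> t" for s t
    using lipschitz_onD[OF lip, of t s] that by (simp add: dist_real_def)
  show lo: "t - s \<le> h t - h s" if "s \<le> t" for s t
    using b[OF that] by (simp add: h algebra_simps abs_le_iff)
  show "h t - h s \<le> (2 * L + 1) * (t - s)" if "s \<le> t" for s t
    using b[OF that] by (simp add: h algebra_simps abs_le_iff)
  have "continuous_on UNIV g" using lip lipschitz_on_continuous_on by blast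
  then show cont: "continuous_on UNIV h"
    unfolding h[abs_def] by (intro continuous_intros)
  have "inj h"
  proof (rule injI)
    fix s t assume "h s = h t"
    then show "s = t" using lo[of s t] lo[of t s] by linarith
  qed
  moreover have "y \<in> range h" for y
  proof -
    define c where "c = \<bar>y - h 0\<bar>"
    have "h (- c) \<le> y" "y \<le> h c"
      using lo[of "-c" 0] lo[of 0 c] by (auto simp: c_def)
    then obtain x where "h x = y"
      using IVT'[of h "-c" y c] continuous_on_subset[OF cont] by (auto simp: c_def)
    then show ?thesis by blast
  qed
  ultimately show "bij h" by (auto simp: bij_def)
qed

text \<open>Lipschitz functions are absolutely continuous.  After a linear shift the function is a bi-Lipschitz
  homeomorphism, which maps null sets to null sets; the image measure therefore has a
  Radon-Nikodym density, and that density is the derivative sought.\<close>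
lemma increment_eq_integral_of_density:
  fixes g :: "real \<Rightarrow> real"
  assumes lip: "L-lipschitz_on UNIV g"
  obtains D where "\<And>a b. a \<le> b \<Longrightarrow> (D has_integral (g b - g a)) {a..b}"
proof -
  define h where "h = (\<lambda>t. g t + (L + 1) * t)"
  have hdef: "h t = g t + (L + 1) * t" for t by (simp add: h_def)
  note h = bijective_bilipschitz_shift[OF lip hdef]
  have cont_k: "continuous_on UNIV (inv h)"
  proof (rule lipschitz_on_continuous_on[of 1])
    show "1-lipschitz_on UNIV (inv h)"
    proof (intro lipschitz_onI)
      fix x y
      have *: "h (inv h z) = z" for z using h(4) by (simp add: bij_is_surj surj_f_inv_f)
      show "dist (inv h x) (inv h y) \<le> 1 * dist x y"
        using h(1)[of "inv h x" "inv h y"] h(1)[of "inv h y" "inv h x"]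
        by (cases "inv h x \<le> inv h y") (auto simp: * dist_real_def)
    qed simp
  qed
  then have meas_k: "inv h \<in> borel_measurable borel" by (rule borel_measurable_continuous_onI)
  have img: "h ` A = inv h -` A" for A
    using bij_vimage_eq_inv_image[OF bij_imp_bij_inv[OF h(4)], of A] inv_inv_eq[OF h(4)] by simp
  \<comment> \<open>The image of Lebesgue measure under the inverse of \<open>h\<close> gives an interval the increment of \<open>h\<close>.\<close>
  define M where "M = distr lborel borel (inv h)"
  have M: "emeasure M A = emeasure lborel (h ` A)" if "A \<in> sets borel" for A
    unfolding M_def img using that meas_k by (subst emeasure_distr) auto
  have "absolutely_continuous lborel M"
    unfolding absolutely_continuous_def
  proof
    fix A assume A: "A \<in> null_sets (lborel :: real measure)"
    then have bA: "A \<in> sets borel" by auto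
    have "negligible A"
      using A by (simp add: negligible_iff_null_sets null_sets_completionI)
    then have "negligible (h ` A)"
    proof (intro negligible_locally_Lipschitz_image)
      fix x assume "x \<in> A"
      show "\<exists>T B. open T \<and> x \<in> T \<and> (\<forall>y\<in>A \<inter> T. norm (h y - h x) \<le> B * norm (y - x))"
      proof (intro exI[of _ UNIV] exI[of _ "2 * L + 1"] conjI ballI)
        fix y
        show "norm (h y - h x) \<le> (2 * L + 1) * norm (y - x)"
          using h(1)[of x y] h(2)[of x y] h(1)[of y x] h(2)[of y x]
          by (cases "x \<le> y") (auto simp: abs_if)
      qed auto
    qed auto
    moreover have "h ` A \<in> sets borel"
      unfolding img using measurable_sets[OF meas_k bA] by simp
    ultimately have "emeasure lborel (h ` A) = 0"
      by (simp add: negligible_iff_null_sets null_sets_completion_iff null_setsD1)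
    then show "A \<in> null_sets M" using M[OF bA] bA by (auto simp: null_sets_def M_def)
  qed
  then obtain f where f: "f \<in> borel_measurable lborel" "density lborel f = M"
    using sigma_finite_measure.Radon_Nikodym[OF lborel.sigma_finite_measure_axioms, of M] by (auto simp: M_def)
  have nn: "(\<integral>\<^sup>+x\<in>{a..b}. f x \<partial>lborel) = ennreal (h b - h a)" if "a \<le> b" for a b
  proof -
    have "(\<integral>\<^sup>+x\<in>{a..b}. f x \<partial>lborel) = emeasure M {a..b}"
      unfolding f(2)[symmetric] using f(1) by (subst emeasure_density) auto
    also have "\<dots> = emeasure lborel (h ` {a..b})" by (simp add: M)
    also have "h ` {a..b} = {h a..h b}"
    proof (intro equalityI subsetI)
      fix y assume "y \<in> h ` {a..b}"
      then show "y \<in> {h a..h b}" using h(1) by force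
    next
      fix y assume "y \<in> {h a..h b}"
      then show "y \<in> h ` {a..b}"
        using IVT'[of h a y b] continuous_on_subset[OF h(3)] that by force
    qed
    finally show ?thesis using h(1)[OF that] that by simp
  qed
  define D where "D = (\<lambda>x. enn2real (f x))"
  have D: "(D has_integral (h b - h a)) {a..b}" if "a \<le> b" for a b
  proof -
    have mf: "(\<lambda>x. f x * indicator {a..b} x) \<in> borel_measurable lborel" using f(1) by simp
    have "AE x in lborel. f x * indicator {a..b} x \<noteq> \<infinity>"
      using nn[OF that] by (intro nn_integral_PInf_AE[OF mf]) auto
    then have "AE x in lborel. ennreal (D x * indicator {a..b} x) = f x * indicator {a..b} x"
      by eventually_elim (auto simp: D_def indicator_def less_top split: if_splits)
    then have "(\<integral>\<^sup>+x. ennreal (D x * indicator {a..b} x) \<partial>lborel) = ennreal (h b - h a)"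
      unfolding nn[OF that, symmetric] by (rule nn_integral_cong_AE)
    then have "((\<lambda>x. D x * indicator {a..b} x) has_integral (h b - h a)) UNIV"
      using h(1)[OF that] that f(1)
      by (intro nn_integral_has_integral) (auto simp: D_def)
    moreover have "(\<lambda>x. D x * indicator {a..b} x) = (\<lambda>x. if x \<in> {a..b} then D x else 0)"
      by auto
    ultimately show ?thesis by (simp only: has_integral_restrict_UNIV)
  qed
  show ?thesis
  proof (rule that)
    fix a b :: real assume "a \<le> b"
    have "((\<lambda>x. D x - (L + 1)) has_integral (h b - h a - (b - a) * (L + 1))) {a..b}"
      using has_integral_diff[OF D[OF \<open>a \<le> b\<close>] has_integral_const_real[of "L + 1" a b]] \<open>a \<le> b\<close> by simp
    then show "((\<lambda>x. D x - (L + 1)) has_integral (g b - g a)) {a..b}"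
      by (simp add: h_def algebra_simps)
  qed
qed

text \<open>Lebesgue's differentiation theorem applied to the density of the increments.\<close>
lemma lipschitz_real_differentiable_ae:
  fixes g :: "real \<Rightarrow> real"
  assumes lip: "L-lipschitz_on UNIV g"
  shows "negligible {x. \<not> g differentiable (at x)}"
proof -
  obtain D where D: "\<And>a b. a \<le> b \<Longrightarrow> (D has_integral (g b - g a)) {a..b}"
    using increment_eq_integral_of_density[OF lip] by blast
  have D': "((\<lambda>x. D (- x)) has_integral (g (- a) - g (- b))) {a..b}" if "a \<le> b" for a b
    using D[of "-b" "-a"] that has_integral_reflect_real[where f = D and a = "-b" and b = "-a"] by simp
  have int: "D integrable_on cbox a b" "(\<lambda>x. D (- x)) integrable_on cbox a b" for a b
    using D[of a b] D'[of a b] by (cases "a \<le> b"; auto simp: integrable_on_def)+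
  obtain N where N: "negligible N" "\<And>x e. \<lbrakk>x \<notin> N; 0 < e\<rbrakk> \<Longrightarrow> \<exists>d>0. \<forall>h. 0 < h \<and> h < d \<longrightarrow>
      norm (integral (cbox x (x + h *\<^sub>R One)) D /\<^sub>R h ^ DIM(real) - D x) < e"
    using integrable_ccontinuous_explicit[of D] int(1) by blast
  \<comment> \<open>Averages over \<open>[x, x + h]\<close> control the right derivative; reflecting the line gives the left one.\<close>
  obtain N' where N': "negligible N'" "\<And>x e. \<lbrakk>x \<notin> N'; 0 < e\<rbrakk> \<Longrightarrow> \<exists>d>0. \<forall>h. 0 < h \<and> h < d \<longrightarrow>
      norm (integral (cbox x (x + h *\<^sub>R One)) (\<lambda>x. D (- x)) /\<^sub>R h ^ DIM(real) - D (- x)) < e"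
    using integrable_ccontinuous_explicit[of "\<lambda>x. D (- x)"] int(2) by blast
  have "g differentiable (at x)" if x: "x \<notin> N" "- x \<notin> N'" for x
  proof -
    have "((\<lambda>t. (g (x + t) - g x) / t) \<longlongrightarrow> D x) (at_right 0)"
    proof (rule tendstoI)
      fix e :: real assume "e > 0"
      then obtain d where d: "d > 0" "\<forall>h. 0 < h \<and> h < d \<longrightarrow>
          norm (integral (cbox x (x + h *\<^sub>R One)) D /\<^sub>R h ^ DIM(real) - D x) < e"
        using N(2) x by blast
      have "dist ((g (x + t) - g x) / t) (D x) < e" if "0 < t" "t < d" for t
        using d(2)[rule_format, of t] that integral_unique[OF D, of x "x + t"]
        by (simp add: dist_real_def divide_inverse mult.commute)
      then show "\<forall>\<^sub>F t in at_right 0. dist ((g (x + t) - g x) / t) (D x) < e"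
        using d(1) by (auto simp: eventually_at_right_field)
    qed
    moreover have "((\<lambda>t. (g x - g (x - t)) / t) \<longlongrightarrow> D x) (at_right 0)"
    proof (rule tendstoI)
      fix e :: real assume "e > 0"
      then obtain d where d: "d > 0" "\<forall>h. 0 < h \<and> h < d \<longrightarrow>
          norm (integral (cbox (-x) (-x + h *\<^sub>R One)) (\<lambda>x. D (-x)) /\<^sub>R h ^ DIM(real) - D (-(-x))) < e"
        using N'(2) x by blast
      have "dist ((g x - g (x - t)) / t) (D x) < e" if "0 < t" "t < d" for t
        using d(2)[rule_format, of t] that integral_unique[OF D', of "-x" "-x + t"]
        by (simp add: dist_real_def divide_inverse mult.commute)
      then show "\<forall>\<^sub>F t in at_right 0. dist ((g x - g (x - t)) / t) (D x) < e"
        using d(1) by (auto simp: eventually_at_right_field)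
    qed
    ultimately show ?thesis
      using has_real_derivative_from_sides real_differentiable_def by blast
  qed
  then have "{x. \<not> g differentiable (at x)} \<subseteq> N \<union> uminus ` N'"
    by (auto simp: image_iff) (metis minus_minus)
  moreover have "negligible (uminus ` N')"
    using N'(1)
    by (intro negligible_locally_Lipschitz_image)
       (auto intro!: exI[of _ "UNIV :: real set"] exI[of _ "1 :: real"])
  ultimately show ?thesis using N(1) by (meson negligible_Un negligible_subset)
qed

section \<open>Rademacher's theorem\<close>

text \<open>The Cauchy criterion for the difference quotients writes the set of differentiability as a countable
  intersection of countable unions of closed sets.\<close>
lemma borel_differentiable_along:
  fixes f :: "'a::euclidean_space \<Rightarrow> real"
  assumes cont: "continuous_on UNIV f"
  shows "{x. (\<lambda>t. f (x + t *\<^sub>R v)) differentiable (at (0::real))} \<in> sets borel"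
proof -
  define q where "q x t = (f (x + t *\<^sub>R v) - f x) / t" for x t
  define C where "C n m = (\<Inter>s\<in>{s. s \<noteq> 0 \<and> \<bar>s\<bar> < 1 / Suc m}. \<Inter>t\<in>{t. t \<noteq> 0 \<and> \<bar>t\<bar> < 1 / Suc m}.
      {x. \<bar>q x s - q x t\<bar> \<le> 1 / Suc n})" for n m :: nat
  have closed: "closed (C n m)" for n m
  proof -
    have "closed {x. \<bar>q x s - q x t\<bar> \<le> 1 / Suc n}" if "s \<noteq> 0" "t \<noteq> 0" for s t
    proof -
      have *: "continuous_on UNIV (\<lambda>x. f (x + r *\<^sub>R v))" for r
        by (rule continuous_on_compose2[OF cont]) (auto intro!: continuous_intros)
      show ?thesis unfolding q_def using that
        by (intro closed_Collect_le continuous_intros * cont) auto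
    qed
    then show ?thesis unfolding C_def by (intro closed_INT ballI) auto
  qed
  have "(\<lambda>t. f (x + t *\<^sub>R v)) differentiable (at 0) \<longleftrightarrow> (\<forall>n. \<exists>m. x \<in> C n m)" for x
  proof
    assume "(\<lambda>t. f (x + t *\<^sub>R v)) differentiable (at 0)"
    then obtain D where "((\<lambda>t. f (x + t *\<^sub>R v)) has_real_derivative D) (at 0)"
      using real_differentiable_def by blast
    then have lim: "((\<lambda>t. q x t) \<longlongrightarrow> D) (at 0)" by (simp add: DERIV_def q_def)
    show "\<forall>n. \<exists>m. x \<in> C n m"
    proof
      fix n
      have "\<forall>\<^sub>F t in at 0. dist (q x t) D < 1 / (2 * Suc n)"
        by (rule tendstoD[OF lim]) simp
      then obtain d where d: "d > 0" "\<And>t. t \<noteq> 0 \<Longrightarrow> \<bar>t\<bar> < d \<Longrightarrow> dist (q x t) D < 1 / (2 * Suc n)"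
        unfolding eventually_at by (auto simp: dist_real_def)
      obtain m where m: "1 / real (Suc m) < d" using nat_approx_posE[OF d(1)] by blast
      have "\<bar>q x s - q x t\<bar> \<le> 1 / Suc n"
        if "s \<noteq> 0" "\<bar>s\<bar> < 1 / Suc m" "t \<noteq> 0" "\<bar>t\<bar> < 1 / Suc m" for s t
      proof -
        have "dist (q x s) D < 1 / (2 * Suc n)" "dist (q x t) D < 1 / (2 * Suc n)"
          using d(2) that m by (auto simp del: of_nat_Suc)
        then have "\<bar>q x s - q x t\<bar> < 1 / (2 * Suc n) + 1 / (2 * Suc n)"
          unfolding dist_real_def by linarith
        then show ?thesis by (simp add: field_simps)
      qed
      then show "\<exists>m. x \<in> C n m" unfolding C_def by blast
    qed
  next
    assume C: "\<forall>n. \<exists>m. x \<in> C n m"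
    have near: "\<exists>d>0. \<forall>s t. s \<noteq> 0 \<and> \<bar>s\<bar> < d \<and> t \<noteq> 0 \<and> \<bar>t\<bar> < d \<longrightarrow> \<bar>q x s - q x t\<bar> < e" if e: "e > 0" for e
    proof -
      obtain n where n: "1 / real (Suc n) < e" using nat_approx_posE[OF e] by blast
      obtain m where "x \<in> C n m" using C by blast
      then have "\<forall>s t. s \<noteq> 0 \<and> \<bar>s\<bar> < 1 / Suc m \<and> t \<noteq> 0 \<and> \<bar>t\<bar> < 1 / Suc m \<longrightarrow> \<bar>q x s - q x t\<bar> < e"
        unfolding C_def using n by (fastforce simp del: of_nat_Suc)
      then show ?thesis by (intro exI[of _ "1 / real (Suc m)"]) simp
    qed
    define u where "u k = 1 / real (Suc k)" for k
    have u: "u \<longlonglongrightarrow> 0" "\<And>k. u k > 0" unfolding u_def by (use LIMSEQ_inverse_real_of_nat in \<open>auto simp: inverse_eq_divide\<close>)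
    have "Cauchy (\<lambda>k. q x (u k))"
    proof (rule metric_CauchyI)
      fix e :: real assume "e > 0"
      then obtain d where d: "d > 0" "\<forall>s t. s \<noteq> 0 \<and> \<bar>s\<bar> < d \<and> t \<noteq> 0 \<and> \<bar>t\<bar> < d \<longrightarrow> \<bar>q x s - q x t\<bar> < e"
        using near by blast
      obtain M where "\<forall>k\<ge>M. \<bar>u k\<bar> < d" using LIMSEQ_D[OF u(1) d(1)] by auto
      then show "\<exists>M. \<forall>m\<ge>M. \<forall>n\<ge>M. dist (q x (u m)) (q x (u n)) < e"
        using d(2) u(2) by (auto simp: dist_real_def less_imp_neq[symmetric] intro!: exI[of _ M])
    qed
    then obtain D where D: "(\<lambda>k. q x (u k)) \<longlonglongrightarrow> D" using Cauchy_convergent convergent_def by blast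
    have "((\<lambda>t. q x t) \<longlongrightarrow> D) (at 0)"
    proof (rule tendstoI)
      fix e :: real assume "e > 0"
      then obtain d where d: "d > 0" "\<forall>s t. s \<noteq> 0 \<and> \<bar>s\<bar> < d \<and> t \<noteq> 0 \<and> \<bar>t\<bar> < d \<longrightarrow> \<bar>q x s - q x t\<bar> < e / 2"
        using near[of "e / 2"] by auto
      obtain M where M: "\<forall>k\<ge>M. \<bar>u k\<bar> < d" using LIMSEQ_D[OF u(1) d(1)] by auto
      have "dist (q x t) D < e" if "t \<noteq> 0" "\<bar>t\<bar> < d" for t
      proof -
        have "\<bar>q x t - q x (u k)\<bar> \<le> e / 2" if "k \<ge> M" for k
          using d(2) M u(2)[of k] that \<open>t \<noteq> 0\<close> \<open>\<bar>t\<bar> < d\<close> by (intro less_imp_le) auto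
        then have "\<bar>q x t - D\<bar> \<le> e / 2"
          by (intro LIMSEQ_le_const2[OF tendsto_rabs[OF tendsto_diff[OF tendsto_const D]]]) blast
        then show ?thesis using \<open>e > 0\<close> by (simp add: dist_real_def)
      qed
      then show "\<forall>\<^sub>F t in at 0. dist (q x t) D < e"
        unfolding eventually_at using d(1) by (auto simp: dist_real_def)
    qed
    then have "((\<lambda>t. f (x + t *\<^sub>R v)) has_real_derivative D) (at 0)"
      by (simp add: DERIV_def q_def)
    then show "(\<lambda>t. f (x + t *\<^sub>R v)) differentiable (at 0)" using real_differentiable_def by blast
  qed
  then have "{x. (\<lambda>t. f (x + t *\<^sub>R v)) differentiable (at (0::real))} = (\<Inter>n. \<Union>m. C n m)" by auto
  also have "\<dots> \<in> sets borel" using closed by (intro sets.countable_INT sets.countable_UN) auto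
  finally show ?thesis .
qed

text \<open>Tonelli's theorem along the direction \<open>v\<close> without a change of coordinates: by translation invariance
  the measure of the exceptional set equals its average over the translates by \<open>t v\<close> with
  \<open>0 \<le> t \<le> 1\<close>, and exchanging the integrals turns this average into integrals over line sections.\<close>
lemma AE_from_lines:
  fixes P :: "'a::euclidean_space \<Rightarrow> bool"
  assumes P: "{x. P x} \<in> sets borel" and lines: "\<And>x. negligible {t::real. \<not> P (x + t *\<^sub>R v)}"
  shows "AE x in lborel. P x"
proof -
  define N where "N = {x. \<not> P x}"
  have N[measurable]: "N \<in> sets borel"
    using P unfolding N_def by (metis Collect_neg_eq borel_comp)
  have m: "(\<lambda>(t::real, x). indicator {0..1} t * (indicator N (t *\<^sub>R v + x) :: ennreal)) \<in> borel_measurable (lborel \<Otimes>\<^sub>M lborel)"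
    by measurable
  have trans: "(\<integral>\<^sup>+x. indicator N (t *\<^sub>R v + x) \<partial>lborel) = emeasure lborel N" for t :: real
  proof -
    have "(\<integral>\<^sup>+x. indicator N (t *\<^sub>R v + x) \<partial>lborel) = (\<integral>\<^sup>+x. indicator N x \<partial>distr lborel borel ((+) (t *\<^sub>R v)))"
      by (subst nn_integral_distr) auto
    then show ?thesis by (simp add: lborel_distr_plus)
  qed
  have "emeasure lborel N = (\<integral>\<^sup>+t. indicator {0..1::real} t * emeasure lborel N \<partial>lborel)"
    by (simp add: nn_integral_multc)
  also have "\<dots> = (\<integral>\<^sup>+t. \<integral>\<^sup>+x. indicator {0..1} t * indicator N (t *\<^sub>R v + x) \<partial>lborel \<partial>lborel)"
    by (simp add: nn_integral_cmult trans)
  also have "\<dots> = (\<integral>\<^sup>+x. \<integral>\<^sup>+t. indicator {0..1} t * indicator N (t *\<^sub>R v + x) \<partial>lborel \<partial>lborel)"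
    by (rule lborel_pair.Fubini'[symmetric]) (use m in \<open>simp add: case_prod_beta\<close>)
  also have "\<dots> = (\<integral>\<^sup>+x. 0 \<partial>(lborel :: 'a measure))"
  proof (rule nn_integral_cong)
    fix x :: 'a
    have "(\<integral>\<^sup>+t. indicator {0..1::real} t * indicator N (t *\<^sub>R v + x) \<partial>lborel) \<le>
        (\<integral>\<^sup>+t. indicator {t::real. \<not> P (x + t *\<^sub>R v)} t \<partial>lborel)"
      by (intro nn_integral_mono) (auto simp: N_def indicator_def add.commute)
    also have "\<dots> = emeasure lborel {t::real. \<not> P (x + t *\<^sub>R v)}"
    proof (rule nn_integral_indicator)
      have "{t::real. \<not> P (x + t *\<^sub>R v)} = (\<lambda>t. x + t *\<^sub>R v) -` N \<inter> space borel" by (auto simp: N_def)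
      also have "\<dots> \<in> sets borel" by measurable
      finally show "{t::real. \<not> P (x + t *\<^sub>R v)} \<in> sets lborel" by simp
    qed
    also have "\<dots> = 0"
    proof -
      have "{t::real. \<not> P (x + t *\<^sub>R v)} = (\<lambda>t. x + t *\<^sub>R v) -` N \<inter> space borel" by (auto simp: N_def)
      also have "\<dots> \<in> sets borel" by measurable
      finally show ?thesis
        using lines[of x] by (simp add: negligible_iff_null_sets null_sets_completion_iff null_setsD1)
    qed
    finally show "(\<integral>\<^sup>+t. indicator {0..1::real} t * indicator N (t *\<^sub>R v + x) \<partial>lborel) = 0" by simp
  qed
  finally have "emeasure lborel N = 0" by simp
  then have "N \<in> null_sets lborel" by (simp add: null_setsI)
  then show ?thesis by (rule AE_I') (auto simp: N_def)
qed

lemma lipschitz_differentiable_along_ae: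
  fixes f :: "'a::euclidean_space \<Rightarrow> real"
  assumes lip: "L-lipschitz_on UNIV f"
  shows "AE x in lborel. (\<lambda>t. f (x + t *\<^sub>R v)) differentiable (at (0::real))"
proof (rule AE_from_lines[where v = v])
  show "{x. (\<lambda>t. f (x + t *\<^sub>R v)) differentiable (at (0::real))} \<in> sets borel"
    using lip lipschitz_on_continuous_on by (intro borel_differentiable_along) blast
  fix x
  have L: "L \<ge> 0" using lip lipschitz_on_nonneg by blast
  have "(L * norm v)-lipschitz_on UNIV (\<lambda>t::real. f (x + t *\<^sub>R v))"
  proof (rule lipschitz_onI)
    fix s t :: real
    have "dist (f (x + s *\<^sub>R v)) (f (x + t *\<^sub>R v)) \<le> L * dist (x + s *\<^sub>R v) (x + t *\<^sub>R v)"
      using lip by (rule lipschitz_onD) auto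
    also have "dist (x + s *\<^sub>R v) (x + t *\<^sub>R v) = dist s t * norm v"
      by (simp add: dist_norm flip: scaleR_diff_left)
    finally show "dist (f (x + s *\<^sub>R v)) (f (x + t *\<^sub>R v)) \<le> L * norm v * dist s t" by (simp add: mult_ac)
  qed (use L in simp)
  then have neg: "negligible {t::real. \<not> (\<lambda>t. f (x + t *\<^sub>R v)) differentiable (at t)}"
    by (rule lipschitz_real_differentiable_ae)
  have "(\<lambda>s. f (x + t *\<^sub>R v + s *\<^sub>R v)) differentiable (at (0::real))"
    if t: "(\<lambda>t. f (x + t *\<^sub>R v)) differentiable (at t)" for t
  proof -
    obtain D where "((\<lambda>t. f (x + t *\<^sub>R v)) has_real_derivative D) (at (0 + t))"
      using t unfolding real_differentiable_def by auto
    then have "((\<lambda>s. f (x + (s + t) *\<^sub>R v)) has_real_derivative D) (at 0)"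
      unfolding DERIV_shift .
    then show ?thesis
      unfolding real_differentiable_def by (auto simp: algebra_simps)
  qed
  then show "negligible {t. \<not> (\<lambda>s. f (x + t *\<^sub>R v + s *\<^sub>R v)) differentiable (at (0::real))}"
    by (intro negligible_subset[OF neg]) blast
qed

text \<open>A limit along a sequence makes measurability in the base point immediate.\<close>
definition dirderiv :: "('a::real_vector \<Rightarrow> real) \<Rightarrow> 'a \<Rightarrow> 'a \<Rightarrow> real" where
  "dirderiv f v x = lim (\<lambda>n. (f (x + (1 / real (Suc n)) *\<^sub>R v) - f x) * real (Suc n))"

lemma dirderiv_lim:
  assumes "((\<lambda>t. f (x + t *\<^sub>R v)) has_real_derivative D) (at 0)"
  shows "(\<lambda>n. (f (x + (1 / real (Suc n)) *\<^sub>R v) - f x) * real (Suc n)) \<longlonglongrightarrow> D"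
    and dirderiv_eqI: "dirderiv f v x = D"
proof -
  have "((\<lambda>t. (f (x + t *\<^sub>R v) - f x) / t) \<longlongrightarrow> D) (at 0)"
    using assms by (simp add: DERIV_def)
  moreover have "filterlim (\<lambda>n. 1 / real (Suc n)) (at 0) sequentially"
    unfolding filterlim_at
    using LIMSEQ_inverse_real_of_nat by (auto simp: inverse_eq_divide)
  ultimately have "(\<lambda>n. (f (x + (1 / real (Suc n)) *\<^sub>R v) - f x) / (1 / real (Suc n))) \<longlonglongrightarrow> D"
    by (rule filterlim_compose)
  then show lim: "(\<lambda>n. (f (x + (1 / real (Suc n)) *\<^sub>R v) - f x) * real (Suc n)) \<longlonglongrightarrow> D" by simp
  show "dirderiv f v x = D" unfolding dirderiv_def using lim by (rule limI)
qed

lemma dirderiv_measurable: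
  fixes f :: "'a::euclidean_space \<Rightarrow> real"
  assumes "continuous_on UNIV f"
  shows "dirderiv f v \<in> borel_measurable borel"
proof -
  have [measurable]: "f \<in> borel_measurable borel" using assms by (rule borel_measurable_continuous_onI)
  show ?thesis unfolding dirderiv_def[abs_def] by measurable
qed

text \<open>Almost every value is a limit of averages over shrinking boxes.\<close>
lemma negligible_nonzero_if_box_integrals_zero:
  fixes F :: "'a::euclidean_space \<Rightarrow> real"
  assumes F: "\<And>a b. (F has_integral 0) (cbox a b)"
  shows "negligible {x. F x \<noteq> 0}"
proof -
  obtain N where N: "negligible N" "\<And>x e. \<lbrakk>x \<notin> N; 0 < e\<rbrakk> \<Longrightarrow> \<exists>d>0. \<forall>h. 0 < h \<and> h < d \<longrightarrow>
      norm (integral (cbox x (x + h *\<^sub>R One)) F /\<^sub>R h ^ DIM('a) - F x) < e"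
    using integrable_ccontinuous_explicit[of F] has_integral_integrable[OF F] by blast
  have "F x = 0" if x: "x \<notin> N" for x
  proof (rule ccontr)
    assume "F x \<noteq> 0"
    then obtain d where d: "d > 0" "\<forall>h. 0 < h \<and> h < d \<longrightarrow>
      norm (integral (cbox x (x + h *\<^sub>R One)) F /\<^sub>R h ^ DIM('a) - F x) < \<bar>F x\<bar>"
      using N(2)[OF x, of "\<bar>F x\<bar>"] by auto
    from d(2)[rule_format, of "d / 2"] show False
      using d(1) integral_unique[OF F] by simp
  qed
  then show ?thesis by (intro negligible_subset[OF N(1)]) blast
qed

lemma lipschitz_has_dirderiv_ae:
  fixes f :: "'a::euclidean_space \<Rightarrow> real"
  assumes lip: "L-lipschitz_on UNIV f"
  shows "AE x in lborel. ((\<lambda>t. f (x + t *\<^sub>R v)) has_real_derivative dirderiv f v x) (at 0)"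
  using lipschitz_differentiable_along_ae[OF lip, of v]
proof eventually_elim
  case (elim x)
  then obtain D where D: "((\<lambda>t. f (x + t *\<^sub>R v)) has_real_derivative D) (at 0)"
    using real_differentiable_def by blast
  then show ?case using dirderiv_eqI[OF D] by simp
qed

text \<open>The increment along \<open>u + v\<close> is the increment along \<open>u\<close> followed by an increment along \<open>v\<close> whose base
  point is moved by \<open>u\<close>.  Pointwise the moved quotients need not converge, but their integrals over a
  box do: moving the box back instead of the point, dominated convergence applies, because the
  indicators of the moved boxes converge off the boundary of the box.  Thus both sides have the same
  integral over every box.\<close>
lemma dirderiv_add_ae:
  fixes f :: "'a::euclidean_space \<Rightarrow> real"
  assumes lip: "L-lipschitz_on UNIV f"
  shows "AE x in lborel. dirderiv f (u + v) x = dirderiv f u x + dirderiv f v x"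
proof -
  have L: "L \<ge> 0" using lip lipschitz_on_nonneg by blast
  have cont: "continuous_on UNIV f" using lip lipschitz_on_continuous_on by blast
  have [measurable]: "f \<in> borel_measurable borel" using cont by (rule borel_measurable_continuous_onI)
  have [measurable]: "dirderiv f w \<in> borel_measurable borel" for w using dirderiv_measurable[OF cont] .
  define e where "e n = 1 / real (Suc n)" for n
  define Q where "Q w n x = (f (x + e n *\<^sub>R w) - f x) * real (Suc n)" for w n x
  have [measurable]: "Q w n \<in> borel_measurable borel" for w n unfolding Q_def[abs_def] by measurable
  have e: "e n > 0" "e n \<le> 1" for n by (auto simp: e_def)
  have e0: "e \<longlonglongrightarrow> 0"
    unfolding e_def[abs_def] using LIMSEQ_inverse_real_of_nat by (simp add: inverse_eq_divide)
  have Qlim: "AE x in lborel. (\<lambda>n. Q w n x) \<longlonglongrightarrow> dirderiv f w x" for w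
    using lipschitz_has_dirderiv_ae[OF lip, of w]
    by eventually_elim (unfold Q_def e_def, rule dirderiv_lim)
  have Qb: "\<bar>Q w n x\<bar> \<le> L * norm w" for w n x
  proof -
    have "\<bar>f (x + e n *\<^sub>R w) - f x\<bar> \<le> L * (e n * norm w)"
      using lipschitz_onD[OF lip, of "x + e n *\<^sub>R w" x] e[of n] by (simp add: dist_norm)
    then have "\<bar>Q w n x\<bar> \<le> (L * (e n * norm w)) * real (Suc n)"
      unfolding Q_def abs_mult by (intro mult_mono) auto
    then show ?thesis by (simp add: e_def)
  qed
  have int_bdd: "integrable lborel (\<lambda>x. c * indicator B x)" if "bounded B" "B \<in> sets borel" for c :: real and B :: "'a set"
    using emeasure_bounded_finite[OF that(1)] that(2) by (intro integrable_mult_right integrable_real_indicator) auto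
  have conv: "(\<lambda>n. \<integral>x. indicator (cbox a b) x * Q w n x \<partial>lborel) \<longlonglongrightarrow> (\<integral>x. indicator (cbox a b) x * dirderiv f w x \<partial>lborel)"
    and int: "integrable lborel (\<lambda>x. indicator (cbox a b) x * dirderiv f w x)" 
    and intQ: "\<And>n. integrable lborel (\<lambda>x. indicator (cbox a b) x * Q w n x)" for a b w
  proof -
    have *: "AE x in lborel. (\<lambda>n. indicator (cbox a b) x * Q w n x) \<longlonglongrightarrow> indicator (cbox a b) x * dirderiv f w x"
      using Qlim[of w] by eventually_elim (intro tendsto_intros)
    have **: "AE x in lborel. norm (indicator (cbox a b) x * Q w n x) \<le> (L * norm w) * indicator (cbox a b) x" for n
      using Qb by (auto simp: indicator_def)
    have intb: "integrable lborel (\<lambda>x. (L * norm w) * indicator (cbox a b) x :: real)"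
      by (rule int_bdd) auto
    note dc = integrable_dominated_convergence[OF _ _ intb * **]
      integrable_dominated_convergence2[OF _ _ intb * **] integral_dominated_convergence[OF _ _ intb * **]
    show "(\<lambda>n. \<integral>x. indicator (cbox a b) x * Q w n x \<partial>lborel) \<longlonglongrightarrow> (\<integral>x. indicator (cbox a b) x * dirderiv f w x \<partial>lborel)"
      by (intro dc(3)) auto
    show "integrable lborel (\<lambda>x. indicator (cbox a b) x * dirderiv f w x)"
      by (intro dc(1)) auto
    show "\<And>n. integrable lborel (\<lambda>x. indicator (cbox a b) x * Q w n x)"
      by (intro dc(2)) auto
  qed
  \<comment> \<open>The quotients with moved base point have the same limit of integrals.\<close>
  have shift: "(\<lambda>n. \<integral>x. indicator (cbox a b) x * Q v n (x + e n *\<^sub>R u) \<partial>lborel) \<longlonglongrightarrow> (\<integral>x. indicator (cbox a b) x * dirderiv f v x \<partial>lborel)"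
    and intS: "\<And>n. integrable lborel (\<lambda>x. indicator (cbox a b) x * Q v n (x + e n *\<^sub>R u))" for a b
  proof -
    obtain M where M: "\<And>x. x \<in> cbox a b \<Longrightarrow> norm x \<le> M"
      using bounded_cbox bounded_iff by metis
    have "(\<integral>x. indicator (cbox a b) x * Q v n (x + e n *\<^sub>R u) \<partial>lborel) =
        (\<integral>x. indicator (cbox a b) (x - e n *\<^sub>R u) * Q v n x \<partial>distr lborel borel ((+) (e n *\<^sub>R u)))" for n
      by (subst integral_distr) (auto simp: add.commute)
    then have eq: "(\<integral>x. indicator (cbox a b) x * Q v n (x + e n *\<^sub>R u) \<partial>lborel) =
        (\<integral>x. indicator (cbox a b) (x - e n *\<^sub>R u) * Q v n x \<partial>lborel)" for n
      by (simp add: lborel_distr_plus)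
    have "negligible (frontier (cbox a b))" using negligible_frontier_interval(1)[of a b] by (simp add: frontier_cbox)
    then have "AE x in lebesgue. x \<notin> frontier (cbox a b)" 
      using AE_not_in negligible_iff_null_sets by blast
    then have fr: "AE x in lborel. x \<notin> frontier (cbox a b)"
      unfolding AE_completion_iff .
    have *: "AE x in lborel. (\<lambda>n. indicator (cbox a b) (x - e n *\<^sub>R u) * Q v n x) \<longlonglongrightarrow> indicator (cbox a b) x * dirderiv f v x"
      using Qlim[of v] fr
    proof eventually_elim
      case (elim x)
      have lim: "(\<lambda>n. x - e n *\<^sub>R u) \<longlonglongrightarrow> x"
        using tendsto_diff[OF tendsto_const tendsto_scaleR[OF e0 tendsto_const], of x u] by simp
      have "\<forall>\<^sub>F n in sequentially. (indicator (cbox a b) (x - e n *\<^sub>R u) :: real) = indicator (cbox a b) x"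
      proof (cases "x \<in> cbox a b")
        case True
        then have "x \<in> interior (cbox a b)" using elim(2) by (simp add: frontier_def)
        then have "\<forall>\<^sub>F n in sequentially. x - e n *\<^sub>R u \<in> interior (cbox a b)"
          using topological_tendstoD[OF lim] by blast
        then show ?thesis
          by eventually_elim (use True box_subset_cbox[of a b] in \<open>auto simp: indicator_def\<close>)
      next
        case False
        then have "\<forall>\<^sub>F n in sequentially. x - e n *\<^sub>R u \<in> - cbox a b"
          using topological_tendstoD[OF lim, of "- cbox a b"] by (auto simp: open_Compl)
        then show ?thesis by eventually_elim (use False in auto)
      qed
      then have "(\<lambda>n. indicator (cbox a b) (x - e n *\<^sub>R u) :: real) \<longlonglongrightarrow> indicator (cbox a b) x"
        by (rule tendsto_eventually)
      then show ?case using elim(1) by (intro tendsto_mult)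
    qed
    have **: "AE x in lborel. norm (indicator (cbox a b) (x - e n *\<^sub>R u) * Q v n x) \<le> (L * norm v) * indicator (cball 0 (M + norm u)) x" for n
    proof (rule AE_I2)
      fix x
      have "norm x \<le> M + norm u" if "x - e n *\<^sub>R u \<in> cbox a b"
      proof -
        have "norm x \<le> norm (x - e n *\<^sub>R u) + norm (e n *\<^sub>R u)" using norm_triangle_ineq[of "x - e n *\<^sub>R u" "e n *\<^sub>R u"] by simp
        also have "norm (e n *\<^sub>R u) \<le> norm u" using e[of n] by (simp add: mult_left_le_one_le)
        finally show ?thesis using M[OF that] by simp
      qed
      then show "norm (indicator (cbox a b) (x - e n *\<^sub>R u) * Q v n x) \<le> (L * norm v) * indicator (cball 0 (M + norm u)) x"
        using Qb[of v n x] L by (auto simp: indicator_def)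
    qed
    have intb: "integrable lborel (\<lambda>x::'a. (L * norm v) * indicator (cball 0 (M + norm u)) x :: real)"
      by (rule int_bdd) auto
    note dc = integral_dominated_convergence[OF _ _ intb * **]
    show "(\<lambda>n. \<integral>x. indicator (cbox a b) x * Q v n (x + e n *\<^sub>R u) \<partial>lborel) \<longlonglongrightarrow> (\<integral>x. indicator (cbox a b) x * dirderiv f v x \<partial>lborel)"
      unfolding eq by (intro dc) auto
    show "integrable lborel (\<lambda>x. indicator (cbox a b) x * Q v n (x + e n *\<^sub>R u))" for n
    proof (rule Bochner_Integration.integrable_bound[OF int_bdd[of "cbox a b" "L * norm v"]])
      show "AE x in lborel. norm (indicator (cbox a b) x * Q v n (x + e n *\<^sub>R u)) \<le> norm (L * norm v * indicator (cbox a b) x)"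
        using Qb L by (auto simp: indicator_def)
    qed auto
  qed
  have Qadd: "Q (u + v) n x = Q u n x + Q v n (x + e n *\<^sub>R u)" for n x
    unfolding Q_def by (simp add: scaleR_add_right add.assoc left_diff_distrib)
  have zero: "((\<lambda>x. dirderiv f (u + v) x - dirderiv f u x - dirderiv f v x) has_integral 0) (cbox a b)" for a b
  proof -
    have "(\<lambda>n. (\<integral>x. indicator (cbox a b) x * Q u n x \<partial>lborel) + (\<integral>x. indicator (cbox a b) x * Q v n (x + e n *\<^sub>R u) \<partial>lborel)) \<longlonglongrightarrow>
       (\<integral>x. indicator (cbox a b) x * dirderiv f u x \<partial>lborel) + (\<integral>x. indicator (cbox a b) x * dirderiv f v x \<partial>lborel)"
      by (intro tendsto_add conv shift)
    moreover have "(\<integral>x. indicator (cbox a b) x * Q u n x \<partial>lborel) + (\<integral>x. indicator (cbox a b) x * Q v n (x + e n *\<^sub>R u) \<partial>lborel) =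
       (\<integral>x. indicator (cbox a b) x * Q (u + v) n x \<partial>lborel)" for n
      unfolding Qadd by (simp add: distrib_left intQ intS)
    ultimately have "(\<lambda>n. \<integral>x. indicator (cbox a b) x * Q (u + v) n x \<partial>lborel) \<longlonglongrightarrow>
       (\<integral>x. indicator (cbox a b) x * dirderiv f u x \<partial>lborel) + (\<integral>x. indicator (cbox a b) x * dirderiv f v x \<partial>lborel)"
      by simp
    then have eq: "(\<integral>x. indicator (cbox a b) x * dirderiv f (u + v) x \<partial>lborel) =
      (\<integral>x. indicator (cbox a b) x * dirderiv f u x \<partial>lborel) + (\<integral>x. indicator (cbox a b) x * dirderiv f v x \<partial>lborel)"
      by (rule LIMSEQ_unique[OF conv])
    have hi: "((\<lambda>x. indicator (cbox a b) x * dirderiv f w x) has_integral (\<integral>x. indicator (cbox a b) x * dirderiv f w x \<partial>lborel)) UNIV" for w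
      by (rule has_integral_integral_lborel[OF int])
    have "((\<lambda>x. indicator (cbox a b) x * dirderiv f (u + v) x - indicator (cbox a b) x * dirderiv f u x - indicator (cbox a b) x * dirderiv f v x) has_integral 0) UNIV"
      using has_integral_diff[OF has_integral_diff[OF hi hi] hi, of "u + v" u v] unfolding eq by simp
    moreover have "(\<lambda>x. indicator (cbox a b) x * dirderiv f (u + v) x - indicator (cbox a b) x * dirderiv f u x - indicator (cbox a b) x * dirderiv f v x)
      = (\<lambda>x. if x \<in> cbox a b then dirderiv f (u + v) x - dirderiv f u x - dirderiv f v x else 0)" by auto
    ultimately show ?thesis by (simp only: has_integral_restrict_UNIV)
  qed
  have "AE x in lebesgue. x \<notin> {x. dirderiv f (u + v) x - dirderiv f u x - dirderiv f v x \<noteq> 0}"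
    using negligible_nonzero_if_box_integrals_zero[OF zero] AE_not_in negligible_iff_null_sets by blast
  then have "AE x in lborel. x \<notin> {x. dirderiv f (u + v) x - dirderiv f u x - dirderiv f v x \<noteq> 0}"
    unfolding AE_completion_iff .
  then show ?thesis by eventually_elim (auto simp: algebra_simps)
qed

lemma dirderiv_scale:
  fixes f :: "'a::real_vector \<Rightarrow> real"
  assumes "((\<lambda>t. f (x + t *\<^sub>R v)) has_real_derivative D) (at 0)"
  shows "((\<lambda>t. f (x + t *\<^sub>R (c *\<^sub>R v))) has_real_derivative (c * D)) (at 0)"
proof -
  have "((\<lambda>t::real. c * t) has_real_derivative c) (at 0)" by (auto intro!: derivative_eq_intros)
  moreover have "((\<lambda>t. f (x + t *\<^sub>R v)) has_real_derivative D) (at (c * 0))" using assms by simp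
  ultimately have "((\<lambda>t. f (x + t *\<^sub>R v)) \<circ> (\<lambda>t. c * t) has_real_derivative (D * c)) (at 0)"
    by (intro DERIV_chain)
  moreover have "(\<lambda>t. f (x + t *\<^sub>R v)) \<circ> (\<lambda>t. c * t) = (\<lambda>t. f (x + t *\<^sub>R (c *\<^sub>R v)))"
    by (rule ext) (simp add: mult.commute)
  ultimately show ?thesis by (simp only: mult.commute)
qed

lemma dirderiv_linear_ae:
  fixes f :: "'a::euclidean_space \<Rightarrow> real"
  assumes lip: "L-lipschitz_on UNIV f"
  shows "AE x in lborel. dirderiv f v x = (\<Sum>b\<in>Basis. (v \<bullet> b) * dirderiv f b x)"
proof -
  have "AE x in lborel. dirderiv f (\<Sum>b\<in>A. (v \<bullet> b) *\<^sub>R b) x = (\<Sum>b\<in>A. (v \<bullet> b) * dirderiv f b x)"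
    if "finite A" "A \<subseteq> Basis" for A
    using that
  proof (induction A)
    case empty
    have "dirderiv f 0 x = 0" for x by (simp add: dirderiv_def)
    then show ?case by simp
  next
    case (insert b A)
    have ih: "AE x in lborel. dirderiv f (\<Sum>b\<in>A. (v \<bullet> b) *\<^sub>R b) x = (\<Sum>b\<in>A. (v \<bullet> b) * dirderiv f b x)"
      using insert by simp
    have add: "AE x in lborel. dirderiv f ((v \<bullet> b) *\<^sub>R b + (\<Sum>b\<in>A. (v \<bullet> b) *\<^sub>R b)) x =
      dirderiv f ((v \<bullet> b) *\<^sub>R b) x + dirderiv f (\<Sum>b\<in>A. (v \<bullet> b) *\<^sub>R b) x"
      by (rule dirderiv_add_ae[OF lip])
    show ?case
      using ih add lipschitz_has_dirderiv_ae[OF lip, of b]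
    proof eventually_elim
      case (elim x)
      have "dirderiv f ((v \<bullet> b) *\<^sub>R b) x = (v \<bullet> b) * dirderiv f b x"
        by (rule dirderiv_eqI[OF dirderiv_scale[OF elim(3)]])
      then show ?case using elim insert by simp
    qed
  qed
  from this[OF finite_Basis subset_refl] show ?thesis by (simp add: euclidean_representation)
qed

text \<open>Almost every point admits directional derivatives, depending linearly on the direction, in all
  directions of a countable dense set.  At such a point finitely many of these directions approximate
  the unit sphere, and the Lipschitz condition transfers their estimates to all directions uniformly.\<close>
theorem rademacher:
  fixes f :: "'a::euclidean_space \<Rightarrow> real"
  assumes lip: "L-lipschitz_on UNIV f"
  shows "AE x in lborel. (f has_derivative (\<lambda>v. \<Sum>b\<in>Basis. (v \<bullet> b) * dirderiv f b x)) (at x)"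
proof -
  have L: "L \<ge> 0" using lip lipschitz_on_nonneg by blast
  obtain Q :: "'a set" where Q: "countable Q" "\<And>U. open U \<Longrightarrow> U \<noteq> {} \<Longrightarrow> \<exists>d\<in>Q. d \<in> U"
    using countable_dense_setE by blast
  have "AE x in lborel. \<forall>v\<in>Q. ((\<lambda>t. f (x + t *\<^sub>R v)) has_real_derivative dirderiv f v x) (at 0) \<and>
     dirderiv f v x = (\<Sum>b\<in>Basis. (v \<bullet> b) * dirderiv f b x)"
    using Q(1) lipschitz_has_dirderiv_ae[OF lip] dirderiv_linear_ae[OF lip]
    by (intro AE_ball_countable' AE_conjI) auto
  then show ?thesis
  proof eventually_elim
    case (elim x)
    define T where "T = (\<lambda>v. \<Sum>b\<in>Basis. (v \<bullet> b) * dirderiv f b x)"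
    have lin: "bounded_linear T" unfolding T_def
      by (intro bounded_linear_sum bounded_linear_mult_const bounded_linear_inner_left)
    then obtain K where K: "K \<ge> 0" "\<And>v. norm (T v) \<le> norm v * K"
      using bounded_linear.nonneg_bounded by blast
    have "\<exists>d>0. \<forall>y. norm (y - x) < d \<longrightarrow> norm (f y - f x - T (y - x)) \<le> e * norm (y - x)" if "e > 0" for e
    proof -
      \<comment> \<open>The mesh on the sphere, chosen so that moving to the nearest direction costs at most half of \<open>e\<close>.\<close>
      define r where "r = e / (2 * (L + K + 1))"
      have r: "r > 0" "(L + K) * r \<le> e / 2" using that L K(1) by (auto simp: r_def field_simps)
      have "compact (sphere (0::'a) 1)" by simp
      moreover have "sphere (0::'a) 1 \<subseteq> (\<Union>q\<in>Q. ball q r)"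
      proof
        fix w :: 'a
        obtain q where "q \<in> Q" "q \<in> ball w r" using Q(2)[of "ball w r"] r by auto
        then show "w \<in> (\<Union>q\<in>Q. ball q r)" by (auto simp: dist_commute)
      qed
      ultimately obtain F where F: "F \<subseteq> Q" "finite F" "sphere (0::'a) 1 \<subseteq> (\<Union>q\<in>F. ball q r)"
        using compactE_image[of "sphere (0::'a) 1" Q "\<lambda>q. ball q r"] by auto
      have "\<forall>q\<in>F. \<exists>d>0. \<forall>t. 0 < t \<and> t < d \<longrightarrow> \<bar>f (x + t *\<^sub>R q) - f x - t * T q\<bar> \<le> e / 2 * t"
      proof
        fix q assume "q \<in> F"
        then have "q \<in> Q" using F(1) by blast
        then have "((\<lambda>t. f (x + t *\<^sub>R q)) has_real_derivative T q) (at 0)"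
          using elim unfolding T_def by metis
        then have "((\<lambda>t. (f (x + t *\<^sub>R q) - f x) / t) \<longlongrightarrow> T q) (at 0)" by (simp add: DERIV_def)
        from tendstoD[OF this, of "e / 2"] \<open>e > 0\<close> obtain d where d: "d > 0"
           "\<And>t. t \<noteq> 0 \<Longrightarrow> \<bar>t\<bar> < d \<Longrightarrow> \<bar>(f (x + t *\<^sub>R q) - f x) / t - T q\<bar> < e / 2"
          unfolding eventually_at by (auto simp: dist_real_def)
        have "\<bar>f (x + t *\<^sub>R q) - f x - t * T q\<bar> \<le> e / 2 * t" if "0 < t" "t < d" for t
        proof -
          have "f (x + t *\<^sub>R q) - f x - t * T q = ((f (x + t *\<^sub>R q) - f x) / t - T q) * t"
            using that by (simp add: field_simps)
          also have "\<bar>\<dots>\<bar> \<le> e / 2 * t"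
            using d(2)[of t] that \<open>e > 0\<close> unfolding abs_mult by (intro mult_mono) auto
          finally show ?thesis .
        qed
        then show "\<exists>d>0. \<forall>t. 0 < t \<and> t < d \<longrightarrow> \<bar>f (x + t *\<^sub>R q) - f x - t * T q\<bar> \<le> e / 2 * t"
          using d(1) by blast
      qed
      then obtain d where d: "\<And>q. q \<in> F \<Longrightarrow> d q > 0"
        "\<And>q t. q \<in> F \<Longrightarrow> 0 < t \<Longrightarrow> t < d q \<Longrightarrow> \<bar>f (x + t *\<^sub>R q) - f x - t * T q\<bar> \<le> e / 2 * t"
        by metis
      define d0 where "d0 = Min (insert 1 (d ` F))"
      have d0: "d0 > 0" "\<And>q. q \<in> F \<Longrightarrow> d0 \<le> d q"
        unfolding d0_def using F(2) d(1) by auto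
      have "norm (f y - f x - T (y - x)) \<le> e * norm (y - x)" if y: "norm (y - x) < d0" for y
      proof (cases "y = x")
        case True
        then show ?thesis using bounded_linear.linear[OF lin] by (simp add: linear_0)
      next
        case False
        define t where "t = norm (y - x)"
        define w where "w = (y - x) /\<^sub>R t"
        have t: "t > 0" "t < d0" using False y by (auto simp: t_def)
        have w: "norm w = 1" "y = x + t *\<^sub>R w" using t by (auto simp: w_def t_def[symmetric])
        then obtain q where q: "q \<in> F" "dist q w < r" using F(3) by (auto simp: subset_iff)
        have 1: "\<bar>f (x + t *\<^sub>R q) - f x - t * T q\<bar> \<le> e / 2 * t" using d(2)[OF q(1) t(1)] d0(2)[OF q(1)] t by simp
        have nrm: "norm (t *\<^sub>R w - t *\<^sub>R q) \<le> t * r"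
          using q(2) t by (simp add: dist_norm norm_minus_commute flip: scaleR_diff_right)
        have 2: "\<bar>f y - f (x + t *\<^sub>R q)\<bar> \<le> L * (t * r)"
        proof -
          have "\<bar>f y - f (x + t *\<^sub>R q)\<bar> \<le> L * dist y (x + t *\<^sub>R q)"
            using lipschitz_onD[OF lip, of y "x + t *\<^sub>R q"] by (simp add: dist_real_def)
          also have "dist y (x + t *\<^sub>R q) \<le> t * r" using nrm by (simp add: w(2) dist_norm)
          finally show ?thesis using L by (simp add: mult_left_mono)
        qed
        have 3: "\<bar>T (y - x) - t * T q\<bar> \<le> K * (t * r)"
        proof -
          have "T (y - x) - t * T q = T (t *\<^sub>R w - t *\<^sub>R q)"
            using bounded_linear.linear[OF lin] by (simp add: w(2) linear_diff linear_cmul)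
          then have "\<bar>T (y - x) - t * T q\<bar> \<le> norm (t *\<^sub>R w - t *\<^sub>R q) * K" using K(2) by (metis real_norm_def)
          also have "\<dots> \<le> (t * r) * K" using nrm K(1) by (intro mult_right_mono)
          finally show ?thesis by (simp add: mult_ac)
        qed
        have "\<bar>f y - f x - T (y - x)\<bar> \<le> e / 2 * t + L * (t * r) + K * (t * r)" using 1 2 3 by linarith
        also have "\<dots> = e / 2 * t + ((L + K) * r) * t" by (simp add: algebra_simps)
        also have "\<dots> \<le> e / 2 * t + e / 2 * t" using r t by (intro add_left_mono mult_right_mono) auto
        finally show ?thesis by (simp add: t_def)
      qed
      then show ?thesis using d0(1) by blast
    qed
    then show ?case unfolding T_def[symmetric] has_derivative_at_alt using lin by blast
  qed
qed

section \<open>Derivatives relative to a set\<close>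

text \<open>As the slabs shrink, their intersection with the unit ball decreases to part of a hyperplane; scaling
  carries the resulting bound to all balls with the same relative width \<open>k\<close>.\<close>
lemma slab_in_ball_small:
  fixes v :: "'a::euclidean_space"
  assumes "v \<noteq> 0" "e > 0"
  obtains k where "k > 0"
    "\<And>x d. d > 0 \<Longrightarrow> {y \<in> ball x d. \<bar>v \<bullet> (y - x)\<bar> \<le> k * d} \<in> lmeasurable"
    "\<And>x d. d > 0 \<Longrightarrow> measure lebesgue {y \<in> ball x d. \<bar>v \<bullet> (y - x)\<bar> \<le> k * d} < e * measure lebesgue (ball x d)"
proof -
  define W where "W n = {z \<in> ball (0::'a) 1. \<bar>v \<bullet> z\<bar> \<le> 1 / Suc n}" for n
  have slab: "{y \<in> ball x d. \<bar>v \<bullet> (y - x)\<bar> \<le> k} \<in> lmeasurable" for x d k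
  proof -
    have "closed {y. \<bar>v \<bullet> (y - x)\<bar> \<le> k}" by (intro closed_Collect_le continuous_intros)
    then have "ball x d \<inter> {y. \<bar>v \<bullet> (y - x)\<bar> \<le> k} \<in> lmeasurable"
      by (intro fmeasurable_Int_fmeasurable) auto
    moreover have "ball x d \<inter> {y. \<bar>v \<bullet> (y - x)\<bar> \<le> k} = {y \<in> ball x d. \<bar>v \<bullet> (y - x)\<bar> \<le> k}" by blast
    ultimately show ?thesis by simp
  qed
  have W: "W n \<in> lmeasurable" for n using slab[of 0 1 "1 / Suc n"] by (simp add: W_def)
  have "(\<lambda>n. measure lebesgue (W n)) \<longlonglongrightarrow> measure lebesgue (\<Inter>n. W n)"
  proof (rule Lim_measure_decseq)
    show "range W \<subseteq> sets lebesgue" using W by blast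
    show "decseq W"
    proof (rule decseq_SucI, rule subsetI)
      fix n z assume "z \<in> W (Suc n)"
      moreover have "1 / real (Suc (Suc n)) \<le> 1 / real (Suc n)" by (simp add: field_simps)
      ultimately show "z \<in> W n" unfolding W_def by (auto simp del: of_nat_Suc)
    qed
    show "emeasure lebesgue (W n) \<noteq> \<infinity>" for n using fmeasurableD2[OF W[of n]] by auto
  qed
  moreover have "measure lebesgue (\<Inter>n. W n) = 0"
  proof -
    have "(\<Inter>n. W n) \<subseteq> {z. v \<bullet> z = 0}"
    proof
      fix z assume z: "z \<in> (\<Inter>n. W n)"
      have "v \<bullet> z = 0"
      proof (rule ccontr)
        assume "v \<bullet> z \<noteq> 0"
        then obtain n where "1 / real (Suc n) < \<bar>v \<bullet> z\<bar>" using nat_approx_posE[of "\<bar>v \<bullet> z\<bar>"] by auto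
        moreover have "z \<in> W n" using z by blast
        ultimately show False unfolding W_def by (simp del: of_nat_Suc)
      qed
      then show "z \<in> {z. v \<bullet> z = 0}" by simp
    qed
    then have "negligible (\<Inter>n. W n)"
      using negligible_hyperplane[of v 0] assms(1) negligible_subset by blast
    then show ?thesis by (rule negligible_imp_measure0)
  qed
  moreover have pos: "0 < measure lebesgue (ball (0::'a) 1)" by (simp add: content_ball_pos)
  ultimately have "\<forall>\<^sub>F n in sequentially. measure lebesgue (W n) < e * measure lebesgue (ball (0::'a) 1)"
    using assms(2) by (intro order_tendstoD(2)) auto
  then obtain n where n: "measure lebesgue (W n) < e * measure lebesgue (ball (0::'a) 1)"
    using eventually_happens by force
  show ?thesis
  proof (rule that[of "1 / Suc n"])
    fix x :: 'a and d :: real assume d: "d > 0"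
    have aff: "(\<lambda>z. d *\<^sub>R z + x) ` {z \<in> ball 0 1. P z} = {y \<in> ball x d. P ((y - x) /\<^sub>R d)}" for P
    proof (intro equalityI subsetI)
      fix y assume "y \<in> {y \<in> ball x d. P ((y - x) /\<^sub>R d)}"
      then show "y \<in> (\<lambda>z. d *\<^sub>R z + x) ` {z \<in> ball 0 1. P z}"
        using d by (intro image_eqI[of _ _ "(y - x) /\<^sub>R d"])
          (auto simp: dist_norm norm_minus_commute divide_inverse[symmetric] mult.commute[of "inverse d"])
    next
      fix y assume "y \<in> (\<lambda>z. d *\<^sub>R z + x) ` {z \<in> ball 0 1. P z}"
      then show "y \<in> {y \<in> ball x d. P ((y - x) /\<^sub>R d)}"
        using d by (auto simp: dist_norm abs_mult)
    qed
    have sc: "\<bar>v \<bullet> (w /\<^sub>R d)\<bar> \<le> k \<longleftrightarrow> \<bar>v \<bullet> w\<bar> \<le> k * d" for w k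
      using d by (simp add: abs_mult field_simps)
    have "{y \<in> ball x d. \<bar>v \<bullet> (y - x)\<bar> \<le> 1 / real (Suc n) * d} = (\<lambda>z. d *\<^sub>R z + x) ` W n"
      unfolding W_def aff sc ..
    moreover have "ball x d = (\<lambda>z. d *\<^sub>R z + x) ` ball 0 1" using aff[of "\<lambda>_. True", symmetric] by (simp only: simp_thms Collect_mem_eq)
    ultimately have "measure lebesgue {y \<in> ball x d. \<bar>v \<bullet> (y - x)\<bar> \<le> 1 / real (Suc n) * d} = d ^ DIM('a) * measure lebesgue (W n)"
      "measure lebesgue (ball x d) = d ^ DIM('a) * measure lebesgue (ball (0::'a) 1)"
      using d by (simp_all only: measure_lebesgue_affine abs_of_pos)
    then show "measure lebesgue {y \<in> ball x d. \<bar>v \<bullet> (y - x)\<bar> \<le> 1 / real (Suc n) * d} < e * measure lebesgue (ball x d)"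
      using n d by (simp add: mult_ac)
  qed (use slab in auto)
qed

text \<open>Near such a point the set lies in thin slabs and so has density zero there; a set that has density zero
  at each of its points is negligible.\<close>
lemma negligible_tangentially_degenerate:
  fixes A :: "'a::euclidean_space set"
  shows "negligible {x \<in> A. \<exists>v\<noteq>0. \<forall>k>0. \<exists>e>0. \<forall>y\<in>A. dist x y < e \<longrightarrow> \<bar>v \<bullet> (y - x)\<bar> \<le> k * dist x y}"
    (is "negligible ?N")
  unfolding negligible_eq_zero_density_alt
proof (intro ballI allI impI)
  fix x and e :: real assume x: "x \<in> ?N" and e: "e > 0"
  then obtain v where v: "v \<noteq> 0" "\<forall>k>0. \<exists>e>0. \<forall>y\<in>A. dist x y < e \<longrightarrow> \<bar>v \<bullet> (y - x)\<bar> \<le> k * dist x y" by blast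
  obtain k where k: "k > 0"
    "\<And>x d. d > 0 \<Longrightarrow> {y \<in> ball x d. \<bar>v \<bullet> (y - x)\<bar> \<le> k * d} \<in> lmeasurable"
    "\<And>x d. d > 0 \<Longrightarrow> measure lebesgue {y \<in> ball x d. \<bar>v \<bullet> (y - x)\<bar> \<le> k * d} < e * measure lebesgue (ball x d)"
    using slab_in_ball_small[OF v(1) e] by blast
  obtain r where r: "r > 0" "\<forall>y\<in>A. dist x y < r \<longrightarrow> \<bar>v \<bullet> (y - x)\<bar> \<le> k * dist x y" using v(2) k(1) by blast
  define d where "d = min r e"
  have d: "d > 0" "d \<le> r" "d \<le> e" using r(1) e by (auto simp: d_def)
  have "?N \<inter> ball x d \<subseteq> {y \<in> ball x d. \<bar>v \<bullet> (y - x)\<bar> \<le> k * d}"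
  proof
    fix y assume y: "y \<in> ?N \<inter> ball x d"
    then have "\<bar>v \<bullet> (y - x)\<bar> \<le> k * dist x y" using r(2) d by auto
    also have "\<dots> \<le> k * d" using k(1) y by (intro mult_left_mono) auto
    finally show "y \<in> {y \<in> ball x d. \<bar>v \<bullet> (y - x)\<bar> \<le> k * d}" using y by auto
  qed
  then show "\<exists>d U. 0 < d \<and> d \<le> e \<and> ?N \<inter> ball x d \<subseteq> U \<and> U \<in> lmeasurable \<and> measure lebesgue U < e * measure lebesgue (ball x d)"
    using d k(2,3)[OF d(1), of x] by (intro exI[of _ d] exI[of _ "{y \<in> ball x d. \<bar>v \<bullet> (y - x)\<bar> \<le> k * d}"] conjI)
qed

text \<open>The difference of two derivatives within \<open>A\<close> annihilates all tangent directions of \<open>A\<close>.  If it is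
  not zero, its adjoint takes a nonzero value \<open>v\<close>, and \<open>A\<close> is tangentially orthogonal to \<open>v\<close>.  The
  exceptional set is therefore the same for all functions.\<close>
lemma derivative_within_unique_ae:
  fixes A :: "'a::euclidean_space set"
  obtains N where "negligible N"
    "\<And>x (f :: 'a \<Rightarrow> 'b::euclidean_space) D D'. x \<in> A \<Longrightarrow> x \<notin> N \<Longrightarrow>
       (f has_derivative D) (at x within A) \<Longrightarrow> (f has_derivative D') (at x within A) \<Longrightarrow> D = D'"
proof (rule that[OF negligible_tangentially_degenerate[of A]])
  fix x and f :: "'a \<Rightarrow> 'b" and D D'
  assume x: "x \<in> A" and nx: "x \<notin> {x \<in> A. \<exists>v\<noteq>0. \<forall>k>0. \<exists>e>0. \<forall>y\<in>A. dist x y < e \<longrightarrow> \<bar>v \<bullet> (y - x)\<bar> \<le> k * dist x y}"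
    and D: "(f has_derivative D) (at x within A)" "(f has_derivative D') (at x within A)"
  define L where "L = (\<lambda>v. D v - D' v)"
  have der: "((\<lambda>y. 0) has_derivative L) (at x within A)"
    using has_derivative_diff[OF D] by (simp add: L_def)
  then have lin: "linear L" by (simp add: has_derivative_linear)
  show "D = D'"
  proof (rule ccontr)
    assume "D \<noteq> D'"
    then obtain w where "L w \<noteq> 0" by (auto simp: L_def fun_eq_iff)
    then have "w \<bullet> adjoint L (L w) \<noteq> 0" using adjoint_works[OF lin, of w "L w"] by simp
    then have "adjoint L (L w) \<noteq> 0" by auto
    moreover have "\<exists>e>0. \<forall>y\<in>A. dist x y < e \<longrightarrow> \<bar>adjoint L (L w) \<bullet> (y - x)\<bar> \<le> k * dist x y" if k: "k > 0" for k
    proof -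
      have "k / (norm (L w) + 1) > 0" using k by (simp add: add_nonneg_pos)
      then obtain d where d: "d > 0" "\<forall>y\<in>A. norm (y - x) < d \<longrightarrow> norm (0 - 0 - L (y - x)) \<le> k / (norm (L w) + 1) * norm (y - x)"
        using der unfolding has_derivative_within_alt by blast
      have "\<bar>adjoint L (L w) \<bullet> (y - x)\<bar> \<le> k * dist x y" if y: "y \<in> A" "dist x y < d" for y
      proof -
        have "\<bar>adjoint L (L w) \<bullet> (y - x)\<bar> = \<bar>L (y - x) \<bullet> L w\<bar>"
          using adjoint_works[OF lin, of "y - x" "L w"] by (simp add: inner_commute)
        also have "\<dots> \<le> norm (L (y - x)) * norm (L w)" by (rule Cauchy_Schwarz_ineq2)
        also have "\<dots> \<le> (k / (norm (L w) + 1) * norm (y - x)) * (norm (L w) + 1)"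
          using d(2) y k by (intro mult_mono) (auto simp: dist_norm norm_minus_commute)
        also have "\<dots> = k * dist x y"
          using norm_ge_zero[of "L w"] by (simp add: dist_norm norm_minus_commute add_nonneg_eq_0_iff)
        finally show ?thesis .
      qed
      then show ?thesis using d(1) by blast
    qed
    ultimately show False using nx x by blast
  qed
qed

section \<open>Hadamard's inequality\<close>

text \<open>At a matrix maximizing \<open>\<bar>det\<bar>\<close> among those with rows of length at most 1 the rows are orthogonal:
  otherwise subtracting from a row its component along another one would keep the determinant, shorten
  the row, and leave room for rescaling.  Then \<open>M M\<^sup>T\<close> is diagonal with entries at most 1.\<close>
lemma hadamard_unit_rows:
  fixes A :: "real^'n^'n"
  assumes "\<And>i. norm (A $ i) \<le> 1"
  shows "\<bar>det A\<bar> \<le> 1"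
proof -
  define K where "K = {A :: real^'n^'n. \<forall>i. norm (A $ i) \<le> 1}"
  have "closed K"
  proof -
    have "closed {A :: real^'n^'n. norm (A $ i) \<le> 1}" for i
      by (intro closed_Collect_le continuous_on_norm continuous_on_component continuous_on_id continuous_on_const)
    then show ?thesis unfolding K_def by (rule closed_Collect_all)
  qed
  moreover have "bounded K"
  proof -
    have "norm A \<le> real CARD('n)" if "A \<in> K" for A :: "real^'n^'n"
    proof -
      have "norm A \<le> (\<Sum>i\<in>UNIV. norm (A $ i))" unfolding norm_vec_def by (rule L2_set_le_sum) simp
      also have "\<dots> \<le> (\<Sum>i\<in>(UNIV::'n set). 1)" using that by (intro sum_mono) (auto simp: K_def)
      finally show ?thesis by simp
    qed
    then show ?thesis unfolding bounded_iff by blast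
  qed
  ultimately have "compact K" by (simp add: compact_eq_bounded_closed)
  moreover have "mat 1 \<in> K"
  proof -
    have "norm ((mat 1 :: real^'n^'n) $ i) = 1" for i
    proof -
      have "(mat 1 :: real^'n^'n) $ i = axis i 1" by (auto simp: mat_def axis_def vec_eq_iff)
      then show ?thesis by simp
    qed
    then show ?thesis by (simp add: K_def)
  qed
  moreover have "continuous_on K (\<lambda>A. \<bar>det A\<bar>)"
    unfolding det_def by (intro continuous_intros)
  ultimately obtain M where M: "M \<in> K" "\<And>B. B \<in> K \<Longrightarrow> \<bar>det B\<bar> \<le> \<bar>det M\<bar>"
    using continuous_attains_sup[of K "\<lambda>A. \<bar>det A\<bar>"] by blast
  have M1: "\<bar>det M\<bar> \<ge> 1" using M(2)[OF \<open>mat 1 \<in> K\<close>] by simp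
  have rows: "row k M = M $ k" for k by (simp add: row_def)
  have orth: "M $ i \<bullet> M $ j = 0" if ij: "i \<noteq> j" for i j
  proof (rule ccontr)
    assume ab: "M $ i \<bullet> M $ j \<noteq> 0"
    define c where "c = - (M $ i \<bullet> M $ j) / (M $ j \<bullet> M $ j)"
    define w where "w = M $ i + c *s M $ j"
    have w: "det (\<chi> k. if k = i then w else M $ k) = det M"
      using det_row_operation[OF ij, of M c] unfolding rows w_def .
    have "M $ j \<noteq> 0" using ab by auto
    then have jj: "M $ j \<bullet> M $ j > 0" by simp
    have cj: "c * (M $ j \<bullet> M $ j) = - (M $ i \<bullet> M $ j)" using jj by (simp add: c_def)
    have "w \<bullet> w = M $ i \<bullet> M $ i + 2 * c * (M $ i \<bullet> M $ j) + c * (c * (M $ j \<bullet> M $ j))"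
      by (simp add: w_def inner_add_left inner_add_right scalar_mult_eq_scaleR inner_commute)
    then have "w \<bullet> w = M $ i \<bullet> M $ i - (M $ i \<bullet> M $ j)\<^sup>2 / (M $ j \<bullet> M $ j)"
      unfolding cj by (simp add: c_def power2_eq_square)
    moreover have "(M $ i \<bullet> M $ j)\<^sup>2 / (M $ j \<bullet> M $ j) > 0" using jj ab by simp
    moreover have "M $ i \<bullet> M $ i \<le> 1"
      using M(1) by (auto simp: K_def norm_eq_sqrt_inner)
    ultimately have nw: "norm w < 1" by (simp add: norm_eq_sqrt_inner)
    have "w \<noteq> 0"
    proof
      assume "w = 0"
      then have "row i (\<chi> k. if k = i then w else M $ k) = 0" by (simp add: row_def vec_eq_iff)
      then have "det (\<chi> k. if k = i then w else M $ k) = 0" by (rule det_zero_row)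
      then show False using w M1 by simp
    qed
    define B where "B = (\<chi> k. if k = i then (1 / norm w) *s w else M $ k)"
    have "B \<in> K" using M(1) \<open>w \<noteq> 0\<close> by (auto simp: B_def K_def scalar_mult_eq_scaleR)
    moreover have "det B = 1 / norm w * det M"
      unfolding B_def using det_row_mul[of i "1 / norm w" "\<lambda>_. w" "\<lambda>k. M $ k"] w by simp
    ultimately have "\<bar>det M\<bar> / norm w \<le> \<bar>det M\<bar>" using M(2)[of B] by (simp add: abs_mult)
    then have "\<bar>det M\<bar> \<le> \<bar>det M\<bar> * norm w" using \<open>w \<noteq> 0\<close> by (simp add: pos_divide_le_eq)
    moreover have "\<bar>det M\<bar> * norm w < \<bar>det M\<bar> * 1" using nw M1 by (intro mult_strict_left_mono) auto
    ultimately show False by simp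
  qed
  have "M ** transpose M = (\<chi> i j. if i = j then M $ i \<bullet> M $ i else 0)"
    using orth by (auto simp: matrix_matrix_mult_def transpose_def vec_eq_iff inner_vec_def)
  then have "det M * det M = (\<Prod>i\<in>UNIV. M $ i \<bullet> M $ i)"
    using det_mul[of M "transpose M"] det_diagonal[of "M ** transpose M"] by simp
  also have "\<dots> \<le> (\<Prod>i\<in>(UNIV::'n set). 1)"
    using M(1) by (intro prod_mono) (auto simp: K_def norm_eq_sqrt_inner)
  finally have "\<bar>det M\<bar> \<le> 1" using abs_square_le_1[of "det M"] by (simp add: power2_eq_square)
  then show ?thesis using M(2)[of A] assms by (simp add: K_def)
qed

lemma hadamard:
  fixes A :: "real^'n^'n"
  shows "\<bar>det A\<bar> \<le> (\<Prod>i\<in>UNIV. norm (A $ i))"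
proof (cases "\<exists>i. A $ i = 0")
  case True
  then obtain i where "row i A = 0" by (auto simp: row_def)
  then have "det A = 0" by (rule det_zero_row)
  then show ?thesis by (simp add: prod_nonneg)
next
  case False
  define B where "B = (\<chi> i. (1 / norm (A $ i)) *s A $ i)"
  have "\<bar>det B\<bar> \<le> 1" using False by (intro hadamard_unit_rows) (auto simp: B_def scalar_mult_eq_scaleR)
  moreover have "det B = (\<Prod>i\<in>UNIV. 1 / norm (A $ i)) * det A"
    unfolding B_def using det_rows_mul[of "\<lambda>i. 1 / norm (A $ i)" "\<lambda>i. A $ i"] by simp
  ultimately have "\<bar>det A\<bar> / (\<Prod>i\<in>UNIV. norm (A $ i)) \<le> 1"
    by (simp add: prod_dividef abs_mult abs_prod)
  moreover have "(\<Prod>i\<in>UNIV. norm (A $ i)) > 0" using False by (intro prod_pos) auto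
  ultimately show ?thesis by (simp only: pos_divide_le_eq mult_1)
qed

section \<open>Extension of Lipschitz functions\<close>

text \<open>McShane's extension \<open>F y = inf\<^sub>w (g w + L d y w)\<close>.  The last property makes the extension of
  \<open>g = 0\<close> with \<open>L = 1\<close> usable as the distance from \<open>N\<close>.\<close>
lemma (in Metric_space) mcshane:
  fixes g :: "'a \<Rightarrow> real"
  assumes N: "N \<subseteq> M" and L: "L \<ge> 0"
    and lip: "\<And>w w'. w \<in> N \<Longrightarrow> w' \<in> N \<Longrightarrow> \<bar>g w - g w'\<bar> \<le> L * d w w'"
  obtains F where "\<And>w. w \<in> N \<Longrightarrow> F w = g w"
    "\<And>y y'. y \<in> M \<Longrightarrow> y' \<in> M \<Longrightarrow> \<bar>F y - F y'\<bar> \<le> L * d y y'"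
    "\<And>y c. N \<noteq> {} \<Longrightarrow> y \<in> M \<Longrightarrow> F y < c \<Longrightarrow> \<exists>w\<in>N. g w + L * d y w < c"
proof (cases "N = {}")
  case True
  then show ?thesis using that[of "\<lambda>_. 0"] L by simp
next
  case False
  then obtain w0 where w0: "w0 \<in> N" by blast
  define F where "F y = (INF w\<in>N. g w + L * d y w)" for y
  have bdd: "bdd_below ((\<lambda>w. g w + L * d y w) ` N)" if y: "y \<in> M" for y
  proof (rule bdd_belowI2)
    fix w assume w: "w \<in> N"
    have "d w w0 \<le> d y w + d y w0" using triangle[of w y w0] commute w w0 N y by (metis subsetD)
    then have "L * d w w0 \<le> L * d y w + L * d y w0" using L by (metis distrib_left mult_left_mono)
    then show "g w0 - L * d y w0 \<le> g w + L * d y w" using lip[OF w w0] by linarith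
  qed
  show ?thesis
  proof (rule that[of F])
    fix w assume w: "w \<in> N"
    show "F w = g w"
    proof (rule antisym)
      show "F w \<le> g w"
        unfolding F_def using cINF_lower[OF bdd[of w] w] w N by auto
      show "g w \<le> F w"
        unfolding F_def
      proof (rule cINF_greatest)
        fix w' assume "w' \<in> N"
        then show "g w \<le> g w' + L * d w w'" using lip[OF w, of w'] by linarith
      qed (use False in auto)
    qed
  next
    fix y y' assume y: "y \<in> M" "y' \<in> M"
    have *: "F y - L * d y y' \<le> F y'" if y: "y \<in> M" "y' \<in> M" for y y'
      unfolding F_def[of y']
    proof (rule cINF_greatest)
      fix w assume w: "w \<in> N"
      have "F y \<le> g w + L * d y w" unfolding F_def by (rule cINF_lower[OF bdd[OF y(1)] w])
      moreover have "L * d y w \<le> L * d y y' + L * d y' w"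
        using triangle[of y y' w] w N y L by (metis distrib_left mult_left_mono subsetD)
      ultimately show "F y - L * d y y' \<le> g w + L * d y' w" by linarith
    qed (use False in auto)
    show "\<bar>F y - F y'\<bar> \<le> L * d y y'"
      using *[OF y] *[OF y(2,1)] unfolding commute[of y' y] by linarith
  next
    fix y c assume "y \<in> M" "F y < c"
    then show "\<exists>w\<in>N. g w + L * d y w < c"
      unfolding F_def using cINF_less_iff[OF False bdd] by simp
  qed
qed

lemma lipschitz_extension:
  fixes g :: "'a::euclidean_space \<Rightarrow> real"
  assumes "L-lipschitz_on U g"
  obtains G where "L-lipschitz_on UNIV G" "\<And>x. x \<in> U \<Longrightarrow> G x = g x"
proof -
  have L: "L \<ge> 0" using assms by (rule lipschitz_on_nonneg)
  obtain G where "\<And>w. w \<in> U \<Longrightarrow> G w = g w" "\<And>y y'. \<bar>G y - G y'\<bar> \<le> L * dist y y'"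
    using Met_TC.mcshane[of U L g] L lipschitz_onD[OF assms] unfolding dist_real_def by (metis UNIV_I subset_UNIV)
  then show ?thesis using L by (intro that[of G]) (auto intro!: lipschitz_onI simp: dist_real_def)
qed

section \<open>Jacobians of Lipschitz families\<close>

lemma lipschitz_derivative_bound:
  fixes f :: "'a::euclidean_space \<Rightarrow> real"
  assumes lip: "L-lipschitz_on UNIV f" and der: "(f has_derivative D) (at x)"
  shows "\<bar>D v\<bar> \<le> L * norm v"
proof -
  have "((\<lambda>t::real. x + t *\<^sub>R v) has_derivative (\<lambda>t. t *\<^sub>R v)) (at 0)"
    by (auto intro!: derivative_eq_intros)
  then have "((\<lambda>t::real. f (x + t *\<^sub>R v)) has_derivative (\<lambda>t. D (t *\<^sub>R v))) (at 0)"
    using has_derivative_compose[of "\<lambda>t::real. x + t *\<^sub>R v" _ 0 UNIV f D] der by simp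
  moreover have "D (t *\<^sub>R v) = D v * t" for t
    using has_derivative_linear[OF der] by (simp add: linear_cmul)
  ultimately have "((\<lambda>t. f (x + t *\<^sub>R v)) has_real_derivative D v) (at 0)"
    by (simp add: has_field_derivative_def)
  then have "(\<lambda>n. (f (x + (1 / real (Suc n)) *\<^sub>R v) - f x) * real (Suc n)) \<longlonglongrightarrow> D v"
    by (rule dirderiv_lim)
  moreover have "\<bar>(f (x + (1 / real (Suc n)) *\<^sub>R v) - f x) * real (Suc n)\<bar> \<le> L * norm v" for n
  proof -
    have "\<bar>f (x + (1 / real (Suc n)) *\<^sub>R v) - f x\<bar> \<le> L * (1 / real (Suc n) * norm v)"
      using lipschitz_onD[OF lip, of "x + (1 / real (Suc n)) *\<^sub>R v" x] by (simp add: dist_norm)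
    then have "\<bar>(f (x + (1 / real (Suc n)) *\<^sub>R v) - f x) * real (Suc n)\<bar> \<le> (L * (1 / real (Suc n) * norm v)) * real (Suc n)"
      unfolding abs_mult by (intro mult_mono) auto
    then show ?thesis by simp
  qed
  ultimately show ?thesis by (intro LIMSEQ_le_const2[OF tendsto_rabs]) auto
qed

lemma has_derivative_vec_lambda:
  fixes f :: "'n::finite \<Rightarrow> 'a::real_normed_vector \<Rightarrow> real"
  assumes "\<And>i. (f i has_derivative f' i) (at x within S)"
  shows "((\<lambda>x. \<chi> i. f i x) has_derivative (\<lambda>v. \<chi> i. f' i v)) (at x within S)"
proof -
  have *: "(\<chi> i. h i) = (\<Sum>i\<in>UNIV. h i *\<^sub>R axis i (1::real))" for h :: "'n \<Rightarrow> real"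
    using basis_expansion[of "\<chi> i. h i"] by (simp add: scalar_mult_eq_scaleR)
  show ?thesis
    unfolding * by (intro has_derivative_sum has_derivative_scaleR_left assms)
qed

text \<open>Uniqueness of the derivative is part of the definition: it is what identifies \<open>J\<close> with the
  determinant of \<^const>\<open>frechet_derivative\<close>, which selects an arbitrary derivative within \<open>A\<close>.\<close>
definition has_jacobian_ae :: "(real^'n) set \<Rightarrow> ('n::finite \<Rightarrow> real^'n \<Rightarrow> real) \<Rightarrow> (real^'n \<Rightarrow> real) \<Rightarrow> bool" where
  "has_jacobian_ae A g J \<longleftrightarrow> (\<exists>N. negligible N \<and> (\<forall>x\<in>A - N. \<exists>D.
     ((\<lambda>x. \<chi> i. g i x) has_derivative D) (at x within A) \<and>
     (\<forall>D'. ((\<lambda>x. \<chi> i. g i x) has_derivative D') (at x within A) \<longrightarrow> D' = D) \<and> det (matrix D) = J x))"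

text \<open>The derivative of an extension of the family to the whole space is a derivative within every \<open>A\<close>, and it
  is the only one almost everywhere.  So a single Borel function is the Jacobian relative to every
  subset of the domain, and pieces of the domain can be integrated separately.\<close>
lemma lipschitz_family_jacobian:
  fixes g :: "'n::finite \<Rightarrow> real^'n \<Rightarrow> real"
  assumes lip: "\<And>i. (l i)-lipschitz_on U (g i)"
  obtains J where "J \<in> borel_measurable borel" "\<And>x. \<bar>J x\<bar> \<le> (\<Prod>i\<in>UNIV. l i)"
    "\<And>A. A \<subseteq> U \<Longrightarrow> has_jacobian_ae A g J"
proof -
  have "\<exists>G. (l i)-lipschitz_on UNIV G \<and> (\<forall>x\<in>U. G x = g i x)" for i
    using lipschitz_extension[OF lip[of i]] by metis
  then obtain G where G: "\<And>i. (l i)-lipschitz_on UNIV (G i)" "\<And>i x. x \<in> U \<Longrightarrow> G i x = g i x" by metis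
  define DG where "DG i x v = (\<Sum>b\<in>Basis. (v \<bullet> b) * dirderiv (G i) b x)" for i x v
  define M where "M x = (\<chi> i j. dirderiv (G i) (axis j 1) x)" for x
  \<comment> \<open>Cutting off makes the bound hold everywhere; off the exceptional set nothing is cut off.\<close>
  define J where "J x = (if \<bar>det (M x)\<bar> \<le> (\<Prod>i\<in>UNIV. l i) then det (M x) else 0)" for x
  have l: "l i \<ge> 0" for i using lip lipschitz_on_nonneg by blast
  have cont: "continuous_on UNIV (G i)" for i using G(1) lipschitz_on_continuous_on by blast
  have [measurable]: "dirderiv (G i) v \<in> borel_measurable borel" for i v by (rule dirderiv_measurable[OF cont])
  have [measurable]: "(\<lambda>x. det (M x)) \<in> borel_measurable borel"
    unfolding det_def M_def by simp
  have "AE x in lborel. \<forall>i\<in>UNIV. ((G i) has_derivative DG i x) (at x)"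
    unfolding DG_def by (intro AE_finite_allI rademacher[OF G(1)]) auto
  then have "AE x in lebesgue. \<forall>i\<in>UNIV. ((G i) has_derivative DG i x) (at x)"
    by (rule AE_completion)
  then obtain N0 where N0: "N0 \<in> null_sets lebesgue" "{x. \<not> (\<forall>i\<in>UNIV. ((G i) has_derivative DG i x) (at x))} \<subseteq> N0"
    by (auto simp: eventually_ae_filter)
  have der: "((G i) has_derivative DG i x) (at x)" if "x \<notin> N0" for i x using N0(2) that by blast
  have MDG: "matrix (\<lambda>v. \<chi> i. DG i x v) = M x" for x
  proof -
    have "DG i x (axis j 1) = dirderiv (G i) (axis j 1) x" for i j
    proof -
      have "DG i x (axis j 1) = (\<Sum>b\<in>Basis. if b = axis j 1 then dirderiv (G i) b x else 0)"
        unfolding DG_def by (intro sum.cong) (auto simp: inner_Basis axis_in_Basis_iff)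
      then show ?thesis by (simp add: sum.delta axis_in_Basis_iff)
    qed
    then show ?thesis by (simp add: matrix_def M_def)
  qed
  have bound: "\<bar>det (M x)\<bar> \<le> (\<Prod>i\<in>UNIV. l i)" if x: "x \<notin> N0" for x
  proof -
    have "norm (M x $ i) \<le> l i" for i
    proof -
      have "DG i x (M x $ i) = (\<Sum>j\<in>UNIV. M x $ i $ j * DG i x (axis j 1))"
        using has_derivative_linear[OF der[OF x, of i]] basis_expansion[of "M x $ i"]
          linear_sum[of "DG i x" "\<lambda>j. M x $ i $ j *\<^sub>R axis j 1" UNIV]
        by (simp add: linear_cmul scalar_mult_eq_scaleR)
      also have "\<dots> = M x $ i \<bullet> M x $ i"
        using MDG[of x] by (auto simp: inner_vec_def matrix_def vec_eq_iff intro!: sum.cong)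
      finally have "M x $ i \<bullet> M x $ i \<le> l i * norm (M x $ i)"
        using lipschitz_derivative_bound[OF G(1) der[OF x], of i "M x $ i"] by simp
      then have "norm (M x $ i) * norm (M x $ i) \<le> l i * norm (M x $ i)"
        by (simp add: power2_norm_eq_inner[symmetric] power2_eq_square)
      then show ?thesis using l[of i] by (cases "M x $ i = 0") auto
    qed
    then have "(\<Prod>i\<in>UNIV. norm (M x $ i)) \<le> (\<Prod>i\<in>UNIV. l i)" by (intro prod_mono) auto
    then show ?thesis using hadamard[of "M x"] by linarith
  qed
  show ?thesis
  proof (rule that[of J])
    show "J \<in> borel_measurable borel" unfolding J_def[abs_def] by measurable
    show "\<bar>J x\<bar> \<le> (\<Prod>i\<in>UNIV. l i)" for x using l by (auto simp: J_def prod_nonneg)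
    fix A assume A: "A \<subseteq> U"
    obtain N1 where N1: "negligible N1" "\<And>x (f :: real^'n \<Rightarrow> real^'n) D D'. x \<in> A \<Longrightarrow> x \<notin> N1 \<Longrightarrow>
       (f has_derivative D) (at x within A) \<Longrightarrow> (f has_derivative D') (at x within A) \<Longrightarrow> D = D'"
      using derivative_within_unique_ae[of A] by blast
    have "\<exists>D. ((\<lambda>x. \<chi> i. g i x) has_derivative D) (at x within A) \<and>
        (\<forall>D'. ((\<lambda>x. \<chi> i. g i x) has_derivative D') (at x within A) \<longrightarrow> D' = D) \<and> det (matrix D) = J x"
      if x: "x \<in> A" "x \<notin> N0" "x \<notin> N1" for x
    proof (intro exI conjI allI impI)
      have "((\<lambda>x. \<chi> i. G i x) has_derivative (\<lambda>v. \<chi> i. DG i x v)) (at x)"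
        using der[OF x(2)] by (rule has_derivative_vec_lambda)
      then have "((\<lambda>x. \<chi> i. G i x) has_derivative (\<lambda>v. \<chi> i. DG i x v)) (at x within A)"
        by (rule has_derivative_at_withinI)
      moreover have "(\<chi> i. G i y) = (\<chi> i. g i y)" if "y \<in> A" for y using G(2) A that by auto
      ultimately show D: "((\<lambda>x. \<chi> i. g i x) has_derivative (\<lambda>v. \<chi> i. DG i x v)) (at x within A)"
        using has_derivative_transform[OF x(1), of "\<lambda>x. \<chi> i. g i x" "\<lambda>x. \<chi> i. G i x"] by simp
      show "D' = (\<lambda>v. \<chi> i. DG i x v)" if "((\<lambda>x. \<chi> i. g i x) has_derivative D') (at x within A)" for D'
        using N1(2)[OF x(1,3) that D] .
      show "det (matrix (\<lambda>v. \<chi> i. DG i x v)) = J x"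
        unfolding MDG J_def using bound[OF x(2)] by simp
    qed
    moreover have "negligible (N0 \<union> N1)"
      using N0(1) N1(1) by (intro negligible_Un) (simp_all add: negligible_iff_null_sets)
    ultimately show "has_jacobian_ae A g J"
      unfolding has_jacobian_ae_def by (intro exI[of _ "N0 \<union> N1"]) blast
  qed
qed

lemma AE_lebesgue_negligibleI:
  assumes "negligible N" "\<And>x. x \<notin> N \<Longrightarrow> P x"
  shows "AE x in lebesgue. P x"
proof -
  have "AE x in lebesgue. x \<notin> N" using assms(1) AE_not_in negligible_iff_null_sets by blast
  then show ?thesis by eventually_elim (rule assms(2))
qed

lemma has_jacobian_ae_frechet:
  assumes "has_jacobian_ae A g J"
  shows "AE x in lebesgue. x \<in> A \<longrightarrow> det (matrix (frechet_derivative (\<lambda>x. \<chi> i. g i x) (at x within A))) = J x"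
proof -
  obtain N where N: "negligible N" "\<forall>x\<in>A - N. \<exists>D.
     ((\<lambda>x. \<chi> i. g i x) has_derivative D) (at x within A) \<and>
     (\<forall>D'. ((\<lambda>x. \<chi> i. g i x) has_derivative D') (at x within A) \<longrightarrow> D' = D) \<and> det (matrix D) = J x"
    using assms unfolding has_jacobian_ae_def by blast
  show ?thesis
  proof (rule AE_lebesgue_negligibleI[OF N(1)], rule impI)
    fix x assume "x \<notin> N" "x \<in> A"
    then obtain D where D: "((\<lambda>x. \<chi> i. g i x) has_derivative D) (at x within A)"
     "\<forall>D'. ((\<lambda>x. \<chi> i. g i x) has_derivative D') (at x within A) \<longrightarrow> D' = D" "det (matrix D) = J x" using N(2) by blast
    have "((\<lambda>x. \<chi> i. g i x) has_derivative frechet_derivative (\<lambda>x. \<chi> i. g i x) (at x within A)) (at x within A)"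
      unfolding frechet_derivative_works[symmetric] by (rule differentiableI[OF D(1)])
    then have "frechet_derivative (\<lambda>x. \<chi> i. g i x) (at x within A) = D"
      by (rule D(2)[rule_format])
    then show "det (matrix (frechet_derivative (\<lambda>x. \<chi> i. g i x) (at x within A))) = J x" using D(3) by simp
  qed
qed

lemma has_jacobian_ae_unique:
  assumes "has_jacobian_ae A g J"
    and "\<And>x. x \<in> A \<Longrightarrow> ((\<lambda>x. \<chi> i. g i x) has_derivative D) (at x within A)"
  shows "AE x in lebesgue. x \<in> A \<longrightarrow> J x = det (matrix D)"
proof -
  obtain N where N: "negligible N" "\<forall>x\<in>A - N. \<exists>D.
     ((\<lambda>x. \<chi> i. g i x) has_derivative D) (at x within A) \<and>
     (\<forall>D'. ((\<lambda>x. \<chi> i. g i x) has_derivative D') (at x within A) \<longrightarrow> D' = D) \<and> det (matrix D) = J x"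
    using assms unfolding has_jacobian_ae_def by blast
  show ?thesis
  proof (rule AE_lebesgue_negligibleI[OF N(1)], rule impI)
    fix x assume "x \<notin> N" "x \<in> A"
    then obtain E where E: "\<forall>D'. ((\<lambda>x. \<chi> i. g i x) has_derivative D') (at x within A) \<longrightarrow> D' = E"
      "det (matrix E) = J x" using N(2) by blast
    have "D = E" using E(1) assms(2)[OF \<open>x \<in> A\<close>] by blast
    then show "J x = det (matrix D)" using E(2) by simp
  qed
qed

lemma has_jacobian_ae_constant:
  fixes g :: "'n::finite \<Rightarrow> real^'n \<Rightarrow> real"
  assumes J: "has_jacobian_ae A g J" and c: "\<And>i x. x \<in> A \<Longrightarrow> g i x = c i"
  shows "AE x in lebesgue. x \<in> A \<longrightarrow> J x = 0"
proof -
  have "((\<lambda>x. \<chi> i. g i x) has_derivative (\<lambda>_. 0)) (at x within A)" if "x \<in> A" for x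
    by (rule has_derivative_transform[OF that _ has_derivative_const[of "\<chi> i. c i"]]) (simp add: c)
  moreover have "det (matrix (\<lambda>_::real^'n. 0 :: real^'n)) = 0"
  proof (rule det_zero_row)
    show "row undefined (matrix (\<lambda>_::real^'n. 0 :: real^'n)) = 0" by (simp add: row_def matrix_def vec_eq_iff)
  qed
  ultimately show ?thesis using has_jacobian_ae_unique[OF J, of "\<lambda>_. 0"] by simp
qed

lemma has_jacobian_ae_coordinates:
  fixes g :: "'n::finite \<Rightarrow> real^'n \<Rightarrow> real"
  assumes J: "has_jacobian_ae A g J" and c: "\<And>i x. x \<in> A \<Longrightarrow> g i x = x $ i"
  shows "AE x in lebesgue. x \<in> A \<longrightarrow> J x = 1"
proof -
  have "((\<lambda>x. \<chi> i. g i x) has_derivative (\<lambda>v. v)) (at x within A)" if "x \<in> A" for x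
    by (rule has_derivative_transform[OF that _ has_derivative_ident]) (simp add: c vec_lambda_eta)
  moreover have "matrix (\<lambda>v::real^'n. v) = mat 1" using matrix_id_mat_1 by (simp add: id_def)
  ultimately show ?thesis using has_jacobian_ae_unique[OF J, of "\<lambda>v. v"] by simp
qed

text \<open>The chain rule, together with the fact that \<open>\<rho>\<close> carries derivatives within \<open>\<rho>\<inverse>(A)\<close> back to
  derivatives within \<open>A\<close>, which preserves uniqueness.\<close>
lemma has_jacobian_ae_involution:
  fixes g :: "'n::finite \<Rightarrow> real^'n \<Rightarrow> real"
  assumes J: "has_jacobian_ae A g J" and lin: "linear \<rho>" and inv: "\<And>x. \<rho> (\<rho> x) = x"
  shows "has_jacobian_ae (\<rho> -` A) (\<lambda>i. g i \<circ> \<rho>) (\<lambda>x. det (matrix \<rho>) * J (\<rho> x))"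
proof -
  obtain N where N: "negligible N" "\<And>x. x \<in> A - N \<Longrightarrow> \<exists>D.
     ((\<lambda>x. \<chi> i. g i x) has_derivative D) (at x within A) \<and>
     (\<forall>D'. ((\<lambda>x. \<chi> i. g i x) has_derivative D') (at x within A) \<longrightarrow> D' = D) \<and> det (matrix D) = J x"
    using J unfolding has_jacobian_ae_def by blast
  have img: "\<rho> -` B = \<rho> ` B" for B
  proof (intro equalityI subsetI)
    fix x assume "x \<in> \<rho> -` B"
    then show "x \<in> \<rho> ` B" using inv[of x] by (metis image_eqI vimageD)
  qed (auto simp: inv)
  then have img2: "\<rho> ` \<rho> -` B = B" for B using inv by (simp add: image_comp o_def)
  have "negligible (\<rho> -` N)"
    unfolding img
    using N(1) linear_imp_differentiable_on[OF lin] by (intro negligible_differentiable_image_negligible) auto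
  have der: "(\<rho> has_derivative \<rho>) (at x within B)" for x B
    using lin by (simp add: linear_imp_has_derivative)
  show ?thesis
    unfolding has_jacobian_ae_def
  proof (intro exI[of _ "\<rho> -` N"] conjI ballI)
    fix x assume x: "x \<in> \<rho> -` A - \<rho> -` N"
    then obtain D where D: "((\<lambda>x. \<chi> i. g i x) has_derivative D) (at (\<rho> x) within A)"
     "\<And>D'. ((\<lambda>x. \<chi> i. g i x) has_derivative D') (at (\<rho> x) within A) \<Longrightarrow> D' = D" "det (matrix D) = J (\<rho> x)"
      using N(2)[of "\<rho> x"] by blast
    show "\<exists>D. ((\<lambda>x. \<chi> i. (g i \<circ> \<rho>) x) has_derivative D) (at x within \<rho> -` A) \<and>
     (\<forall>D'. ((\<lambda>x. \<chi> i. (g i \<circ> \<rho>) x) has_derivative D') (at x within \<rho> -` A) \<longrightarrow> D' = D) \<and>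
     det (matrix D) = det (matrix \<rho>) * J (\<rho> x)"
    proof (intro exI[of _ "D \<circ> \<rho>"] conjI allI impI)
      show "((\<lambda>x. \<chi> i. (g i \<circ> \<rho>) x) has_derivative D \<circ> \<rho>) (at x within \<rho> -` A)"
        using diff_chain_within[OF der, of "\<lambda>x. \<chi> i. g i x" D x "\<rho> -` A"] D(1) unfolding img2 by (simp add: o_def)
      show "D' = D \<circ> \<rho>" if D': "((\<lambda>x. \<chi> i. (g i \<circ> \<rho>) x) has_derivative D') (at x within \<rho> -` A)" for D'
      proof -
        have "((\<lambda>x. \<chi> i. (g i \<circ> \<rho>) x) \<circ> \<rho> has_derivative D' \<circ> \<rho>) (at (\<rho> x) within A)"
          using D' by (intro diff_chain_within der) (simp add: img[symmetric] inv)
        then have "D' \<circ> \<rho> = D" using D(2) by (simp add: o_def inv)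
        then have "D' (\<rho> (\<rho> y)) = D (\<rho> y)" for y by (metis o_apply)
        then show ?thesis by (simp add: fun_eq_iff inv)
      qed
      have "linear D" using D(1) by (rule has_derivative_linear)
      then have "matrix (D \<circ> \<rho>) = matrix D ** matrix \<rho>" using lin by (simp add: matrix_compose)
      then show "det (matrix (D \<circ> \<rho>)) = det (matrix \<rho>) * J (\<rho> x)" using D(3) by (simp add: det_mul)
    qed
  qed fact
qed

text \<open>Lebesgue measure is complete, so the values of the integrand on the exceptional null set
  do not affect measurability either.\<close>
lemma integration_current_eq:
  fixes g :: "'n::finite \<Rightarrow> real^'n \<Rightarrow> real"
  assumes J: "has_jacobian_ae A g J"
    and meas: "(\<lambda>x. indicator A x * (F x * J x)) \<in> borel_measurable lebesgue"
  shows "integration_current A F g = (LINT x:A|lebesgue. F x * J x)"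
proof -
  have AE: "AE x in lebesgue. indicator A x * (F x * J x) =
      indicator A x * (F x * det (matrix (frechet_derivative (\<lambda>x. \<chi> i. g i x) (at x within A))))"
    using has_jacobian_ae_frechet[OF J] by eventually_elim (auto simp: indicator_def)
  show ?thesis
    unfolding integration_current_def set_lebesgue_integral_def real_scaleR_def
    by (rule integral_cong_AE[OF borel_measurable_AE[OF meas AE] meas]) (use AE in \<open>eventually_elim, auto\<close>)
qed

section \<open>The smocked metric\<close>

lemma smocking_gap:
  fixes \<I> :: "'a::euclidean_space set set"
  assumes smock: "smocking \<I>" and x: "x \<notin> \<Union>\<I>"
  obtains r where "r > 0" "\<And>z. z \<in> \<Union>\<I> \<Longrightarrow> r \<le> dist x z"
proof -
  obtain w :: 'a where "w \<noteq> x" using UNIV_not_singleton[of x] by blast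
  then have "smocking_map \<I> w \<noteq> smocking_map \<I> x"
    using x unfolding smocking_map_eq_iff[OF smock] by blast
  then obtain r where r: "r > 0"
    "\<And>v' a. smocking_map \<I> v' = smocking_map \<I> x \<Longrightarrow> smocking_map \<I> a \<noteq> smocking_map \<I> x \<Longrightarrow>
       a \<in> \<Union>\<I> \<or> smocking_map \<I> a = smocking_map \<I> w \<Longrightarrow> r \<le> dist v' a"
    using fibre_isolated[OF smock] by metis
  show ?thesis
  proof (rule that[OF r(1)])
    fix z assume z: "z \<in> \<Union>\<I>"
    then have "smocking_map \<I> z \<noteq> smocking_map \<I> x"
      using x unfolding smocking_map_eq_iff[OF smock] by blast
    then show "r \<le> dist x z" using r(2)[of x z] z by blast
  qed
qed

lemma closed_smocking_set:
  fixes \<I> :: "'a::euclidean_space set set"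
  assumes smock: "smocking \<I>"
  shows "closed (\<Union>\<I>)"
  unfolding closed_def open_dist
proof
  fix x assume "x \<in> - \<Union>\<I>"
  then obtain r where "r > 0" "\<And>z. z \<in> \<Union>\<I> \<Longrightarrow> r \<le> dist x z" using smocking_gap[OF smock] by blast
  then show "\<exists>e>0. \<forall>y. dist y x < e \<longrightarrow> y \<in> - \<Union>\<I>"
    by (intro exI[of _ r]) (auto simp: dist_commute not_less[symmetric])
qed

lemma smocked_dist_le_dist:
  fixes \<I> :: "'a::euclidean_space set set"
  assumes smock: "smocking \<I>"
  shows "smocked_dist \<I> (smocking_map \<I> v) (smocking_map \<I> w) \<le> dist v w"
  using smocked_dist_le[OF smock, of "[]" v w] by simp

text \<open>A list of jumps either never leaves its place, in which case the triangle inequality applies, or it has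
  to reach the smocking set first.\<close>
lemma jump_length_ge_min:
  fixes \<I> :: "'a::euclidean_space set set"
  assumes smock: "smocking \<I>" and far: "\<And>z. z \<in> \<Union>\<I> \<Longrightarrow> r \<le> dist v z"
    and ps: "jump_list \<I> ps"
  shows "min (dist v w) r \<le> jump_length v ps w"
  using ps
proof (induction ps)
  case Nil
  then show ?case by simp
next
  case (Cons q ps)
  obtain a b where q: "q = (a, b)" by (cases q)
  have ab: "smocking_map \<I> a = smocking_map \<I> b" "jump_list \<I> ps" using Cons.prems q by auto
  show ?case
  proof (cases "a = b")
    case True
    then have "jump_length v ps w \<le> jump_length v (q # ps) w" using q jump_length_triangle by simp
    then show ?thesis using Cons.IH[OF ab(2)] by linarith
  next
    case False
    then have "a \<in> \<Union>\<I>" using ab(1) unfolding smocking_map_eq_iff[OF smock] by blast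
    then have "r \<le> dist v a" by (rule far)
    then show ?thesis using q jump_length_nonneg[of b ps w] by simp
  qed
qed

text \<open>Away from the smocking set the smocked distance agrees with the Euclidean one at scales below the
  distance from the smocking set; all uses of the smocked metric from below rest on this.\<close>
lemma smocked_dist_ge_min:
  fixes \<I> :: "'a::euclidean_space set set"
  assumes smock: "smocking \<I>" and r: "r > 0" and far: "\<And>z. z \<in> \<Union>\<I> \<Longrightarrow> r \<le> dist v z"
  shows "min (dist v w) r \<le> smocked_dist \<I> (smocking_map \<I> v) (smocking_map \<I> w)"
proof (rule smocked_dist_ge[OF smock])
  fix v' w' ps
  assume *: "smocking_map \<I> v' = smocking_map \<I> v" "smocking_map \<I> w' = smocking_map \<I> w" "jump_list \<I> ps"
  have "v \<notin> \<Union>\<I>" using far[of v] r by auto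
  then have [simp]: "v' = v" using *(1) unfolding smocking_map_eq_iff[OF smock] by blast
  have "w' = w \<or> w' \<in> \<Union>\<I>" using *(2) unfolding smocking_map_eq_iff[OF smock] by blast
  then have "w' = w \<or> r \<le> dist v w'" using far by blast
  then have "min (dist v w) r \<le> min (dist v w') r" by auto
  also have "\<dots> \<le> jump_length v ps w'" by (rule jump_length_ge_min[OF smock far *(3)])
  finally show "min (dist v w) r \<le> jump_length v' ps w'" by simp
qed

text \<open>Cover a bounded set by finitely many balls so small that no ball meets two stitches.\<close>
lemma finite_stitches_meeting_bounded:
  fixes \<I> :: "'a::euclidean_space set set"
  assumes smock: "smocking \<I>" and B: "bounded B"
  shows "finite {I\<in>\<I>. I \<inter> B \<noteq> {}}"
proof -
  obtain \<delta> where \<delta>: "\<delta> > 0" and sep: "\<And>I I' z z'. I \<in> \<I> \<Longrightarrow> I' \<in> \<I> \<Longrightarrow> I \<noteq> I' \<Longrightarrow>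
      z \<in> I \<Longrightarrow> z' \<in> I' \<Longrightarrow> \<delta> \<le> dist z z'"
    using smock unfolding smocking_def by metis
  have "compact (closure B)" using B by (simp add: compact_closure)
  moreover have "closure B \<subseteq> (\<Union>c\<in>closure B. ball c (\<delta> / 2))" using \<delta> by force
  ultimately obtain K where K: "finite K" "closure B \<subseteq> (\<Union>c\<in>K. ball c (\<delta> / 2))"
    using compactE_image[of "closure B" "closure B" "\<lambda>c. ball c (\<delta> / 2)"] by (metis open_ball)
  have "\<exists>c\<in>K. \<exists>z\<in>I. z \<in> ball c (\<delta> / 2)" if "I \<in> {I\<in>\<I>. I \<inter> B \<noteq> {}}" for I
    using that K(2) closure_subset[of B] by blast
  then obtain c where c: "\<And>I. I \<in> {I\<in>\<I>. I \<inter> B \<noteq> {}} \<Longrightarrow> c I \<in> K \<and> (\<exists>z\<in>I. z \<in> ball (c I) (\<delta> / 2))"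
    by metis
  have "inj_on c {I\<in>\<I>. I \<inter> B \<noteq> {}}"
  proof (rule inj_onI, rule ccontr)
    fix I I' assume I: "I \<in> {I\<in>\<I>. I \<inter> B \<noteq> {}}" "I' \<in> {I\<in>\<I>. I \<inter> B \<noteq> {}}" "c I = c I'" "I \<noteq> I'"
    obtain z z' where z: "z \<in> I" "z \<in> ball (c I) (\<delta> / 2)" "z' \<in> I'" "z' \<in> ball (c I) (\<delta> / 2)"
      using c[OF I(1)] c[OF I(2)] I(3) by auto
    have "dist z z' < \<delta>"
      using z(2,4) dist_triangle3[of z z' "c I"] by (simp add: dist_commute)
    moreover have "\<delta> \<le> dist z z'" using sep I z by blast
    ultimately show False by simp
  qed
  moreover have "c ` {I\<in>\<I>. I \<inter> B \<noteq> {}} \<subseteq> K" using c by blast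
  ultimately show ?thesis using K(1) by (meson finite_imageD finite_subset)
qed

definition thickening :: "real \<Rightarrow> 'a::metric_space set \<Rightarrow> 'a set" where
  "thickening c B = {w. \<exists>b\<in>B. dist b w \<le> c}"

text \<open>The points reached from \<open>B\<close> by at most one jump; together with \<open>thickening\<close> this bounds
  how far jump lists of given length and number of jumps can travel.\<close>
definition stitch_fill :: "'a set set \<Rightarrow> 'a set \<Rightarrow> 'a set" where
  "stitch_fill \<I> B = B \<union> \<Union>{I\<in>\<I>. I \<inter> B \<noteq> {}}"

lemma bounded_thickening: "bounded B \<Longrightarrow> bounded (thickening c B)"
proof -
  assume "bounded B"
  then obtain x e where "\<forall>b\<in>B. dist x b \<le> e" unfolding bounded_def by blast
  then have "\<forall>w\<in>thickening c B. dist x w \<le> e + c"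
    unfolding thickening_def by (force intro: order_trans[OF dist_triangle] add_mono)
  then show ?thesis unfolding bounded_def by blast
qed

lemma bounded_stitch_fill:
  fixes \<I> :: "'a::euclidean_space set set"
  assumes smock: "smocking \<I>" and "bounded B"
  shows "bounded (stitch_fill \<I> B)"
proof -
  have "bounded (\<Union>{I\<in>\<I>. I \<inter> B \<noteq> {}})"
    using finite_stitches_meeting_bounded[OF assms] stitch_compact[OF smock]
    by (intro bounded_Union) (auto intro: compact_imp_bounded)
  then show ?thesis using assms(2) by (simp add: stitch_fill_def)
qed

lemma stitch_fill_fibre:
  fixes \<I> :: "'a::euclidean_space set set"
  assumes smock: "smocking \<I>" and "a \<in> B" "smocking_map \<I> a = smocking_map \<I> b"
  shows "b \<in> stitch_fill \<I> B"
  using assms(2,3) unfolding smocking_map_eq_iff[OF smock] stitch_fill_def by blast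

text \<open>Between consecutive jumps one travels from one stitch to a different one, at least the separation
  \<open>\<delta>\<close>.  The first jump \<open>(a, b)\<close> is kept apart, since reaching it may cost nothing.\<close>
lemma many_jumps_long:
  fixes \<I> :: "'a::euclidean_space set set"
  assumes smock: "smocking \<I>" and sep: "\<And>I I' z z'. I \<in> \<I> \<Longrightarrow> I' \<in> \<I> \<Longrightarrow> I \<noteq> I' \<Longrightarrow>
      z \<in> I \<Longrightarrow> z' \<in> I' \<Longrightarrow> \<delta> \<le> dist z z'"
    and "jump_list \<I> ((a, b) # qs)" "\<forall>q\<in>set ((a, b) # qs). fst q \<in> \<Union>\<I>"
    "successively (\<lambda>p q. smocking_map \<I> (fst p) \<noteq> smocking_map \<I> (fst q)) ((a, b) # qs)"
  shows "real (length qs) * \<delta> \<le> jump_length b qs w"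
  using assms(3-5)
proof (induction qs arbitrary: a b)
  case Nil
  then show ?case by simp
next
  case (Cons q qs)
  obtain a' b' where q: "q = (a', b')" by (cases q)
  have S: "a \<in> \<Union>\<I>" "a' \<in> \<Union>\<I>" and ne: "smocking_map \<I> a \<noteq> smocking_map \<I> a'"
    and ab: "smocking_map \<I> a = smocking_map \<I> b"
    using Cons.prems q by auto
  have "b \<in> \<Union>\<I>" using ab S unfolding smocking_map_eq_iff[OF smock] by blast
  then obtain I I' where I: "I \<in> \<I>" "b \<in> I" "I' \<in> \<I>" "a' \<in> I'" using S by blast
  have "I \<noteq> I'" using ne I unfolding ab smocking_map_eq_iff[OF smock] by blast
  then have "\<delta> \<le> dist b a'" using sep I by blast
  moreover have "real (length qs) * \<delta> \<le> jump_length b' qs w"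
    using Cons.prems by (intro Cons.IH[of a']) (auto simp: q)
  ultimately show ?case by (simp add: q algebra_simps)
qed

text \<open>One step of the iteration follows the list up to and including its next jump.\<close>
lemma short_jumps_reach:
  fixes \<I> :: "'a::euclidean_space set set"
  assumes smock: "smocking \<I>"
    and "jump_list \<I> ps" "v \<in> B" "jump_length v ps w \<le> c" "length ps \<le> m" "c \<ge> 0"
  shows "w \<in> ((stitch_fill \<I> \<circ> thickening c) ^^ Suc m) B"
  using assms(2-5)
proof (induction m arbitrary: ps v B)
  case 0
  then have "dist v w \<le> c" by simp
  then show ?case using 0 by (auto simp: stitch_fill_def thickening_def)
next
  case (Suc m)
  let ?R = "stitch_fill \<I> \<circ> thickening c"
  have sub: "B \<subseteq> ?R B" using \<open>c \<ge> 0\<close> by (force simp: stitch_fill_def thickening_def)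
  show ?case
  proof (cases ps)
    case Nil
    then have "w \<in> (?R ^^ Suc m) (?R B)" using Suc.prems sub by (intro Suc.IH[of "[]" v]) auto
    then show ?thesis unfolding funpow_Suc_right[of "Suc m"] by (simp only: o_apply)
  next
    case (Cons q qs)
    obtain a b where q: "q = (a, b)" by (cases q)
    have l: "dist v a + jump_length b qs w \<le> c" using Suc.prems Cons q by simp
    then have l': "jump_length b qs w \<le> c" using zero_le_dist[of v a] by linarith
    have "dist v a \<le> c" using l jump_length_nonneg[of b qs w] by linarith
    then have "a \<in> thickening c B" using Suc.prems by (auto simp: thickening_def)
    then have "b \<in> ?R B" using Suc.prems Cons q by (auto intro!: stitch_fill_fibre[OF smock])
    then have "w \<in> (?R ^^ Suc m) (?R B)"
      using Suc.prems l' Cons q by (intro Suc.IH[of qs b]) auto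
    then show ?thesis unfolding funpow_Suc_right[of "Suc m"] by (simp only: o_apply)
  qed
qed

text \<open>A stitch may be arbitrarily long, so that smocked balls can be much larger than Euclidean ones.
  Nevertheless a point at smocked distance at most \<open>R\<close> is reached with a bounded number of jumps, and
  each jump and each walk enlarges a bounded set to a bounded set.\<close>
lemma bounded_smocked_ball_preimage:
  fixes \<I> :: "'a::euclidean_space set set"
  assumes smock: "smocking \<I>"
  shows "bounded {w. smocked_dist \<I> (smocking_map \<I> v) (smocking_map \<I> w) \<le> R}"
proof -
  obtain \<delta> where \<delta>: "\<delta> > 0" and sep: "\<And>I I' z z'. I \<in> \<I> \<Longrightarrow> I' \<in> \<I> \<Longrightarrow> I \<noteq> I' \<Longrightarrow>
      z \<in> I \<Longrightarrow> z' \<in> I' \<Longrightarrow> \<delta> \<le> dist z z'"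
    using smock unfolding smocking_def by metis
  define c where "c = \<bar>R\<bar> + 1"
  \<comment> \<open>All but the first of the jumps of a list of length at most \<open>c\<close> are preceded by a walk of length at least \<open>\<delta>\<close>.\<close>
  define m where "m = nat \<lceil>c / \<delta>\<rceil> + 1"
  define V where "V = stitch_fill \<I> (((stitch_fill \<I> \<circ> thickening c) ^^ Suc m) (stitch_fill \<I> {v}))"
  have "bounded (((stitch_fill \<I> \<circ> thickening c) ^^ k) (stitch_fill \<I> {v}))" for k
    by (induction k) (auto intro!: bounded_stitch_fill[OF smock] bounded_thickening)
  then have "bounded V" unfolding V_def by (intro bounded_stitch_fill[OF smock])
  moreover have "w \<in> V" if w: "smocked_dist \<I> (smocking_map \<I> v) (smocking_map \<I> w) \<le> R" for w
  proof -
    have "\<not> c \<le> smocked_dist \<I> (smocking_map \<I> v) (smocking_map \<I> w)" using w by (simp add: c_def)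
    then obtain v' w' ps where *: "smocking_map \<I> v' = smocking_map \<I> v"
      "smocking_map \<I> w' = smocking_map \<I> w" "jump_list \<I> ps" "jump_length v' ps w' < c"
      using smocked_dist_ge[OF smock, of v w c] by (meson not_le)
    obtain qs where qs: "jump_list \<I> qs" "\<forall>q\<in>set qs. fst q \<in> \<Union>\<I>"
       "successively (\<lambda>p q. smocking_map \<I> (fst p) \<noteq> smocking_map \<I> (fst q)) qs"
       "jump_length v' qs w' \<le> jump_length v' ps w'"
      using normalize_jump_list[OF smock *(3)] by blast
    have "length qs \<le> m"
    proof (cases qs)
      case Nil
      then show ?thesis by simp
    next
      case (Cons q rs)
      obtain a b where q: "q = (a, b)" by (cases q)
      have "real (length rs) * \<delta> \<le> jump_length b rs w'"
        using qs(1-3) unfolding Cons q by (intro many_jumps_long[OF smock sep]) 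
      also have "\<dots> \<le> jump_length v' qs w'" unfolding Cons q by simp
      also have "\<dots> \<le> c" using qs(4) *(4) by simp
      finally have "real (length rs) \<le> c / \<delta>" using \<delta> by (simp add: field_simps)
      then show ?thesis unfolding m_def Cons by (simp add: le_nat_iff) linarith
    qed
    moreover have "v' \<in> stitch_fill \<I> {v}" using *(1) by (intro stitch_fill_fibre[OF smock, of v]) auto
    ultimately have "w' \<in> ((stitch_fill \<I> \<circ> thickening c) ^^ Suc m) (stitch_fill \<I> {v})"
      using qs(1,4) *(4) by (intro short_jumps_reach[OF smock]) (auto simp: c_def)
    then show ?thesis unfolding V_def using *(2) by (rule stitch_fill_fibre[OF smock])
  qed
  then have "{w. smocked_dist \<I> (smocking_map \<I> v) (smocking_map \<I> w) \<le> R} \<subseteq> V" by blast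
  ultimately show ?thesis by (rule bounded_subset)
qed

lemma mcball_smocked_preimage:
  fixes \<I> :: "'a::euclidean_space set set"
  assumes smock: "smocking \<I>" and p: "p \<in> smocked_points \<I>"
  shows "smocking_map \<I> -` mcball_of (smocked_space \<I>) p R = {w. smocked_dist \<I> p (smocking_map \<I> w) \<le> R}"
proof -
  interpret X: Metric_space "smocked_points \<I>" "smocked_dist \<I>" by (rule Metric_space_smocked[OF smock])
  have "smocking_map \<I> w \<in> smocked_points \<I>" for w using range_smocking_map[OF smock] by blast
  moreover have "mcball_of (smocked_space \<I>) p R = X.mcball p R"
    by (simp add: mcball_of_def mspace_smocked_space[OF smock] mdist_smocked_space[OF smock])
  ultimately show ?thesis using p by (simp add: vimage_def)
qed

lemma compact_smocked_ball_preimage: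
  fixes \<I> :: "'a::euclidean_space set set"
  assumes smock: "smocking \<I>" and p: "p \<in> smocked_points \<I>"
  shows "compact (smocking_map \<I> -` mcball_of (smocked_space \<I>) p R)"
proof -
  obtain v where v: "p = smocking_map \<I> v" using p range_smocking_map[OF smock] by blast
  interpret X: Metric_space "smocked_points \<I>" "smocked_dist \<I>" by (rule Metric_space_smocked[OF smock])
  have "continuous_on UNIV (\<lambda>w. smocked_dist \<I> p (smocking_map \<I> w))"
  proof (rule lipschitz_on_continuous_on[of 1], rule lipschitz_onI)
    fix w w'
    have "w \<in> UNIV \<Longrightarrow> smocking_map \<I> w \<in> smocked_points \<I>" for w using range_smocking_map[OF smock] by blast
    then have "\<bar>smocked_dist \<I> p (smocking_map \<I> w) - smocked_dist \<I> p (smocking_map \<I> w')\<bar>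
        \<le> smocked_dist \<I> (smocking_map \<I> w) (smocking_map \<I> w')"
      using X.triangle[OF p, of "smocking_map \<I> w" "smocking_map \<I> w'"]
        X.triangle[OF p, of "smocking_map \<I> w'" "smocking_map \<I> w"]
        X.commute[of "smocking_map \<I> w" "smocking_map \<I> w'"] by (simp add: abs_le_iff)
    then show "dist (smocked_dist \<I> p (smocking_map \<I> w)) (smocked_dist \<I> p (smocking_map \<I> w')) \<le> 1 * dist w w'"
      using smocked_dist_le_dist[OF smock, of w w'] by (simp add: dist_real_def)
  qed simp
  then have "closed {w. smocked_dist \<I> p (smocking_map \<I> w) \<le> R}"
    by (intro closed_Collect_le continuous_on_const)
  then show ?thesis
    unfolding mcball_smocked_preimage[OF smock p]
    using bounded_smocked_ball_preimage[OF smock, of v R] v by (simp add: compact_eq_bounded_closed)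
qed

section \<open>Lipschitz constants, charts and countable sets\<close>

lemma lip_const_works:
  assumes "Lipschitz_continuous_map Y Z f"
  shows "0 \<le> lip_const Y Z f"
    and "x \<in> mspace Y \<Longrightarrow> y \<in> mspace Y \<Longrightarrow> mdist Z (f x) (f y) \<le> lip_const Y Z f * mdist Y x y"
proof -
  let ?C = "{L. 0 \<le> L \<and> (\<forall>x\<in>mspace Y. \<forall>y\<in>mspace Y. mdist Z (f x) (f y) \<le> L * mdist Y x y)}"
  obtain B where "B > 0" "\<forall>x\<in>mspace Y. \<forall>y\<in>mspace Y. mdist Z (f x) (f y) \<le> B * mdist Y x y"
    using assms unfolding Lipschitz_continuous_map_pos by blast
  then have ne: "?C \<noteq> {}" by (auto intro!: exI[of _ B])
  then show "0 \<le> lip_const Y Z f" unfolding lip_const_def by (intro cInf_greatest) auto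
  assume xy: "x \<in> mspace Y" "y \<in> mspace Y"
  show "mdist Z (f x) (f y) \<le> lip_const Y Z f * mdist Y x y"
  proof (cases "mdist Y x y = 0")
    case True
    obtain L where "mdist Z (f x) (f y) \<le> L * mdist Y x y" using ne xy by blast
    then show ?thesis unfolding True by simp
  next
    case False
    then have pos: "mdist Y x y > 0" using mdist_nonneg[of Y x y] by linarith
    have "mdist Z (f x) (f y) / mdist Y x y \<le> lip_const Y Z f"
      unfolding lip_const_def using ne xy pos by (intro cInf_greatest) (auto simp: divide_le_eq)
    then show ?thesis using pos by (simp add: divide_le_eq)
  qed
qed

lemma lip_const_le:
  assumes "0 \<le> L" "\<And>x y. x \<in> mspace Y \<Longrightarrow> y \<in> mspace Y \<Longrightarrow> mdist Z (f x) (f y) \<le> L * mdist Y x y"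
  shows "lip_const Y Z f \<le> L"
  unfolding lip_const_def using assms by (intro cInf_lower) (auto intro!: bdd_belowI[of _ 0])

lemma lip_const_nonneg:
  assumes "0 \<le> L" "\<And>x y. x \<in> mspace Y \<Longrightarrow> y \<in> mspace Y \<Longrightarrow> mdist Z (f x) (f y) \<le> L * mdist Y x y"
  shows "0 \<le> lip_const Y Z f"
  unfolding lip_const_def using assms by (intro cInf_greatest) (auto intro!: exI[of _ L])

text \<open>The lower estimate gives both injectivity and the Lipschitz constant of the inverse.\<close>
lemma bi_lipschitz_chartI:
  assumes sub: "\<phi> ` A \<subseteq> mspace Y"
    and up: "\<And>x y. x \<in> A \<Longrightarrow> y \<in> A \<Longrightarrow> mdist Y (\<phi> x) (\<phi> y) \<le> L * dist x y"
    and lo: "\<And>x y. x \<in> A \<Longrightarrow> y \<in> A \<Longrightarrow> dist x y \<le> C * mdist Y (\<phi> x) (\<phi> y)"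
  shows "bi_lipschitz_chart Y \<phi> A"
  unfolding bi_lipschitz_chart_def
proof (intro conjI)
  show "Lipschitz_continuous_map (submetric euclidean_metric A) Y \<phi>"
    unfolding Lipschitz_continuous_map_def
  proof (intro conjI exI[of _ L] ballI)
    show "\<phi> \<in> mspace (submetric euclidean_metric A) \<rightarrow> mspace Y" using sub by auto
  qed (simp add: up)
  show inj: "inj_on \<phi> A"
  proof (rule inj_onI)
    fix x y assume *: "x \<in> A" "y \<in> A" "\<phi> x = \<phi> y"
    then have "mdist Y (\<phi> x) (\<phi> y) = 0" using sub by (auto simp: image_subset_iff)
    then show "x = y" using lo[OF *(1,2)] by simp
  qed
  show "Lipschitz_continuous_map (submetric Y (\<phi> ` A)) (submetric euclidean_metric A) (inv_into A \<phi>)"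
    unfolding Lipschitz_continuous_map_def
  proof (intro conjI exI[of _ C] ballI)
    show "inv_into A \<phi> \<in> mspace (submetric Y (\<phi> ` A)) \<rightarrow> mspace (submetric euclidean_metric A)"
      by (auto intro: inv_into_into)
    fix u v assume "u \<in> mspace (submetric Y (\<phi> ` A))" "v \<in> mspace (submetric Y (\<phi> ` A))"
    then obtain x y where "x \<in> A" "y \<in> A" "u = \<phi> x" "v = \<phi> y" by auto
    then show "mdist (submetric euclidean_metric A) (inv_into A \<phi> u) (inv_into A \<phi> v)
        \<le> C * mdist (submetric Y (\<phi> ` A)) u v"
      using lo inj by (simp add: inv_into_f_f)
  qed
qed

text \<open>Cover by the single points, which have diameter 0.  This needs \<open>n > 0\<close>, as \<open>0^0 = 1\<close>.\<close>
lemma hausdorff_measure_countable: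
  assumes "countable E" "E \<subseteq> mspace Y" "n > 0"
  shows "hausdorff_measure Y n E = 0"
proof -
  define C where "C i = (if E = {} then {} else {from_nat_into E i})" for i
  have sub: "C i \<subseteq> mspace Y" for i
    using assms(2) from_nat_into[of E i] by (auto simp: C_def)
  have diam: "metric_diam Y (C i) = 0" for i
  proof (cases "E = {}")
    case False
    then have "mdist Y (from_nat_into E i) (from_nat_into E i) = 0" using sub[of i] by (simp add: C_def)
    then show ?thesis using False by (simp add: metric_diam_def C_def)
  qed (simp add: metric_diam_def C_def bot_ennreal)
  have cov: "E \<subseteq> (\<Union>i. C i)"
    using subset_range_from_nat_into[OF assms(1)] by (auto simp: C_def)
  have "(INF C\<in>{C :: nat \<Rightarrow> 'a set. (\<forall>i. C i \<subseteq> mspace Y \<and> metric_diam Y (C i) \<le> \<delta>) \<and> E \<subseteq> (\<Union>i. C i)}.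
          (\<Sum>i. ennreal (unit_ball_vol (real n)) * (metric_diam Y (C i) / 2) ^ n)) \<le> 0" for \<delta>
    using sub cov assms(3) by (intro INF_lower2[of C]) (auto simp: diam zero_power)
  then have "hausdorff_measure Y n E \<le> 0" unfolding hausdorff_measure_def by (rule SUP_least)
  then show ?thesis by simp
qed

section \<open>Shells around the smocking set\<close>

lemma disjoint_tubular_shells:
  assumes "k < l"
  shows "smocking_shell S U k \<inter> smocking_shell S U l = {}"
proof -
  have "1 / real l \<le> 1 / real (k + 1)" using assms by (intro divide_left_mono) auto
  then have "tubular_nbhd (1 / real l) S \<subseteq> tubular_nbhd (1 / real (k + 1)) S"
    unfolding tubular_nbhd_def by (auto intro: less_le_trans)
  then show ?thesis unfolding smocking_shell_def by blast
qed

lemma open_tubular_nbhd: "open (tubular_nbhd r (S :: 'a::metric_space set))"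
proof -
  have "tubular_nbhd r S = (\<Union>z\<in>S. ball z r)" by (auto simp: tubular_nbhd_def dist_commute)
  then show ?thesis by auto
qed

text \<open>A point of the piece with index 0 lies in no shell; if it were within distance 1 of \<open>S\<close> it would by
  induction be within distance \<open>1/j\<close> for all \<open>j\<close>, hence on \<open>S\<close>, which has a gap around each point outside it.\<close>
lemma smocking_piece_far:
  assumes gap: "\<And>x. x \<notin> S \<Longrightarrow> \<exists>r>0. \<forall>z\<in>S. r \<le> dist x z"
    and x: "x \<in> smocking_piece S U k" and z: "z \<in> S"
  shows "1 / real (k + 1) \<le> dist x z"
proof (cases "k = 0")
  case False
  then show ?thesis using x z by (force simp: smocking_piece_def smocking_shell_def tubular_nbhd_def)
next
  case True
  then have xU: "x \<in> U" "x \<notin> S" and sh: "\<And>j. j \<ge> 1 \<Longrightarrow> x \<notin> smocking_shell S U j"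
    using x by (auto simp: smocking_piece_def)
  have tub: "x \<in> tubular_nbhd (1 / real j) S \<Longrightarrow> x \<in> tubular_nbhd (1 / real (j + 1)) S" if "j \<ge> 1" for j
    using sh[OF that] xU by (auto simp: smocking_shell_def)
  show ?thesis
  proof (rule ccontr)
    assume "\<not> ?thesis"
    then have 1: "x \<in> tubular_nbhd (1 / real 1) S" using z True by (force simp: tubular_nbhd_def)
    have all: "x \<in> tubular_nbhd (1 / real (Suc j)) S" for j
    proof (induction j)
      case 0
      then show ?case using 1 by simp
    next
      case (Suc j)
      then show ?case using tub[of "Suc j"] by simp
    qed
    obtain r where r: "r > 0" "\<forall>z\<in>S. r \<le> dist x z" using gap[OF xU(2)] by blast
    obtain j where "1 / real (Suc j) < r" using nat_approx_posE[OF r(1)] by blast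
    then show False using all[of j] r(2) by (fastforce simp: tubular_nbhd_def)
  qed
qed

lemma disjoint_family_smocking_piece: "disjoint_family (smocking_piece S U)"
proof -
  have "smocking_piece S U k \<inter> smocking_piece S U l = {}" if "k < l" for k l
  proof (cases "k = 0")
    case True
    then show ?thesis using that by (auto simp: smocking_piece_def)
  next
    case False
    then show ?thesis using disjoint_tubular_shells[OF that, of S U] that by (simp add: smocking_piece_def)
  qed
  then show ?thesis unfolding disjoint_family_on_def by (metis Int_commute nat_neq_iff)
qed

lemma Union_smocking_piece: "(\<Union>k. smocking_piece S U k) = U - S"
proof (intro equalityI subsetI)
  fix x assume "x \<in> (\<Union>k. smocking_piece S U k)"
  then obtain k where k: "x \<in> smocking_piece S U k" by blast
  have "x \<notin> S" if "x \<in> smocking_shell S U k" for k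
  proof
    assume "x \<in> S"
    then have "x \<in> tubular_nbhd (1 / real (k + 1)) S" by (force simp: tubular_nbhd_def)
    then show False using that by (simp add: smocking_shell_def)
  qed
  then show "x \<in> U - S" using k by (cases "k = 0") (auto simp: smocking_piece_def smocking_shell_def)
next
  fix x assume x: "x \<in> U - S"
  show "x \<in> (\<Union>k. smocking_piece S U k)"
  proof (cases "\<exists>j\<ge>1. x \<in> smocking_shell S U j")
    case True
    then obtain j where "j \<ge> 1" "x \<in> smocking_shell S U j" by blast
    then have "x \<in> smocking_piece S U j" by (simp add: smocking_piece_def)
    then show ?thesis by blast
  next
    case False
    then have "x \<in> smocking_piece S U 0" using x by (auto simp: smocking_piece_def)
    then show ?thesis by blast
  qed
qed

lemma borel_smocking_piece:
  assumes "S \<in> sets borel" "U \<in> sets borel"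
  shows "smocking_piece S U k \<in> sets borel"
proof -
  have sh: "smocking_shell S U j \<in> sets borel" for j
    unfolding smocking_shell_def
    by (intro sets.Diff sets.Int assms(2) borel_open[OF open_tubular_nbhd])
  then have "(\<Union>j\<in>{1..}. smocking_shell S U j) \<in> sets borel" by (intro sets.countable_UN') auto
  then have "U - (S \<union> (\<Union>j\<in>{1..}. smocking_shell S U j)) \<in> sets borel"
    using assms by (intro sets.Diff sets.Un)
  then show ?thesis using sh by (simp add: smocking_piece_def)
qed

section \<open>The current carried by a smocked ball\<close>

locale smocked_ball =
  fixes \<I> :: "(real ^ 'n::finite) set set" and p :: "(real ^ 'n) + (real ^ 'n) set" and R :: real
  assumes smock: "smocking \<I>" and p: "p \<in> smocked_points \<I>"
begin

abbreviation (input) "pr \<equiv> smocking_map \<I>"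

definition Y where "Y = submetric (smocked_space \<I>) (mcball_of (smocked_space \<I>) p R)"
definition U where "U = smocking_map \<I> -` mcball_of (smocked_space \<I>) p R"
definition T where "T = pushforward pr (integration_current U)"

lemma compact_U: "compact U"
  unfolding U_def by (rule compact_smocked_ball_preimage[OF smock p])

lemma borel_U: "U \<in> sets borel"
  using compact_U by (simp add: borel_compact)

lemma borel_S: "\<Union>\<I> \<in> sets borel"
  using closed_smocking_set[OF smock] by simp

lemma mspace_Y: "mspace Y = pr ` U"
proof -
  interpret X: Metric_space "smocked_points \<I>" "smocked_dist \<I>" by (rule Metric_space_smocked[OF smock])
  have "mcball_of (smocked_space \<I>) p R \<subseteq> range pr"
    unfolding range_smocking_map[OF smock] mcball_of_def mspace_smocked_space[OF smock] mdist_smocked_space[OF smock]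
    using X.mcball_subset_mspace .
  then show ?thesis
    unfolding Y_def U_def by (auto simp: mspace_smocked_space[OF smock] range_smocking_map[OF smock])
qed

lemma mdist_Y: "mdist Y = smocked_dist \<I>"
  by (simp add: Y_def mdist_smocked_space[OF smock])

lemma mdist_pr_le: "mdist Y (pr v) (pr w) \<le> dist v w"
  unfolding mdist_Y by (rule smocked_dist_le_dist[OF smock])

lemma mdist_pr_ge:
  "r > 0 \<Longrightarrow> (\<And>z. z \<in> \<Union>\<I> \<Longrightarrow> r \<le> dist v z) \<Longrightarrow> min (dist v w) r \<le> mdist Y (pr v) (pr w)"
  unfolding mdist_Y by (rule smocked_dist_ge_min[OF smock])

lemma Lipschitz_pr: "Lipschitz_continuous_map (submetric euclidean_metric U) Y pr"
  unfolding Lipschitz_continuous_map_def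
proof (intro conjI exI[of _ 1] ballI)
  show "pr \<in> mspace (submetric euclidean_metric U) \<rightarrow> mspace Y" by (auto simp: mspace_Y)
qed (simp add: mdist_pr_le)

text \<open>The ball is the continuous image of a compact set.\<close>
lemma mcomplete_Y: "mcomplete_of Y"
proof -
  have "continuous_map (mtopology_of (submetric euclidean_metric U)) (mtopology_of Y) pr"
    by (rule Lipschitz_continuous_imp_continuous_map[OF Lipschitz_pr])
  then have "continuous_map (top_of_set U) (mtopology_of Y) pr" by (simp add: mtopology_of_submetric)
  moreover have "compactin (top_of_set U) U" using compact_U by (simp add: compactin_subtopology)
  ultimately have "compactin (mtopology_of Y) (pr ` U)" by (rule image_compactin[rotated])
  then have "compact_space (mtopology_of Y)" by (simp add: compact_space_def mspace_Y)
  then show ?thesis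
    unfolding mcomplete_of_def mtopology_of_def
    by (rule Metric_space.compact_space_imp_mcomplete[OF Metric_space_mspace_mdist])
qed

lemma inj_on_pr: "inj_on pr (- \<Union>\<I>)"
  by (auto simp: inj_on_def smocking_map_eq_iff[OF smock])

lemma lipschitz_on_comp_pr:
  assumes "Lipschitz_continuous_map Y euclidean_metric (u :: _ \<Rightarrow> real)"
  shows "(lip_const Y euclidean_metric u)-lipschitz_on U (u \<circ> pr)"
proof (rule lipschitz_onI)
  fix v w assume vw: "v \<in> U" "w \<in> U"
  have "dist (u (pr v)) (u (pr w)) \<le> lip_const Y euclidean_metric u * mdist Y (pr v) (pr w)"
    using lip_const_works(2)[OF assms, of "pr v" "pr w"] vw by (simp add: mspace_Y)
  also have "\<dots> \<le> lip_const Y euclidean_metric u * dist v w"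
    using lip_const_works(1)[OF assms] mdist_pr_le by (rule mult_left_mono[rotated])
  finally show "dist ((u \<circ> pr) v) ((u \<circ> pr) w) \<le> lip_const Y euclidean_metric u * dist v w" by simp
qed (rule lip_const_works(1)[OF assms])

lemma measurable_comp_pr:
  assumes "Lipschitz_continuous_map Y euclidean_metric (u :: _ \<Rightarrow> real)"
  shows "(\<lambda>x. indicator U x * u (pr x)) \<in> borel_measurable borel"
  using borel_measurable_continuous_on_indicator[OF borel_U, of "u \<circ> pr"]
    lipschitz_on_continuous_on[OF lipschitz_on_comp_pr[OF assms]] by simp

text \<open>On a stitch the smocking map is constant, so the derivative within the stitch is zero; by uniqueness
  the Jacobian vanishes almost everywhere on each of the countably many stitches.\<close>
lemma jacobian_off_stitches:
  assumes "\<And>i. Lipschitz_continuous_map Y euclidean_metric (h i)"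
  shows "\<exists>J. J \<in> borel_measurable borel \<and>
    (\<forall>x. \<bar>J x\<bar> \<le> (\<Prod>i\<in>UNIV. lip_const Y euclidean_metric (h i))) \<and>
    (\<forall>A\<subseteq>U. has_jacobian_ae A (\<lambda>i. h i \<circ> pr) J) \<and>
    (AE x in lebesgue. x \<in> U \<inter> \<Union>\<I> \<longrightarrow> J x = 0)"
proof -
  obtain J where J: "J \<in> borel_measurable borel"
    "\<And>x. \<bar>J x\<bar> \<le> (\<Prod>i\<in>UNIV. lip_const Y euclidean_metric (h i))"
    "\<And>A. A \<subseteq> U \<Longrightarrow> has_jacobian_ae A (\<lambda>i. h i \<circ> pr) J"
    using lipschitz_family_jacobian[of "\<lambda>i. lip_const Y euclidean_metric (h i)" U "\<lambda>i. h i \<circ> pr"]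
      lipschitz_on_comp_pr[OF assms] by blast
  have "AE x in lebesgue. x \<in> U \<inter> I \<longrightarrow> J x = 0" if I: "I \<in> \<I>" for I
    by (rule has_jacobian_ae_constant[OF J(3), where c = "\<lambda>i. h i (Inr I)"])
       (auto simp: smocking_map_stitch[OF smock I])
  moreover have "countable \<I>" using smock by (simp only: smocking_def)
  ultimately have "AE x in lebesgue. \<forall>I\<in>\<I>. x \<in> U \<inter> I \<longrightarrow> J x = 0" by (intro AE_ball_countable') auto
  then have "AE x in lebesgue. x \<in> U \<inter> \<Union>\<I> \<longrightarrow> J x = 0" by eventually_elim blast
  with J show ?thesis by blast
qed

abbreviation (input) "A \<equiv> smocking_piece (\<Union>\<I>) U"

lemma gap: "x \<notin> \<Union>\<I> \<Longrightarrow> \<exists>r>0. \<forall>z\<in>\<Union>\<I>. r \<le> dist x z"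
  using smocking_gap[OF smock] by metis

lemma A_subset: "A k \<subseteq> U - \<Union>\<I>"
  using Union_smocking_piece[of "\<Union>\<I>" U] by blast

lemma borel_A: "A k \<in> sets borel"
  by (rule borel_smocking_piece[OF borel_S borel_U])

lemma integrable_current_density:
  assumes fh: "current_tuple Y f h"
    and J: "J \<in> borel_measurable borel" "\<And>x. \<bar>J x\<bar> \<le> C"
  shows "integrable lebesgue (\<lambda>x. indicator U x * ((f \<circ> pr) x * J x))"
    "B \<in> sets lebesgue \<Longrightarrow> B \<subseteq> U \<Longrightarrow> set_integrable lebesgue B (\<lambda>x. (f \<circ> pr) x * J x)"
proof -
  have f: "Lipschitz_continuous_map Y euclidean_metric f" "bounded (f ` mspace Y)"
    using fh by (auto simp: current_tuple_def)
  obtain K where K: "\<And>y. y \<in> mspace Y \<Longrightarrow> \<bar>f y\<bar> \<le> K" using f(2) by (auto simp: bounded_iff)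
  have "(\<lambda>x. indicator U x * f (pr x)) \<in> borel_measurable lborel" "J \<in> borel_measurable lborel"
    using measurable_comp_pr[OF f(1)] J(1) by simp_all
  then have "(\<lambda>x. indicator U x * f (pr x) * J x) \<in> borel_measurable lebesgue"
    by (intro borel_measurable_times[OF measurable_completion measurable_completion])
  then have m: "(\<lambda>x. indicator U x * ((f \<circ> pr) x * J x)) \<in> borel_measurable lebesgue" by (simp add: mult.assoc)
  show int: "integrable lebesgue (\<lambda>x. indicator U x * ((f \<circ> pr) x * J x))"
  proof (rule Bochner_Integration.integrable_bound[OF _ m])
    have "U \<in> lmeasurable" using compact_U by (rule lmeasurable_compact)
    then show "integrable lebesgue (\<lambda>x. (K * C) * indicator U x :: real)"
      by (intro integrable_mult_right integrable_real_indicator) (auto simp: fmeasurable_def)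
    have "norm (indicator U x * ((f \<circ> pr) x * J x)) \<le> norm (K * C * indicator U x)" for x
    proof (cases "x \<in> U")
      case True
      then have "\<bar>f (pr x)\<bar> \<le> K" using K[of "pr x"] by (simp add: mspace_Y)
      then have "\<bar>f (pr x)\<bar> * \<bar>J x\<bar> \<le> \<bar>K\<bar> * \<bar>C\<bar>"
        using J(2)[of x] by (intro mult_mono) auto
      then show ?thesis using True by (simp add: abs_mult)
    qed simp
    then show "AE x in lebesgue. norm (indicator U x * ((f \<circ> pr) x * J x)) \<le> norm (K * C * indicator U x)" by simp
  qed
  assume B: "B \<in> sets lebesgue" "B \<subseteq> U"
  have "set_integrable lebesgue U (\<lambda>x. (f \<circ> pr) x * J x)" using int by (simp add: set_integrable_def)
  then show "set_integrable lebesgue B (\<lambda>x. (f \<circ> pr) x * J x)"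
    using B by (rule set_integrable_subset)
qed

lemma integration_current_pr:
  assumes fh: "current_tuple Y f h"
    and J: "J \<in> borel_measurable borel" "\<And>x. \<bar>J x\<bar> \<le> C"
    and jac: "\<And>A. A \<subseteq> U \<Longrightarrow> has_jacobian_ae A (\<lambda>i. h i \<circ> pr) J"
    and B: "B \<in> sets lebesgue" "B \<subseteq> U"
  shows "integration_current B (f \<circ> pr) (\<lambda>i. h i \<circ> pr) = (LINT x:B|lebesgue. (f \<circ> pr) x * J x)"
  using integrable_current_density(2)[OF fh J B] unfolding set_integrable_def
  by (intro integration_current_eq jac B) (auto dest: borel_measurable_integrable)

lemma current_eq_jacobian_integral:
  assumes fh: "current_tuple Y f h"
    and J: "J \<in> borel_measurable borel" "\<And>x. \<bar>J x\<bar> \<le> C"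
    and jac: "\<And>A. A \<subseteq> U \<Longrightarrow> has_jacobian_ae A (\<lambda>i. h i \<circ> pr) J"
    and J0: "AE x in lebesgue. x \<in> U \<inter> \<Union>\<I> \<longrightarrow> J x = 0"
  shows "T f h = (LINT x:U - \<Union>\<I>|lebesgue. (f \<circ> pr) x * J x)"
proof -
  have bU: "U \<in> sets lebesgue" "U - \<Union>\<I> \<in> sets lebesgue"
    using borel_U borel_S by auto
  have i: "set_integrable lebesgue U (\<lambda>x. (f \<circ> pr) x * J x)"
    "set_integrable lebesgue (U - \<Union>\<I>) (\<lambda>x. (f \<circ> pr) x * J x)"
    by (rule integrable_current_density(2)[OF fh J]; use bU in auto)+
  have "T f h = (LINT x:U|lebesgue. (f \<circ> pr) x * J x)"
    unfolding T_def pushforward_def using bU by (intro integration_current_pr[OF fh J jac]) auto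
  also have "\<dots> = (LINT x:U - \<Union>\<I>|lebesgue. (f \<circ> pr) x * J x)"
    unfolding set_lebesgue_integral_def
  proof (rule integral_cong_AE)
    show "AE x in lebesgue. indicator U x *\<^sub>R ((f \<circ> pr) x * J x) = indicator (U - \<Union>\<I>) x *\<^sub>R ((f \<circ> pr) x * J x)"
      using J0 by eventually_elim (auto simp: indicator_def)
  qed (use i in \<open>auto simp: set_integrable_def dest: borel_measurable_integrable\<close>)
  finally show ?thesis .
qed

lemma pieces_sums:
  assumes fh: "current_tuple Y f h"
  shows "(\<lambda>k. integration_current (A k) (f \<circ> pr) (\<lambda>i. h i \<circ> pr)) sums T f h"
proof -
  have h: "\<And>i. Lipschitz_continuous_map Y euclidean_metric (h i)" using fh by (simp add: current_tuple_def)
  obtain J where J: "J \<in> borel_measurable borel"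
    "\<And>x. \<bar>J x\<bar> \<le> (\<Prod>i\<in>UNIV. lip_const Y euclidean_metric (h i))"
    and jac: "\<And>A. A \<subseteq> U \<Longrightarrow> has_jacobian_ae A (\<lambda>i. h i \<circ> pr) J"
    and J0: "AE x in lebesgue. x \<in> U \<inter> \<Union>\<I> \<longrightarrow> J x = 0"
    using jacobian_off_stitches[of h, OF h] by blast
  have A: "A k \<in> sets lebesgue" "A k \<subseteq> U" for k using borel_A[of k] A_subset[of k] by auto
  have bU: "U - \<Union>\<I> \<in> sets lebesgue" using borel_U borel_S by auto
  let ?F = "\<lambda>x. (f \<circ> pr) x * J x"
  have iU: "set_integrable lebesgue (U - \<Union>\<I>) ?F" by (rule integrable_current_density(2)[OF fh J bU]) blast
  have int: "integrable lebesgue (\<lambda>x. indicator (A k) x *\<^sub>R ?F x)" for k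
    using integrable_current_density(2)[OF fh J A] by (simp add: set_integrable_def)
  have single: "(\<lambda>k. indicator (A k) x *\<^sub>R c) sums (indicator (U - \<Union>\<I>) x *\<^sub>R c)" for x and c :: real
    using sums_scaleR_left[OF indicator_sums[of A x]] disjoint_family_smocking_piece[of "\<Union>\<I>" U] 
    unfolding Union_smocking_piece disjoint_family_on_def by blast
  have "(\<lambda>k. \<integral>x. indicator (A k) x *\<^sub>R ?F x \<partial>lebesgue) sums (\<integral>x. (\<Sum>k. indicator (A k) x *\<^sub>R ?F x) \<partial>lebesgue)"
  proof (rule sums_integral[OF int])
    have n: "norm (indicator (A k) x *\<^sub>R ?F x) = indicator (A k) x *\<^sub>R \<bar>?F x\<bar>" for k x by (simp add: abs_mult)
    show "AE x in lebesgue. summable (\<lambda>k. norm (indicator (A k) x *\<^sub>R ?F x))"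
      unfolding n using single by (intro AE_I2) (rule sums_summable)
    have i': "set_integrable lebesgue (A k) (\<lambda>x. \<bar>?F x\<bar>)" for k
      using integrable_current_density(2)[OF fh J A] by (rule set_integrable_abs)
    show "summable (\<lambda>k. \<integral>x. norm (indicator (A k) x *\<^sub>R ?F x) \<partial>lebesgue)"
    proof (rule summableI_nonneg_bounded)
      fix n
      have "(\<Sum>k<n. \<integral>x. norm (indicator (A k) x *\<^sub>R ?F x) \<partial>lebesgue) = (\<integral>x. (\<Sum>k<n. norm (indicator (A k) x *\<^sub>R ?F x)) \<partial>lebesgue)"
        using int by (subst Bochner_Integration.integral_sum) auto
      also have "\<dots> \<le> (\<integral>x. indicator (U - \<Union>\<I>) x *\<^sub>R \<bar>?F x\<bar> \<partial>lebesgue)"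
      proof (rule integral_mono)
        show "integrable lebesgue (\<lambda>x. \<Sum>k<n. norm (indicator (A k) x *\<^sub>R ?F x))" using int by auto
        show "integrable lebesgue (\<lambda>x. indicator (U - \<Union>\<I>) x *\<^sub>R \<bar>?F x\<bar>)"
          using set_integrable_abs[OF iU] by (simp add: set_integrable_def)
        fix x
        show "(\<Sum>k<n. norm (indicator (A k) x *\<^sub>R ?F x)) \<le> indicator (U - \<Union>\<I>) x *\<^sub>R \<bar>?F x\<bar>"
          unfolding n sums_unique[OF single] by (intro sum_le_suminf sums_summable[OF single]) auto
      qed
      finally show "(\<Sum>k<n. \<integral>x. norm (indicator (A k) x *\<^sub>R ?F x) \<partial>lebesgue) \<le> (\<integral>x. indicator (U - \<Union>\<I>) x *\<^sub>R \<bar>?F x\<bar> \<partial>lebesgue)" .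
    qed simp
  qed
  moreover have "(\<Sum>k. indicator (A k) x *\<^sub>R ?F x) = indicator (U - \<Union>\<I>) x *\<^sub>R ?F x" for x
    using sums_unique[OF single] by simp
  ultimately have "(\<lambda>k. LINT x:A k|lebesgue. ?F x) sums (LINT x:U - \<Union>\<I>|lebesgue. ?F x)"
    by (simp only: set_lebesgue_integral_def)
  moreover have "T f h = (LINT x:U - \<Union>\<I>|lebesgue. ?F x)" by (rule current_eq_jacobian_integral[OF fh J jac J0])
  moreover have "integration_current (A k) (f \<circ> pr) (\<lambda>i. h i \<circ> pr) = (LINT x:A k|lebesgue. ?F x)" for k
    by (rule integration_current_pr[OF fh J jac A])
  ultimately show ?thesis by (simp only:)
qed

section \<open>Rectifiable structures of both orientations\<close>

text \<open>One proof for both orientations: the charts are \<open>\<pi> \<circ> \<rho>\<close> with \<open>\<rho>\<close> the identity or a reflection,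
  whose determinant is the sign of the resulting current.\<close>
lemma weight_one_structure_involution:
  assumes lin: "linear \<rho>" and inv: "\<And>x. \<rho> (\<rho> x) = x" and iso: "\<And>x y. dist (\<rho> x) (\<rho> y) = dist x y"
    and meas: "\<rho> \<in> lebesgue \<rightarrow>\<^sub>M lebesgue" and pres: "distr lebesgue lebesgue \<rho> = lebesgue"
  shows "weight_one_structure Y (\<lambda>f h. det (matrix \<rho>) * T f h) (\<lambda>_. pr \<circ> \<rho>) (\<lambda>k. \<rho> -` A k)"
  unfolding weight_one_structure_def int_rect_structure_def
proof (intro conjI allI impI)
  show "mcomplete_of Y" by (rule mcomplete_Y)
  have cont: "continuous_on UNIV \<rho>" using lin by (simp add: linear_continuous_on linear_linear)
  then have bm: "\<rho> \<in> borel_measurable borel" by (rule borel_measurable_continuous_onI)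
  show bB: "\<rho> -` A k \<in> sets borel" for k using measurable_sets[OF bm borel_A[of k]] by simp
  have img: "(pr \<circ> \<rho>) ` \<rho> -` B = pr ` B" for B using inv by (force simp: image_iff)
  have bU: "bounded (\<rho> -` U)"
  proof -
    obtain e where e: "\<forall>y\<in>U. dist (\<rho> 0) y \<le> e"
      using compact_imp_bounded[OF compact_U] unfolding bounded_any_center[of _ "\<rho> 0"] by blast
    then have "\<forall>y\<in>\<rho> -` U. dist 0 y \<le> e" using iso by (metis vimageD)
    then show ?thesis unfolding bounded_def by blast
  qed
  show "bounded (\<rho> -` A k)" for k using A_subset[of k] by (intro bounded_subset[OF bU]) blast
  \<comment> \<open>Distances above \<open>r\<close> are controlled only through the diameter of \<open>U\<close>.\<close>
  obtain D where D: "\<And>x y. x \<in> U \<Longrightarrow> y \<in> U \<Longrightarrow> dist x y \<le> D"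
    using compact_imp_bounded[OF compact_U] bounded_two_points by metis
  show "bi_lipschitz_chart Y (pr \<circ> \<rho>) (\<rho> -` A k)" for k
  proof (rule bi_lipschitz_chartI)
    show "(pr \<circ> \<rho>) ` (\<rho> -` A k) \<subseteq> mspace Y" unfolding img mspace_Y using A_subset[of k] by blast
    show "mdist Y ((pr \<circ> \<rho>) x) ((pr \<circ> \<rho>) y) \<le> 1 * dist x y" for x y
      using mdist_pr_le[of "\<rho> x" "\<rho> y"] by (simp add: iso)
    fix x y assume xy: "x \<in> \<rho> -` A k" "y \<in> \<rho> -` A k"
    define r where "r = 1 / real (k + 1)"
    have r: "r > 0" by (simp add: r_def)
    have "min (dist (\<rho> x) (\<rho> y)) r \<le> mdist Y (pr (\<rho> x)) (pr (\<rho> y))"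
      using smocking_piece_far[OF gap, of "\<rho> x" U k] xy r by (intro mdist_pr_ge) (auto simp: r_def)
    moreover have "dist x y \<le> D" using D[of "\<rho> x" "\<rho> y"] xy A_subset[of k] by (auto simp: iso)
    moreover have "dist x y \<le> max 1 (D / r) * min (dist x y) r"
    proof (cases "dist x y \<le> r")
      case True
      have "1 * dist x y \<le> max 1 (D / r) * dist x y" by (intro mult_right_mono) auto
      then show ?thesis using True by simp
    next
      case False
      have "D = D / r * r" using r by simp
      also have "\<dots> \<le> max 1 (D / r) * r" using r by (intro mult_right_mono) auto
      finally have "dist x y \<le> max 1 (D / r) * r" using \<open>dist x y \<le> D\<close> by linarith
      moreover have "min (dist x y) r = r" using False by simp
      ultimately show ?thesis by simp
    qed
    moreover have "max 1 (D / r) * min (dist x y) r \<le> max 1 (D / r) * mdist Y (pr (\<rho> x)) (pr (\<rho> y))"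
      using calculation(1) by (intro mult_left_mono) (auto simp: iso)
    ultimately show "dist x y \<le> max 1 (D / r) * mdist Y ((pr \<circ> \<rho>) x) ((pr \<circ> \<rho>) y)" by simp
  qed
  show "disjoint_family (\<lambda>i. (pr \<circ> \<rho>) ` \<rho> -` A i)"
    unfolding img disjoint_family_on_def
  proof (intro ballI impI)
    fix k l :: nat assume "k \<noteq> l"
    then have "A k \<inter> A l = {}" using disjoint_family_smocking_piece[of "\<Union>\<I>" U] by (simp add: disjoint_family_on_def)
    then show "pr ` A k \<inter> pr ` A l = {}"
      using inj_on_image_Int[OF inj_on_pr, of "A k" "A l"] A_subset[of k] A_subset[of l] by auto
  qed
  have "(\<Sum>i. ennreal (\<bar>real_of_int 1\<bar> * lip_const (submetric euclidean_metric (\<rho> -` A i)) Y (pr \<circ> \<rho>) ^ CARD('n)) *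
            emeasure lborel (\<rho> -` A i)) \<le> (\<Sum>i. emeasure lborel (\<rho> -` A i))"
  proof (rule suminf_le)
    fix i
    have l: "mdist Y ((pr \<circ> \<rho>) x) ((pr \<circ> \<rho>) y) \<le> 1 * mdist (submetric euclidean_metric (\<rho> -` A i)) x y" for x y
      using mdist_pr_le[of "\<rho> x" "\<rho> y"] by (simp add: iso)
    have "lip_const (submetric euclidean_metric (\<rho> -` A i)) Y (pr \<circ> \<rho>) ^ CARD('n) \<le> 1"
      using lip_const_le[where f = "pr \<circ> \<rho>", OF _ l] lip_const_nonneg[where f = "pr \<circ> \<rho>", OF _ l] by (intro power_le_one) auto
    then have "ennreal (\<bar>real_of_int 1\<bar> * lip_const (submetric euclidean_metric (\<rho> -` A i)) Y (pr \<circ> \<rho>) ^ CARD('n)) \<le> 1"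
      by simp
    from mult_right_mono[OF this, of "emeasure lborel (\<rho> -` A i)"]
    show "ennreal (\<bar>real_of_int 1\<bar> * lip_const (submetric euclidean_metric (\<rho> -` A i)) Y (pr \<circ> \<rho>) ^ CARD('n)) *
            emeasure lborel (\<rho> -` A i) \<le> emeasure lborel (\<rho> -` A i)"
      by (simp only: mult_1 zero_le)
  qed auto
  also have "\<dots> = emeasure lborel (\<Union>i. \<rho> -` A i)"
    using bB disjoint_family_smocking_piece[of "\<Union>\<I>" U]
    by (intro suminf_emeasure) (auto simp: disjoint_family_on_def)
  also have "\<dots> < \<infinity>"
    using A_subset by (intro emeasure_bounded_finite bounded_subset[OF bU]) blast
  finally show "(\<Sum>i. ennreal (\<bar>real_of_int 1\<bar> * lip_const (submetric euclidean_metric (\<rho> -` A i)) Y (pr \<circ> \<rho>) ^ CARD('n)) *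
            emeasure lborel (\<rho> -` A i)) < \<infinity>" .
  show "hausdorff_measure Y CARD('n) (mspace Y - (\<Union>i. (pr \<circ> \<rho>) ` \<rho> -` A i)) = 0"
  proof (rule hausdorff_measure_countable)
    have "(\<Union>i. (pr \<circ> \<rho>) ` \<rho> -` A i) = pr ` (U - \<Union>\<I>)"
      unfolding img image_UN[symmetric] Union_smocking_piece ..
    then have "mspace Y - (\<Union>i. (pr \<circ> \<rho>) ` \<rho> -` A i) \<subseteq> pr ` (U - (U - \<Union>\<I>))"
      unfolding mspace_Y using image_diff_subset[of pr U "U - \<Union>\<I>"] by simp
    also have "\<dots> \<subseteq> pr ` (\<Union>\<I>)" by (rule image_mono) blast
    also have "\<dots> \<subseteq> Inr ` \<I>"
    proof (rule image_subsetI)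
      fix x assume "x \<in> \<Union>\<I>"
      then obtain I where I: "I \<in> \<I>" "x \<in> I" by blast
      show "pr x \<in> Inr ` \<I>" unfolding smocking_map_stitch[OF smock I] using I(1) by (rule imageI)
    qed
    finally show "countable (mspace Y - (\<Union>i. (pr \<circ> \<rho>) ` \<rho> -` A i))"
      by (rule countable_subset) (use smock in \<open>simp add: smocking_def\<close>)
  qed auto
  fix f and h :: "'n \<Rightarrow> _" assume fh: "current_tuple Y f h"
  have h: "\<And>i. Lipschitz_continuous_map Y euclidean_metric (h i)" using fh by (simp add: current_tuple_def)
  obtain J where J: "J \<in> borel_measurable borel"
    "\<And>x. \<bar>J x\<bar> \<le> (\<Prod>i\<in>UNIV. lip_const Y euclidean_metric (h i))"
    and jac: "\<And>A. A \<subseteq> U \<Longrightarrow> has_jacobian_ae A (\<lambda>i. h i \<circ> pr) J"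
    and "AE x in lebesgue. x \<in> U \<inter> \<Union>\<I> \<longrightarrow> J x = 0"
    using jacobian_off_stitches[of h, OF h] by blast
  have "integration_current (\<rho> -` A k) (f \<circ> (pr \<circ> \<rho>)) (\<lambda>i. h i \<circ> (pr \<circ> \<rho>)) =
      det (matrix \<rho>) * integration_current (A k) (f \<circ> pr) (\<lambda>i. h i \<circ> pr)" for k
  proof -
    have Ak: "A k \<in> sets lebesgue" "A k \<subseteq> U" using borel_A[of k] A_subset[of k] by auto
    let ?G = "\<lambda>x. indicator (A k) x * ((f \<circ> pr) x * J x)"
    have ic: "integration_current (A k) (f \<circ> pr) (\<lambda>i. h i \<circ> pr) = (LINT x:A k|lebesgue. (f \<circ> pr) x * J x)"
      by (rule integration_current_pr[OF fh J jac Ak])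
    have G: "integrable lebesgue ?G"
      using integrable_current_density(2)[OF fh J Ak] by (simp add: set_integrable_def)
    have eq: "indicator (\<rho> -` A k) x * ((f \<circ> (pr \<circ> \<rho>)) x * (det (matrix \<rho>) * J (\<rho> x))) = det (matrix \<rho>) * ?G (\<rho> x)" for x
      by (simp add: indicator_def)
    have mG: "(\<lambda>x. ?G (\<rho> x)) \<in> borel_measurable lebesgue"
      using measurable_compose[OF meas borel_measurable_integrable[OF G]] .
    have jac': "has_jacobian_ae (\<rho> -` A k) (\<lambda>i. h i \<circ> (pr \<circ> \<rho>)) (\<lambda>x. det (matrix \<rho>) * J (\<rho> x))"
      using has_jacobian_ae_involution[OF jac[OF Ak(2)] lin inv] by (simp add: comp_assoc)
    have "integration_current (\<rho> -` A k) (f \<circ> (pr \<circ> \<rho>)) (\<lambda>i. h i \<circ> (pr \<circ> \<rho>)) =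
        (LINT x:\<rho> -` A k|lebesgue. (f \<circ> (pr \<circ> \<rho>)) x * (det (matrix \<rho>) * J (\<rho> x)))"
      by (rule integration_current_eq[OF jac']) (unfold eq, intro borel_measurable_times borel_measurable_const mG)
    also have "\<dots> = det (matrix \<rho>) * (\<integral>x. ?G (\<rho> x) \<partial>lebesgue)"
      unfolding set_lebesgue_integral_def real_scaleR_def eq by simp
    also have "(\<integral>x. ?G (\<rho> x) \<partial>lebesgue) = (\<integral>x. ?G x \<partial>distr lebesgue lebesgue \<rho>)"
      by (rule integral_distr[OF meas borel_measurable_integrable[OF G], symmetric])
    also have "\<dots> = integration_current (A k) (f \<circ> pr) (\<lambda>i. h i \<circ> pr)"
      unfolding pres ic by (simp add: set_lebesgue_integral_def)
    finally show ?thesis .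
  qed
  then show "(\<lambda>i. real_of_int 1 * pushforward (pr \<circ> \<rho>) (integration_current (\<rho> -` A i)) f h) sums (det (matrix \<rho>) * T f h)"
    unfolding pushforward_def using sums_mult[OF pieces_sums[OF fh], of "det (matrix \<rho>)"] by simp
qed

end

text \<open>Any fixed coordinate will do; \<^term>\<open>undefined\<close> names one without further choice.\<close>
definition coordinate_reflection :: "real^'n \<Rightarrow> real^'n::finite" where
  "coordinate_reflection x = (\<chi> i. if i = undefined then - x $ i else x $ i)"

lemma coordinate_reflection:
  shows linear_coordinate_reflection: "linear (coordinate_reflection :: real^'n::finite \<Rightarrow> _)"
    and coordinate_reflection_involution: "coordinate_reflection (coordinate_reflection x) = x"
    and dist_coordinate_reflection: "dist (coordinate_reflection x) (coordinate_reflection y) = dist x y"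
    and det_coordinate_reflection: "det (matrix (coordinate_reflection :: real^'n \<Rightarrow> _)) = - 1"
    and measurable_coordinate_reflection: "(coordinate_reflection :: real^'n \<Rightarrow> _) \<in> lebesgue \<rightarrow>\<^sub>M lebesgue"
    and distr_coordinate_reflection: "distr lebesgue lebesgue (coordinate_reflection :: real^'n \<Rightarrow> _) = lebesgue"
proof -
  let ?\<rho> = "coordinate_reflection :: real^'n \<Rightarrow> real^'n"
  show "linear ?\<rho>"
    by (rule linearI) (auto simp: coordinate_reflection_def vec_eq_iff)
  show "coordinate_reflection (coordinate_reflection x) = x"
    by (simp add: coordinate_reflection_def vec_eq_iff)
  show "dist (coordinate_reflection x) (coordinate_reflection y) = dist x y"
    unfolding dist_vec_def by (rule arg_cong[where f = "\<lambda>f. L2_set f UNIV"])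
      (auto simp: coordinate_reflection_def dist_real_def fun_eq_iff)
  have entry: "matrix ?\<rho> $ i $ j = (if i = j then if i = undefined then - 1 else 1 else 0)" for i j
    by (simp add: matrix_def coordinate_reflection_def axis_def)
  have "det (matrix ?\<rho>) = (\<Prod>i\<in>(UNIV :: 'n set). if i = undefined then - 1 else 1 :: real)"
    by (subst det_diagonal) (simp_all add: entry)
  then show "det (matrix ?\<rho>) = - 1" by (simp add: prod.delta)
  define c where "c j = (if j = axis undefined 1 then - 1 else 1 :: real)" for j :: "real^'n"
  have T: "(\<lambda>x. 0 + (\<Sum>j\<in>Basis. (c j * (x \<bullet> j)) *\<^sub>R j)) = ?\<rho>"
  proof (rule ext)
    fix x :: "real^'n"
    show "0 + (\<Sum>j\<in>Basis. (c j * (x \<bullet> j)) *\<^sub>R j) = ?\<rho> x"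
    proof (rule euclidean_eqI)
      fix b :: "real^'n" assume b: "b \<in> Basis"
      then obtain i where i: "b = axis i 1" by (auto simp: Basis_vec_def)
      have "(0 + (\<Sum>j\<in>Basis. (c j * (x \<bullet> j)) *\<^sub>R j)) \<bullet> b = c b * (x \<bullet> b)"
        using b by (simp add: inner_sum_left_Basis)
      also have "\<dots> = ?\<rho> x \<bullet> b"
        by (auto simp: i c_def inner_axis coordinate_reflection_def axis_eq_axis)
      finally show "(0 + (\<Sum>j\<in>Basis. (c j * (x \<bullet> j)) *\<^sub>R j)) \<bullet> b = ?\<rho> x \<bullet> b" .
    qed
  qed
  have c: "c j \<noteq> 0" "\<bar>c j\<bar> = 1" for j by (auto simp: c_def)
  show "?\<rho> \<in> lebesgue \<rightarrow>\<^sub>M lebesgue"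
    using lebesgue_affine_measurable[of c 0] c unfolding T by simp
  show "distr lebesgue lebesgue ?\<rho> = lebesgue"
    using lebesgue_affine_euclidean[of c 0] c unfolding T by (simp add: density_1)
qed

section \<open>Mass\<close>

text \<open>Comparison of measures is local: cut a set along the disjointed cover.\<close>
lemma emeasure_le_via_cover:
  assumes sets: "sets \<mu> = sets \<nu>" and D: "\<And>i::nat. D i \<in> sets \<nu>"
    and null: "emeasure \<mu> (space \<mu> - (\<Union>i. D i)) = 0"
    and le: "\<And>i C. C \<in> sets \<nu> \<Longrightarrow> C \<subseteq> D i \<Longrightarrow> emeasure \<mu> C \<le> emeasure \<nu> C"
    and B: "B \<in> sets \<nu>"
  shows "emeasure \<mu> B \<le> emeasure \<nu> B"
proof -
  have sp: "space \<mu> = space \<nu>" using sets by (rule sets_eq_imp_space_eq)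
  have "range (disjointed D) \<subseteq> sets \<nu>" by (rule sets.range_disjointed_sets) (use D in auto)
  then have D': "B \<inter> disjointed D i \<in> sets \<nu>" for i using B by (intro sets.Int) auto
  have disj: "disjoint_family (\<lambda>i. B \<inter> disjointed D i)"
    using disjoint_family_disjointed[of D] by (auto simp: disjoint_family_on_def)
  have un: "(\<Union>i. B \<inter> disjointed D i) = B \<inter> (\<Union>i. D i)"
    using UN_disjointed_eq[of D] by blast
  have BD: "B \<inter> (\<Union>i. D i) \<in> sets \<nu>" using D B by auto
  have "B - (\<Union>i. D i) \<subseteq> space \<mu> - (\<Union>i. D i)" using sets.sets_into_space[OF B] sp by auto
  then have "emeasure \<mu> (B - (\<Union>i. D i)) \<le> 0"
    using D unfolding null[symmetric] sp[symmetric] by (intro emeasure_mono) (auto simp: sets sp)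
  then have z: "emeasure \<mu> (B - (\<Union>i. D i)) = 0" by simp
  have "B = (B \<inter> (\<Union>i. D i)) \<union> (B - (\<Union>i. D i))" by blast
  then have "emeasure \<mu> B \<le> emeasure \<mu> (B \<inter> (\<Union>i. D i)) + emeasure \<mu> (B - (\<Union>i. D i))"
    using emeasure_subadditive[of "B \<inter> (\<Union>i. D i)" \<mu> "B - (\<Union>i. D i)"] BD B D by (auto simp: sets)
  also have "\<dots> = emeasure \<mu> (B \<inter> (\<Union>i. D i))" by (simp add: z)
  also have "\<dots> = (\<Sum>i. emeasure \<mu> (B \<inter> disjointed D i))"
    unfolding un[symmetric] using D' disj by (intro suminf_emeasure[symmetric]) (auto simp: sets)
  also have "\<dots> \<le> (\<Sum>i. emeasure \<nu> (B \<inter> disjointed D i))"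
    using D' disjointed_subset[of D] by (intro suminf_le le) auto
  also have "\<dots> = emeasure \<nu> (B \<inter> (\<Union>i. D i))"
    unfolding un[symmetric] using D' disj by (intro suminf_emeasure) auto
  also have "\<dots> \<le> emeasure \<nu> B" using B by (intro emeasure_mono) auto
  finally show ?thesis .
qed

context smocked_ball
begin

text \<open>The Borel sets of the ball, which carries a metric but is not a type of class topological space.\<close>
definition borel_Y where "borel_Y = sigma (mspace Y) {V. openin (mtopology_of Y) V}"

lemma opens_Pow: "{V. openin (mtopology_of Y) V} \<subseteq> Pow (mspace Y)"
  using openin_subset[of "mtopology_of Y"] by auto

lemma space_borel_Y: "space borel_Y = mspace Y"
  unfolding borel_Y_def using opens_Pow by (rule space_measure_of)

lemma sets_borel_Y: "sets borel_Y = sigma_sets (mspace Y) {V. openin (mtopology_of Y) V}"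
  unfolding borel_Y_def using opens_Pow by (rule sets_measure_of)

lemma open_in_borel_Y: "openin (mtopology_of Y) V \<Longrightarrow> V \<in> sets borel_Y"
  unfolding sets_borel_Y by (rule sigma_sets.Basic) simp

lemma measurable_Lipschitz_Y:
  assumes "Lipschitz_continuous_map Y euclidean_metric (f :: _ \<Rightarrow> real)"
  shows "f \<in> borel_measurable borel_Y"
proof (rule borel_measurableI)
  fix G :: "real set" assume "open G"
  have "continuous_map (mtopology_of Y) euclidean f"
    using Lipschitz_continuous_imp_continuous_map[OF assms] by simp
  then have "openin (mtopology_of Y) {y \<in> topspace (mtopology_of Y). f y \<in> G}"
    using \<open>open G\<close> by (simp add: continuous_map_def)
  moreover have "f -` G \<inter> space borel_Y = {y \<in> topspace (mtopology_of Y). f y \<in> G}"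
    by (auto simp: space_borel_Y)
  ultimately show "f -` G \<inter> space borel_Y \<in> sets borel_Y" by (simp add: open_in_borel_Y)
qed

lemma sets_unstitched: "U - \<Union>\<I> \<in> sets lebesgue" "U - \<Union>\<I> \<in> sets borel"
  using borel_U borel_S by auto

lemma measurable_pr: "pr \<in> lebesgue_on (U - \<Union>\<I>) \<rightarrow>\<^sub>M borel_Y"
  unfolding borel_Y_def
proof (rule measurable_measure_of[OF opens_Pow])
  show "pr \<in> space (lebesgue_on (U - \<Union>\<I>)) \<rightarrow> mspace Y" by (auto simp: mspace_Y)
  fix V assume "V \<in> {V. openin (mtopology_of Y) V}"
  moreover have "continuous_map (top_of_set U) (mtopology_of Y) pr"
    using Lipschitz_continuous_imp_continuous_map[OF Lipschitz_pr] by (simp add: mtopology_of_submetric)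
  ultimately have "openin (top_of_set U) {x \<in> U. pr x \<in> V}" by (simp add: continuous_map_def)
  then obtain G where G: "open G" "{x \<in> U. pr x \<in> V} = U \<inter> G" by (auto simp: openin_open)
  have "pr -` V \<inter> space (lebesgue_on (U - \<Union>\<I>)) = (U - \<Union>\<I>) \<inter> G" using G(2) by auto
  moreover have "(U - \<Union>\<I>) \<inter> G \<in> sets lebesgue" using sets_unstitched(2) G(1) by auto
  ultimately show "pr -` V \<inter> space (lebesgue_on (U - \<Union>\<I>)) \<in> sets (lebesgue_on (U - \<Union>\<I>))"
    by (simp add: sets_restrict_space_iff sets_unstitched(1))
qed

definition mass_measure where "mass_measure = distr (lebesgue_on (U - \<Union>\<I>)) borel_Y pr"

lemma emeasure_mass_measure:
  assumes "B \<in> sets borel_Y"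
  shows "pr -` B \<inter> (U - \<Union>\<I>) \<in> sets lebesgue"
    "emeasure mass_measure B = emeasure lebesgue (pr -` B \<inter> (U - \<Union>\<I>))"
proof -
  have "pr -` B \<inter> (U - \<Union>\<I>) \<in> sets (lebesgue_on (U - \<Union>\<I>))"
    using measurable_sets[OF measurable_pr assms] by simp
  then show "pr -` B \<inter> (U - \<Union>\<I>) \<in> sets lebesgue" by (simp add: sets_restrict_space_iff sets_unstitched(1))
  show "emeasure mass_measure B = emeasure lebesgue (pr -` B \<inter> (U - \<Union>\<I>))"
    unfolding mass_measure_def using emeasure_distr[OF measurable_pr assms]
    by (simp add: emeasure_restrict_space sets_unstitched(1))
qed

text \<open>The Jacobian is bounded by the product of the Lipschitz constants and vanishes on the stitches, so only
  \<open>U - S\<close> contributes.\<close>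
lemma dominated_mass_measure: "current_dominated_by Y T mass_measure"
  unfolding current_dominated_by_def
proof (intro conjI allI impI)
  show "space mass_measure = mspace Y" by (simp add: mass_measure_def space_borel_Y)
  show "sets mass_measure = sigma_sets (mspace Y) {V. openin (mtopology_of Y) V}"
    by (simp add: mass_measure_def sets_borel_Y)
  have "emeasure lebesgue (U - \<Union>\<I>) \<le> emeasure lebesgue U"
    using borel_U by (intro emeasure_mono) auto
  also have "\<dots> < \<infinity>" using lmeasurable_compact[OF compact_U] unfolding fmeasurable_def by blast
  finally have fin: "emeasure lebesgue (U - \<Union>\<I>) < \<infinity>" .
  show "finite_measure mass_measure"
  proof
    have "space mass_measure \<in> sets borel_Y" by (simp add: mass_measure_def)
    note emeasure_mass_measure(2)[OF this]
    also have "emeasure lebesgue (pr -` space mass_measure \<inter> (U - \<Union>\<I>)) \<le> emeasure lebesgue (U - \<Union>\<I>)"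
      by (rule emeasure_mono[OF Int_lower2 sets_unstitched(1)])
    finally show "emeasure mass_measure (space mass_measure) \<noteq> \<infinity>" using fin by auto
  qed
  fix f and h :: "'n \<Rightarrow> _" assume fh: "current_tuple Y f h"
  have h: "\<And>i. Lipschitz_continuous_map Y euclidean_metric (h i)"
    and f: "Lipschitz_continuous_map Y euclidean_metric f" using fh by (auto simp: current_tuple_def)
  obtain J where J: "J \<in> borel_measurable borel"
    "\<And>x. \<bar>J x\<bar> \<le> (\<Prod>i\<in>UNIV. lip_const Y euclidean_metric (h i))"
    and jac: "\<And>A. A \<subseteq> U \<Longrightarrow> has_jacobian_ae A (\<lambda>i. h i \<circ> pr) J"
    and J0: "AE x in lebesgue. x \<in> U \<inter> \<Union>\<I> \<longrightarrow> J x = 0"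
    using jacobian_off_stitches[of h, OF h] by blast
  let ?P = "\<Prod>i\<in>UNIV. lip_const Y euclidean_metric (h i)"
  have i1: "set_integrable lebesgue (U - \<Union>\<I>) (\<lambda>x. (f \<circ> pr) x * J x)"
    by (rule integrable_current_density(2)[OF fh J sets_unstitched(1)]) blast
  have "set_integrable lebesgue (U - \<Union>\<I>) (\<lambda>x. (f \<circ> pr) x * 1)"
    by (rule integrable_current_density(2)[OF fh _ _ sets_unstitched(1), of "\<lambda>_. 1" 1]) auto
  then have i2: "set_integrable lebesgue (U - \<Union>\<I>) (\<lambda>x. \<bar>(f \<circ> pr) x\<bar>)"
    using set_integrable_abs by fastforce
  have "\<bar>T f h\<bar> = \<bar>LINT x:U - \<Union>\<I>|lebesgue. (f \<circ> pr) x * J x\<bar>"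
    using current_eq_jacobian_integral[OF fh J jac J0] by simp
  also have "\<dots> \<le> (LINT x:U - \<Union>\<I>|lebesgue. \<bar>(f \<circ> pr) x * J x\<bar>)"
    using set_integral_norm_bound[OF i1] by simp
  also have "\<dots> \<le> (LINT x:U - \<Union>\<I>|lebesgue. ?P * \<bar>(f \<circ> pr) x\<bar>)"
  proof (rule set_integral_mono)
    show "set_integrable lebesgue (U - \<Union>\<I>) (\<lambda>x. \<bar>(f \<circ> pr) x * J x\<bar>)" by (rule set_integrable_abs[OF i1])
    show "set_integrable lebesgue (U - \<Union>\<I>) (\<lambda>x. ?P * \<bar>(f \<circ> pr) x\<bar>)" using i2 by simp
    show "\<bar>(f \<circ> pr) x * J x\<bar> \<le> ?P * \<bar>(f \<circ> pr) x\<bar>" for x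
      unfolding abs_mult using J(2)[of x] by (subst mult.commute) (rule mult_right_mono, auto)
  qed
  also have "\<dots> = ?P * (LINT x:U - \<Union>\<I>|lebesgue. \<bar>(f \<circ> pr) x\<bar>)" by simp
  also have "(LINT x:U - \<Union>\<I>|lebesgue. \<bar>(f \<circ> pr) x\<bar>) = (LINT y|mass_measure. \<bar>f y\<bar>)"
    unfolding mass_measure_def
    using measurable_Lipschitz_Y[OF f] sets_unstitched(1)
    by (subst integral_distr[OF measurable_pr]) (auto simp: set_lebesgue_integral_def integral_restrict_space)
  finally show "\<bar>T f h\<bar> \<le> ?P * (LINT y|mass_measure. \<bar>f y\<bar>)" .
qed

text \<open>Points within \<open>r / 4\<close> of \<open>K\<close> stay \<open>3 r / 4\<close> away from the stitches, and any two of them are at most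
  \<open>3 r / 4\<close> apart.\<close>
lemma isometry_near_unstitched:
  assumes K: "K \<subseteq> U" and r: "r > 0" and far: "\<And>x z. x \<in> K \<Longrightarrow> z \<in> \<Union>\<I> \<Longrightarrow> r \<le> dist x z"
    and small: "\<And>x y. x \<in> K \<Longrightarrow> y \<in> K \<Longrightarrow> dist x y \<le> r / 4"
    and v: "k \<in> K" "dist k v \<le> r / 4" and w: "l \<in> K" "dist l w \<le> r / 4"
  shows "mdist Y (pr v) (pr w) = dist v w"
proof (rule antisym[OF mdist_pr_le])
  have "3 * r / 4 \<le> dist v z" if "z \<in> \<Union>\<I>" for z
    using far[OF v(1) that] v(2) dist_triangle[of k z v] by simp
  then have "min (dist v w) (3 * r / 4) \<le> mdist Y (pr v) (pr w)" using r by (intro mdist_pr_ge) auto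
  moreover have "dist v w \<le> 3 * r / 4"
    using v(2) w(2) small[OF v(1) w(1)] dist_triangle[of v w k] dist_triangle[of k w l]
    by (simp add: dist_commute)
  ultimately show "dist v w \<le> mdist Y (pr v) (pr w)" by simp
qed

lemma preimage_near_unstitched:
  assumes r: "r > 0" and far: "\<And>z. z \<in> \<Union>\<I> \<Longrightarrow> r \<le> dist k z" and "mdist Y (pr v) (pr k) < e" "e \<le> r"
  shows "dist k v < e"
proof -
  interpret Ym: Metric_space "mspace Y" "mdist Y" by (rule Metric_space_mspace_mdist)
  have "min (dist k v) r \<le> mdist Y (pr k) (pr v)" by (rule mdist_pr_ge[OF r far])
  then show ?thesis using assms(3,4) Ym.commute[of "pr v" "pr k"] by auto
qed

text \<open>The test functions are a bump that is 1 on \<open>\<pi>(K)\<close> and vanishes off a small neighbourhood, and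
  1-Lipschitz extensions of the coordinates from that neighbourhood.  Their Jacobian is 1 there, so
  \<open>T\<close> returns at least the volume of \<open>K\<close>, while domination bounds it by the measure of the
  neighbourhood.  Shrinking the bump leaves \<open>\<pi>(K)\<close>.\<close>
lemma compact_le_dominating:
  assumes \<nu>: "current_dominated_by Y T \<nu>"
    and K: "compact K" "K \<subseteq> U - \<Union>\<I>" and r: "r > 0"
    and far: "\<And>x z. x \<in> K \<Longrightarrow> z \<in> \<Union>\<I> \<Longrightarrow> r \<le> dist x z"
    and small: "\<And>x y. x \<in> K \<Longrightarrow> y \<in> K \<Longrightarrow> dist x y \<le> r / 4"
  shows "emeasure lebesgue K \<le> emeasure \<nu> (pr ` K)"
proof (cases "K = {}")
  case True
  then show ?thesis by simp
next
  case ne: False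
  interpret Ym: Metric_space "mspace Y" "mdist Y" by (rule Metric_space_mspace_mdist)
  interpret \<nu>: finite_measure \<nu> using \<nu> by (simp add: current_dominated_by_def)
  have sp\<nu>: "space \<nu> = mspace Y" and sets\<nu>: "sets \<nu> = sets borel_Y"
    using \<nu> by (auto simp: current_dominated_by_def sets_borel_Y)
  have KU: "K \<subseteq> U" using K by blast
  \<comment> \<open>On \<open>\<pi>(N)\<close> the smocked distance is the Euclidean one.\<close>
  define N where "N = {v \<in> U. \<exists>k\<in>K. dist k v \<le> r / 4}"
  have KN: "K \<subseteq> N" using KU r by (force simp: N_def)
  have NS: "v \<notin> \<Union>\<I>" if v: "v \<in> N" for v
  proof
    assume "v \<in> \<Union>\<I>"
    moreover obtain k where "k \<in> K" "dist k v \<le> r / 4" using v unfolding N_def by blast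
    ultimately show False using far[of k v] r by simp
  qed
  have "N \<subseteq> U" by (auto simp: N_def)
  then have NU: "N \<subseteq> U - \<Union>\<I>" using NS by blast
  have prN: "projl (pr v) = v" if "v \<in> N" for v
    using smocking_map_outside[OF smock NS[OF that]] by simp
  have iso: "mdist Y (pr v) (pr w) = dist v w" if vw: "v \<in> N" "w \<in> N" for v w
  proof -
    obtain k l where kl: "k \<in> K" "dist k v \<le> r / 4" "l \<in> K" "dist l w \<le> r / 4"
      using vw unfolding N_def by blast
    show ?thesis by (rule isometry_near_unstitched[OF KU r _ _ kl]) (fact far small)+
  qed
  have "\<exists>F. (\<forall>v\<in>N. F (pr v) = v $ i) \<and> (\<forall>y\<in>mspace Y. \<forall>y'\<in>mspace Y. \<bar>F y - F y'\<bar> \<le> mdist Y y y')" for i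
  proof -
    have "pr ` N \<subseteq> mspace Y" using NU by (auto simp: mspace_Y)
    moreover have "\<bar>projl y $ i - projl y' $ i\<bar> \<le> 1 * mdist Y y y'" if yy: "y \<in> pr ` N" "y' \<in> pr ` N" for y y'
    proof -
      obtain v w where vw: "v \<in> N" "w \<in> N" "y = pr v" "y' = pr w" using yy by blast
      have "\<bar>v $ i - w $ i\<bar> \<le> dist v w" using component_le_norm_cart[of "v - w" i] by (simp add: dist_norm)
      then show ?thesis using vw by (simp add: prN iso)
    qed
    ultimately obtain F where F: "\<And>y. y \<in> pr ` N \<Longrightarrow> F y = projl y $ i"
       "\<And>y y'. y \<in> mspace Y \<Longrightarrow> y' \<in> mspace Y \<Longrightarrow> \<bar>F y - F y'\<bar> \<le> 1 * mdist Y y y'"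
      using Ym.mcshane[of "pr ` N" 1 "\<lambda>y. projl y $ i"] by (metis zero_le_one)
    then show ?thesis by (intro exI[of _ F]) (auto simp: prN)
  qed
  then obtain h where h: "\<And>i v. v \<in> N \<Longrightarrow> h i (pr v) = v $ i"
     "\<And>i y y'. y \<in> mspace Y \<Longrightarrow> y' \<in> mspace Y \<Longrightarrow> \<bar>h i y - h i y'\<bar> \<le> mdist Y y y'" by metis
  have Lip_h: "Lipschitz_continuous_map Y euclidean_metric (h i)" for i
    unfolding Lipschitz_continuous_map_def using h(2) by (auto simp: dist_real_def intro!: exI[of _ 1])
  have lc: "0 \<le> lip_const Y euclidean_metric (h i)" "lip_const Y euclidean_metric (h i) \<le> 1" for i
    using h(2) by (auto simp: dist_real_def intro!: lip_const_le lip_const_works(1)[OF Lip_h])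
  obtain J where J: "J \<in> borel_measurable borel"
    "\<And>x. \<bar>J x\<bar> \<le> (\<Prod>i\<in>UNIV. lip_const Y euclidean_metric (h i))"
    and jac: "\<And>A. A \<subseteq> U \<Longrightarrow> has_jacobian_ae A (\<lambda>i. h i \<circ> pr) J"
    and J0: "AE x in lebesgue. x \<in> U \<inter> \<Union>\<I> \<longrightarrow> J x = 0"
    using jacobian_off_stitches[of h, OF Lip_h] by blast
  have J1: "AE x in lebesgue. x \<in> N \<longrightarrow> J x = 1"
    by (rule has_jacobian_ae_coordinates[OF jac]) (use NU h(1) in auto)
  have "pr ` K \<subseteq> mspace Y" using KU by (auto simp: mspace_Y)
  \<comment> \<open>The smocked distance from \<open>\<pi>(K)\<close>.\<close>
  then obtain \<Phi> where \<Phi>: "\<And>y. y \<in> pr ` K \<Longrightarrow> \<Phi> y = 0"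
       "\<And>y y'. y \<in> mspace Y \<Longrightarrow> y' \<in> mspace Y \<Longrightarrow> \<bar>\<Phi> y - \<Phi> y'\<bar> \<le> 1 * mdist Y y y'"
       "\<And>y c. pr ` K \<noteq> {} \<Longrightarrow> y \<in> mspace Y \<Longrightarrow> \<Phi> y < c \<Longrightarrow> \<exists>w\<in>pr ` K. 0 + 1 * mdist Y y w < c"
    using Ym.mcshane[of "pr ` K" 1 "\<lambda>_. 0"] by auto
  have \<Phi>0: "0 \<le> \<Phi> y" if y: "y \<in> mspace Y" for y
  proof (rule ccontr)
    assume "\<not> 0 \<le> \<Phi> y"
    then obtain w where "mdist Y y w < 0" using \<Phi>(3)[of y 0] y ne by auto
    then show False using Ym.nonneg[of y w] by simp
  qed
  have near: "\<exists>k\<in>K. dist k v < e" if v: "v \<in> U" "\<Phi> (pr v) < e" "e \<le> r" for v e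
  proof -
    obtain k where k: "k \<in> K" "mdist Y (pr v) (pr k) < e"
      using \<Phi>(3)[of "pr v" e] v ne by (auto simp: mspace_Y)
    then have "dist k v < e" using preimage_near_unstitched[OF r far[OF k(1)] k(2)] v(3) by blast
    then show ?thesis using k(1) by blast
  qed
  define V where "V e = {y \<in> mspace Y. \<Phi> y < e}" for e
  have Lip_\<Phi>: "Lipschitz_continuous_map Y euclidean_metric \<Phi>"
    unfolding Lipschitz_continuous_map_def using \<Phi>(2) by (auto simp: dist_real_def intro!: exI[of _ 1])
  have V: "V e \<in> sets \<nu>" for e
  proof -
    have "V e = \<Phi> -` {..<e} \<inter> space borel_Y" by (auto simp: V_def space_borel_Y)
    then show ?thesis using measurable_sets[OF measurable_Lipschitz_Y[OF Lip_\<Phi>], of "{..<e}"] by (simp add: sets\<nu>)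
  qed
  have bound: "measure lebesgue K \<le> measure \<nu> (V e)" if e: "e > 0" "e \<le> r / 4" for e
  proof -
    define f where "f y = max 0 (1 - \<Phi> y / e)" for y
    have f01: "0 \<le> f y" "y \<in> mspace Y \<Longrightarrow> f y \<le> 1" for y
      using \<Phi>0[of y] e(1) by (auto simp: f_def)
    have Lip_f: "Lipschitz_continuous_map Y euclidean_metric f"
      unfolding Lipschitz_continuous_map_def
    proof (intro conjI exI[of _ "1 / e"] ballI)
      fix y y' assume y: "y \<in> mspace Y" "y' \<in> mspace Y"
      have "\<bar>f y - f y'\<bar> \<le> \<bar>\<Phi> y / e - \<Phi> y' / e\<bar>" unfolding f_def by linarith
      also have "\<dots> = 1 / e * \<bar>\<Phi> y - \<Phi> y'\<bar>" using e(1) by (simp add: abs_divide flip: diff_divide_distrib)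
      also have "\<dots> \<le> 1 / e * mdist Y y y'" using \<Phi>(2)[OF y] e(1) by (intro mult_left_mono) auto
      finally show "mdist euclidean_metric (f y) (f y') \<le> 1 / e * mdist Y y y'" by (simp add: dist_real_def)
    qed simp
    have fh: "current_tuple Y f h"
      unfolding current_tuple_def using Lip_f Lip_h f01 by (auto simp: bounded_iff intro!: exI[of _ 1])
    have f_out: "f (pr v) = 0" if "v \<in> U" "v \<notin> N" for v
    proof -
      have "\<not> \<Phi> (pr v) < e"
        using near[OF that(1), of e] e r that unfolding N_def by force
      then show ?thesis using e(1) by (simp add: f_def)
    qed
    have W: "set_integrable lebesgue (U - \<Union>\<I>) (\<lambda>x. (f \<circ> pr) x * J x)"
      by (rule integrable_current_density(2)[OF fh J sets_unstitched(1)]) blast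
    have "measure lebesgue K = (\<integral>x. indicator K x \<partial>lebesgue)" by simp
    also have "\<dots> \<le> (LINT x:U - \<Union>\<I>|lebesgue. (f \<circ> pr) x * J x)"
      unfolding set_lebesgue_integral_def
    proof (rule integral_mono_AE)
      show "integrable lebesgue (indicat_real K)"
        using lmeasurable_compact[OF K(1)] by (simp only: lmeasurable_iff_integrable)
      show "integrable lebesgue (\<lambda>x. indicator (U - \<Union>\<I>) x *\<^sub>R ((f \<circ> pr) x * J x))"
        using W by (simp add: set_integrable_def)
      show "AE x in lebesgue. indicat_real K x \<le> indicator (U - \<Union>\<I>) x *\<^sub>R ((f \<circ> pr) x * J x)"
        using J1
      proof eventually_elim
        case (elim x)
        show ?case
        proof (cases "x \<in> N")
          case True
          have "f (pr x) = 1" if "x \<in> K" using \<Phi>(1)[of "pr x"] that by (simp add: f_def)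
          then show ?thesis using True elim NU f01(1)[of "pr x"] by (auto simp: indicator_def)
        next
          case False
          then show ?thesis using KN f_out[of x] by (auto simp: indicator_def)
        qed
      qed
    qed
    also have "\<dots> = T f h" by (rule current_eq_jacobian_integral[OF fh J jac J0, symmetric])
    also have "\<dots> \<le> (\<Prod>i\<in>UNIV. lip_const Y euclidean_metric (h i)) * (LINT y|\<nu>. \<bar>f y\<bar>)"
      using \<nu> fh unfolding current_dominated_by_def by (meson abs_le_D1)
    also have "\<dots> \<le> 1 * (LINT y|\<nu>. \<bar>f y\<bar>)"
      using lc by (intro mult_right_mono prod_le_1) auto
    also have "(LINT y|\<nu>. \<bar>f y\<bar>) \<le> (LINT y|\<nu>. indicator (V e) y)"
    proof (rule integral_mono)
      have "f \<in> borel_measurable \<nu>"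
        using measurable_Lipschitz_Y[OF Lip_f] measurable_cong_sets[OF sets\<nu> refl] by blast
      then show "integrable \<nu> (\<lambda>y. \<bar>f y\<bar>)"
        using f01 by (intro \<nu>.integrable_const_bound[of _ 1]) (auto simp: sp\<nu>)
      show "integrable \<nu> (indicat_real (V e))" using V by (intro integrable_real_indicator) (simp_all add: \<nu>.emeasure_finite less_top[symmetric])
      fix y assume y: "y \<in> space \<nu>"
      show "\<bar>f y\<bar> \<le> indicat_real (V e) y"
        using f01[of y] y e(1) by (auto simp: sp\<nu> indicator_def V_def f_def)
    qed
    finally show ?thesis using V by (simp add: sets.sets_into_space Int_absorb2)
  qed
  define u where "u n = (r / 4) / real (Suc n)" for n
  have u: "u n > 0" "u n \<le> r / 4" for n using r by (auto simp: u_def field_simps)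
  have "(\<lambda>n. measure \<nu> (V (u n))) \<longlonglongrightarrow> measure \<nu> (\<Inter>n. V (u n))"
  proof (rule \<nu>.finite_Lim_measure_decseq)
    show "decseq (\<lambda>n. V (u n))"
    proof (rule decseq_SucI)
      fix n
      have "u (Suc n) \<le> u n" unfolding u_def using r by (intro divide_left_mono) auto
      then show "V (u (Suc n)) \<subseteq> V (u n)" by (auto simp: V_def)
    qed
  qed (use V in auto)
  then have le: "measure lebesgue K \<le> measure \<nu> (\<Inter>n. V (u n))"
    using bound u by (intro LIMSEQ_le_const) auto
  have "(\<Inter>n. V (u n)) = pr ` K"
  proof (intro equalityI subsetI)
    fix y assume "y \<in> pr ` K"
    then show "y \<in> (\<Inter>n. V (u n))" using \<Phi>(1) u(1) \<open>pr ` K \<subseteq> mspace Y\<close> by (auto simp: V_def)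
  next
    fix y assume y: "y \<in> (\<Inter>n. V (u n))"
    then obtain v where v: "v \<in> U" "y = pr v" by (auto simp: V_def mspace_Y)
    have "\<exists>k\<in>K. dist k v < e" if e: "e > 0" for e
    proof -
      have "e / (r / 4) > 0" using e r by simp
      then obtain n where "1 / real (Suc n) < e / (r / 4)" by (rule nat_approx_posE)
      then have "u n < e" using r by (simp add: u_def field_simps)
      moreover have "\<exists>k\<in>K. dist k v < u n"
        using y v(2) u(2)[of n] r by (intro near[OF v(1)]) (auto simp: V_def)
      ultimately show ?thesis by force
    qed
    then have "v \<in> closure K" unfolding closure_approachable by blast
    then show "y \<in> pr ` K" using compact_imp_closed[OF K(1)] v(2) by simp
  qed
  then show ?thesis
    using le lmeasurable_compact[OF K(1)] by (simp add: \<nu>.emeasure_eq_measure emeasure_eq_measure2)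
qed

text \<open>Inner regularity of Lebesgue measure reduces the comparison on a small ball to compact sets, and
  countably many small balls cover \<open>\<pi>(U - S)\<close> by Lindelof's theorem.\<close>
lemma mass_measure_minimal:
  assumes \<nu>: "current_dominated_by Y T \<nu>" and B: "B \<in> sets borel_Y"
  shows "emeasure mass_measure B \<le> emeasure \<nu> B"
proof -
  interpret Ym: Metric_space "mspace Y" "mdist Y" by (rule Metric_space_mspace_mdist)
  have sets\<nu>: "sets \<nu> = sets borel_Y" using \<nu> by (auto simp: current_dominated_by_def sets_borel_Y)
  have sets\<mu>: "sets mass_measure = sets borel_Y" by (simp add: mass_measure_def)
  let ?W = "U - \<Union>\<I>"
  have "\<forall>x\<in>?W. \<exists>r>0. \<forall>z\<in>\<Union>\<I>. r \<le> dist x z" using gap by blast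
  then obtain r where r: "\<And>x. x \<in> ?W \<Longrightarrow> r x > 0" "\<And>x z. x \<in> ?W \<Longrightarrow> z \<in> \<Union>\<I> \<Longrightarrow> r x \<le> dist x z" by metis
  obtain X where X: "countable X" "X \<subseteq> ?W" "?W \<subseteq> (\<Union>x\<in>X. ball x (r x / 16))"
  proof -
    obtain F where F: "F \<subseteq> (\<lambda>x. ball x (r x / 16)) ` ?W" "countable F" "\<Union>F = (\<Union>x\<in>?W. ball x (r x / 16))"
      using Lindelof[of "(\<lambda>x. ball x (r x / 16)) ` ?W"] by blast
    obtain X where X: "countable X" "X \<subseteq> ?W" "F = (\<lambda>x. ball x (r x / 16)) ` X"
      using countable_subset_image[of F "\<lambda>x. ball x (r x / 16)" ?W] F(1,2) by blast
    have "x \<in> ball x (r x / 16)" if "x \<in> ?W" for x using r(1)[OF that] by simp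
    then have "?W \<subseteq> \<Union>F" unfolding F(3) by blast
    then show thesis using that[OF X(1,2)] unfolding X(3) by blast
  qed
  define D where "D i = (if X = {} then {} else Ym.mball (pr (from_nat_into X i)) (r (from_nat_into X i) / 16))" for i
  have cover: "pr x \<in> (\<Union>i. D i)" if x: "x \<in> ?W" for x
  proof -
    obtain a where a: "a \<in> X" "x \<in> ball a (r a / 16)" using X(3) x by blast
    then obtain i where i: "a = from_nat_into X i" using from_nat_into_surj[OF X(1)] by metis
    have "mdist Y (pr a) (pr x) < r a / 16" using mdist_pr_le[of a x] a(2) by simp
    moreover have "pr a \<in> mspace Y" "pr x \<in> mspace Y" using a(1) X(2) x by (auto simp: mspace_Y)
    ultimately have "pr x \<in> D i" using a(1) i by (auto simp: D_def)
    then show ?thesis by blast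
  qed
  show ?thesis
  proof (rule emeasure_le_via_cover[of mass_measure \<nu> D])
    show "sets mass_measure = sets \<nu>" by (simp add: sets\<mu> sets\<nu>)
    show D: "D i \<in> sets \<nu>" for i
      unfolding sets\<nu> D_def by (auto intro!: open_in_borel_Y simp: mtopology_of_def)
    show "B \<in> sets \<nu>" using B sets\<nu> by simp
    have sp: "space mass_measure - (\<Union>i. D i) \<in> sets borel_Y"
      using D by (auto simp: mass_measure_def sets\<nu>)
    have "pr -` (space mass_measure - (\<Union>i. D i)) \<inter> ?W = {}" using cover by blast
    then show "emeasure mass_measure (space mass_measure - (\<Union>i. D i)) = 0"
      unfolding emeasure_mass_measure(2)[OF sp] by simp
    fix i C assume C: "C \<in> sets \<nu>" "C \<subseteq> D i"
    define E where "E = pr -` C \<inter> ?W"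
    have E: "E \<in> sets lebesgue" "emeasure mass_measure C = emeasure lebesgue E"
      using emeasure_mass_measure[of C] C sets\<nu> by (auto simp: E_def)
    show "emeasure mass_measure C \<le> emeasure \<nu> C"
    proof (rule ennreal_le_epsilon)
      fix e :: real assume e: "e > 0"
      obtain K where K: "closed K" "K \<subseteq> E" "E - K \<in> lmeasurable" "emeasure lebesgue (E - K) < ennreal e"
        using sets_lebesgue_inner_closed[OF E(1) e] by metis
      have "bounded K" using K(2) compact_imp_bounded[OF compact_U] by (rule_tac bounded_subset) (auto simp: E_def)
      then have cK: "compact K" using K(1) by (simp add: compact_eq_bounded_closed)
      have "emeasure lebesgue K \<le> emeasure \<nu> (pr ` K)"
      proof (cases "K = {}")
        case False
        then have Xne: "X \<noteq> {}" using K(2) C(2) by (auto simp: E_def D_def)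
        define a where "a = from_nat_into X i"
        have a: "a \<in> ?W" using from_nat_into[OF Xne, of i] X(2) by (auto simp: a_def)
        have near: "dist a x < r a / 16" if "x \<in> K" for x
        proof (rule preimage_near_unstitched[OF r(1)[OF a] r(2)[OF a]])
          have "pr x \<in> D i" using that K(2) C(2) by (auto simp: E_def)
          then show "mdist Y (pr x) (pr a) < r a / 16"
            using Xne by (simp add: D_def a_def Ym.commute)
          show "r a / 16 \<le> r a" using r(1)[OF a] by simp
        qed
        show ?thesis
        proof (rule compact_le_dominating[OF \<nu> cK, of "r a / 2"])
          show "K \<subseteq> ?W" using K(2) by (auto simp: E_def)
          show "r a / 2 > 0" using r(1)[OF a] by simp
          show "r a / 2 \<le> dist x z" if "x \<in> K" "z \<in> \<Union>\<I>" for x z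
            using near[OF that(1)] r(2)[OF a that(2)] r(1)[OF a] dist_triangle[of a z x] by linarith
          show "dist x y \<le> r a / 2 / 4" if "x \<in> K" "y \<in> K" for x y
            using near[OF that(1)] near[OF that(2)] dist_triangle3[of x y a] by simp
        qed
      qed simp
      also have "\<dots> \<le> emeasure \<nu> C" using K(2) C(1) by (intro emeasure_mono) (auto simp: E_def)
      finally have KC: "emeasure lebesgue K \<le> emeasure \<nu> C" .
      have "E = K \<union> (E - K)" using K(2) by blast
      then have "emeasure lebesgue E \<le> emeasure lebesgue K + emeasure lebesgue (E - K)"
        using emeasure_subadditive[of K lebesgue "E - K"] K(1,3) by (auto simp: fmeasurableD)
      also have "\<dots> \<le> emeasure \<nu> C + ennreal e" using KC K(4) by (intro add_mono) auto
      finally show "emeasure mass_measure C \<le> emeasure \<nu> C + ennreal e" unfolding E(2) .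
    qed
  qed
qed

lemma has_mass_T: "has_mass Y T (emeasure lebesgue (U - \<Union>\<I>))"
  unfolding has_mass_def
proof (intro exI[of _ mass_measure] conjI allI impI ballI)
  show "current_dominated_by Y T mass_measure" by (rule dominated_mass_measure)
  show "emeasure mass_measure B \<le> emeasure \<nu> B"
    if "current_dominated_by Y T \<nu>" "B \<in> sets mass_measure" for \<nu> B
    using mass_measure_minimal[OF that(1)] that(2) by (simp add: mass_measure_def)
  have "mspace Y \<in> sets borel_Y" using sets.top[of borel_Y] by (simp add: space_borel_Y)
  moreover have "pr -` mspace Y \<inter> (U - \<Union>\<I>) = U - \<Union>\<I>" by (auto simp: mspace_Y)
  ultimately show "emeasure lebesgue (U - \<Union>\<I>) = emeasure mass_measure (mspace Y)"
    using emeasure_mass_measure(2)[of "mspace Y"] by simp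
qed

end

section \<open>Rectifiable structure and mass of smocked balls\<close>

theorem theorem3p12:
  fixes \<I> :: "(real ^ 'n) set set" and p :: "(real ^ 'n) + (real ^ 'n) set" and R :: real
  assumes smock: "smocking \<I>" and p: "p \<in> smocked_points \<I>"
  shows
    "let S = \<Union>\<I>;
         \<pi> = smocking_map \<I>;
         X = smocked_space \<I>;
         Y = submetric X (mcball_of X p R);
         U = \<pi> -` mcball_of X p R;
         A = smocking_piece S U;
         T = pushforward \<pi> (integration_current U);
         T' = pushforward \<pi> (- integration_current U)
     in weight_one_structure Y T (\<lambda>_. \<pi>) A \<and>
        (\<exists>\<phi> B. weight_one_structure Y T' \<phi> B) \<and>
        (\<forall>f h. current_tuple Y f h \<longrightarrow>
           (\<lambda>k. LINT x:A k|lebesgue.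
              (f \<circ> \<pi>) x *
              det (matrix (frechet_derivative (\<lambda>x. \<chi> i. (h i \<circ> \<pi>) x) (at x within A k))))
           sums T f h) \<and>
        has_mass Y T (emeasure lebesgue (U - S)) \<and>
        (negligible (U \<inter> S) \<longrightarrow> has_mass Y T (emeasure lebesgue U))"
proof -
  interpret B: smocked_ball \<I> p R by (rule smocked_ball.intro[OF smock p])
  let ?S = "\<Union>\<I>" and ?\<pi> = "smocking_map \<I>"
  have "linear (id :: real^'n \<Rightarrow> _)" by (simp add: linear_id)
  then have "weight_one_structure B.Y (\<lambda>f h. det (matrix (id :: real^'n \<Rightarrow> _)) * B.T f h)
      (\<lambda>_. ?\<pi> \<circ> id) (\<lambda>k. id -` smocking_piece ?S B.U k)"
    by (rule B.weight_one_structure_involution) (auto simp: id_def distr_id2)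
  then have plus: "weight_one_structure B.Y B.T (\<lambda>_. ?\<pi>) (smocking_piece ?S B.U)"
    by (simp add: matrix_id_mat_1)
  have "weight_one_structure B.Y (\<lambda>f h. det (matrix (coordinate_reflection :: real^'n \<Rightarrow> _)) * B.T f h)
      (\<lambda>_. ?\<pi> \<circ> coordinate_reflection) (\<lambda>k. coordinate_reflection -` smocking_piece ?S B.U k)"
    by (rule B.weight_one_structure_involution[OF linear_coordinate_reflection coordinate_reflection_involution
        dist_coordinate_reflection measurable_coordinate_reflection distr_coordinate_reflection])
  moreover have "(\<lambda>f h. det (matrix (coordinate_reflection :: real^'n \<Rightarrow> _)) * B.T f h) =
      pushforward ?\<pi> (- integration_current B.U)"
    by (simp add: fun_eq_iff det_coordinate_reflection B.T_def pushforward_def)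
  ultimately have minus: "\<exists>\<phi> C. weight_one_structure B.Y (pushforward ?\<pi> (- integration_current B.U)) \<phi> C"
    by metis
  have sums: "(\<lambda>k. LINT x:smocking_piece ?S B.U k|lebesgue. (f \<circ> ?\<pi>) x *
      det (matrix (frechet_derivative (\<lambda>x. \<chi> i. (h i \<circ> ?\<pi>) x) (at x within smocking_piece ?S B.U k)))) sums B.T f h"
    if "current_tuple B.Y f h" for f h
    using B.pieces_sums[OF that] unfolding integration_current_def .
  have mass: "has_mass B.Y B.T (emeasure lebesgue (B.U - ?S))" by (rule B.has_mass_T)
  have mass': "has_mass B.Y B.T (emeasure lebesgue B.U)" if "negligible (B.U \<inter> ?S)"
  proof -
    have "emeasure lebesgue (B.U - B.U \<inter> ?S) = emeasure lebesgue B.U"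
      using that B.borel_U by (intro emeasure_Diff_null_set) (auto simp: negligible_iff_null_sets)
    then show ?thesis using mass by (simp add: Diff_Int_distrib2[symmetric] Diff_Int)
  qed
  show ?thesis
    unfolding Let_def using plus minus sums mass mass' unfolding B.Y_def B.U_def B.T_def by blast
qed

end
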